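(* Under the standing assumption below, every optimal path $\omega\in(\underline{-1}\to\underline{+1})_{opt}$ visits $\tilde{\mathcal S}\cup\tilde{\mathcal D}$, i.e. $\omega\cap(\tilde{\mathcal S}\cup\tilde{\mathcal D})\neq\emptyset$; moreover $\tilde{\mathcal S}\cup\tilde{\mathcal D}$ is the union of all minimal gates for the transition from $\underline{-1}$ to $\underline{+1}$.
   Context: Let $\mathbb{T}^2$ denote the triangular lattice embedded in $\mathbb{R}^2$ and $\mathbb{H}^2$ its dual, the hexagonal lattice; each vertex $i$ of $\mathbb{H}^2$ is the centre of a unique closed triangular face of $\mathbb{T}^2$ (the face centred at $i$), and $d$ denotes the graph distance on $\mathbb{H}^2$, so $d(i,j)=1$ iff the faces centred at $i$ and $j$ share an edge. Fix an integer $L\ge1$ and let $\Lambda\subset\mathbb{H}^2$ be the set of sites in a parallelogram of side length $L$ cut along two coordinate axes of $\mathbb{T}^2$, with periodic boundary conditions; thus $\Lambda$ is a discrete torus with $|\Lambda|=2L^2$ sites, each having 3 nearest neighbours. Let $\mathcal X=\{-1,+1\}^\Lambda$ and let $\underline{+1}$, $\underline{-1}$ be the configurations with all spins $+1$, resp. $-1$. For $J,h>0$ the Hamiltonian is $H(\sigma)=-\frac J2\sum_{\{i,j\}\subset\Lambda:\,d(i,j)=1}\sigma(i)\sigma(j)-\frac h2\sum_{i\in\Lambda}\sigma(i)$ (sum over unordered nearest-neighbour pairs), so that $H(\sigma)-H(\underline{-1})=J|\gamma(\sigma)|-hN^+(\sigma)$, where $|\gamma(\sigma)|$ is the number of nearest-neighbour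 pairs carrying opposite spins and $N^+(\sigma)$ is the number of sites with spin $+1$. For $x\in\Lambda$, $\sigma^{(x)}$ denotes $\sigma$ with the spin at $x$ reversed. Standing assumption: $0<h<1$, $J\ge2h$, $\frac J{2h}-\frac12\notin\mathbb Z$, and $|\Lambda|\ge(4J/h)^2$. Set $r^*=\lfloor\frac J{2h}-\frac12\rfloor$, $\delta=\frac J{2h}-\frac12-r^*\in(0,1)$. Paths and gates: a path is a finite sequence $(\omega_1,\dots,\omega_n)$ in $\mathcal X$ with each $\omega_{k+1}=\omega_k^{(x)}$ for some $x\in\Lambda$; $\Theta(\sigma,\eta)$ is the set of paths from $\sigma$ to $\eta$; $\Phi(\sigma,\eta)=\min_{\omega\in\Theta(\sigma,\eta)}\max_{\zeta\in\omega}H(\zeta)$. The set $(\sigma\to\eta)_{opt}$ of optimal paths consists of the $\omega\in\Theta(\sigma,\eta)$ with $\max_{\zeta\in\omega}H(\zeta)=\Phi(\sigma,\eta)$. The set of minimal saddles $\mathscr S(\sigma,\eta)$ is the set of $\zeta$ such that some optimal path from $\sigma$ to $\eta$ contains $\zeta$ and $H(\zeta)=\Phi(\sigma,\eta)$. A gate is a set $\mathcal W\subseteq\mathscr S(\sigma,\eta)$ intersecting every optimal path from $\sigma$ to $\eta$; a gate is minimal if no proper subset of it is a gate. Geometry: for integers $d\ge1$, $a,b,c\ge0$ with $a+b,b+c,c+a\le d$, let $T^d_{a,b,c}$ be the union of faces of $\mathbb T^2$ obtained from an equilateral triangle of side length $d$ with sides on lattice lines (the union of its $d^2$ faces) by removing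 the equilateral sub-triangles of side lengths $a,b,c$ at its three corners; its boundary is a (possibly degenerate) hexagon with side lengths, in cyclic order, $a,\ d-a-b,\ b,\ d-b-c,\ c,\ d-c-a$. Let $Q^*=T^{3r^*+2}_{r^*,r^*,r^*+1}$ (side lengths $r^*,r^*+2,r^*,r^*+1,r^*+1,r^*+1$, area $6(r^* )^2+10r^*+3$) if $\delta\in(0,\frac12)$, and $Q^*=T^{3r^*+3}_{r^*,r^*+1,r^*+1}$ (side lengths $r^*,r^*+2,r^*+1,r^*+1,r^*+1,r^*+2$, area $6(r^*+1)^2+2(r^*+1)-1$) if $\delta\in(\frac12,1)$; in both cases the longest sides have length $\ell=r^*+2$. For a longest side $s$ of a copy $Q$ of $Q^*$ (image under a symmetry of $\mathbb T^2$), let $t_1,\dots,t_\ell$ be the faces outside $Q$ sharing an edge with $s$, in order along $s$, and for $1\le j\le\ell-1$ let $u_j$ be the face outside $Q$ sharing an edge with both $t_j$ and $t_{j+1}$. $\tilde{\mathcal S}$ is the set of configurations $\sigma$ whose set of faces centred at plus sites is exactly $Q\cup\{t_j,u_j\}$ or $Q\cup\{t_{j+1},u_j\}$ (two faces forming an elementary rhombus attached along $s$) for some such $Q$ placed in $\Lambda$, longest side $s$ and $1\le j\le\ell-1$; $\tilde{\mathcal D}$ is the set of configurations whose set of faces centred at plus sites is exactly $Q\cup\{t_j,t_{j+1}\}$ for some such $Q$, $s$, $j$. All configurations in $\tilde{\mathcal S}\cup\tilde{\mathcal D}$ have $N^+=\|Q^*\|+2$.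
   Formalization: The formal theorem additionally assumes δ ≠ 1/2: the standing assumption allows δ = 1/2 (J/(2h) an integer), but Q*, and hence S̃ and D̃, is only defined for δ in (0,1/2) or (1/2,1). *)

theory Defs
  imports Complex_Main
begin

text \<open>Vertices of the triangular lattice T^2 are written in lattice coordinates
  (a,b) standing for a*e1 + b*e2 with e1 = (1,0), e2 = (1/2, sqrt 3 / 2).
  Two vertices are lattice neighbours iff their difference is one of six unit vectors.\<close>

type_synonym vtx = "int \<times> int"

definition tri_adj :: "vtx \<Rightarrow> vtx \<Rightarrow> bool" where
  "tri_adj u v \<longleftrightarrow> (fst v - fst u, snd v - snd u) \<in>
     {(1,0),(-1,0),(0,1),(0,-1),(1,-1),(-1,1)}"

text \<open>A face (closed triangle) of T^2, equivalently a vertex of H^2, is written (a,b,o):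
  o = True is the upward triangle with vertices (a,b),(a+1,b),(a,b+1);
  o = False is the downward triangle with vertices (a+1,b),(a,b+1),(a+1,b+1).\<close>

type_synonym face = "int \<times> int \<times> bool"

fun vs :: "face \<Rightarrow> vtx set" where
  "vs (a, b, True) = {(a,b), (a+1,b), (a,b+1)}"
| "vs (a, b, False) = {(a+1,b), (a,b+1), (a+1,b+1)}"

definition face_adj :: "face \<Rightarrow> face \<Rightarrow> bool" where
  "face_adj f g \<longleftrightarrow> card (vs f \<inter> vs g) = 2"

definition lattice_sym :: "(vtx \<Rightarrow> vtx) \<Rightarrow> bool" where
  "lattice_sym g \<longleftrightarrow> bij g \<and> (\<forall>u v. tri_adj (g u) (g v) \<longleftrightarrow> tri_adj u v)"

definition img :: "(vtx \<Rightarrow> vtx) \<Rightarrow> face set \<Rightarrow> face set" where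
  "img g F = {f'. \<exists>f\<in>F. vs f' = g ` vs f}"

definition Lam :: "int \<Rightarrow> face set" where
  "Lam L = {(a,b,ori). 0 \<le> a \<and> a < L \<and> 0 \<le> b \<and> b < L}"

fun proj :: "int \<Rightarrow> face \<Rightarrow> face" where
  "proj L (a, b, ori) = (a mod L, b mod L, ori)"

definition torus_adj :: "int \<Rightarrow> face \<Rightarrow> face \<Rightarrow> bool" where
  "torus_adj L x y \<longleftrightarrow> x \<in> Lam L \<and> y \<in> Lam L \<and>
     (\<exists>x' y'. proj L x' = x \<and> proj L y' = y \<and> face_adj x' y')"

definition nn_pairs :: "int \<Rightarrow> face set set" where
  "nn_pairs L = {{x, y} | x y. torus_adj L x y}"

definition Conf :: "int \<Rightarrow> (face \<Rightarrow> int) set" where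
  "Conf L = {\<sigma>. (\<forall>x\<in>Lam L. \<sigma> x = 1 \<or> \<sigma> x = -1) \<and> (\<forall>x. x \<notin> Lam L \<longrightarrow> \<sigma> x = 0)}"

definition all_plus :: "int \<Rightarrow> face \<Rightarrow> int" where
  "all_plus L = (\<lambda>x. if x \<in> Lam L then 1 else 0)"

definition all_minus :: "int \<Rightarrow> face \<Rightarrow> int" where
  "all_minus L = (\<lambda>x. if x \<in> Lam L then -1 else 0)"

definition flip :: "(face \<Rightarrow> int) \<Rightarrow> face \<Rightarrow> face \<Rightarrow> int" where
  "flip \<sigma> x = \<sigma>(x := - \<sigma> x)"

definition plus_set :: "int \<Rightarrow> (face \<Rightarrow> int) \<Rightarrow> face set" where
  "plus_set L \<sigma> = {x \<in> Lam L. \<sigma> x = 1}"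

definition Ham :: "real \<Rightarrow> real \<Rightarrow> int \<Rightarrow> (face \<Rightarrow> int) \<Rightarrow> real" where
  "Ham J h L \<sigma> = - (J / 2) * (\<Sum>e\<in>nn_pairs L. \<Prod>i\<in>e. real_of_int (\<sigma> i))
                  - (h / 2) * (\<Sum>i\<in>Lam L. real_of_int (\<sigma> i))"

definition is_path :: "int \<Rightarrow> (face \<Rightarrow> int) list \<Rightarrow> bool" where
  "is_path L \<omega> \<longleftrightarrow> \<omega> \<noteq> [] \<and> set \<omega> \<subseteq> Conf L \<and>
     (\<forall>k. Suc k < length \<omega> \<longrightarrow> (\<exists>x\<in>Lam L. \<omega> ! Suc k = flip (\<omega> ! k) x))"

definition paths :: "int \<Rightarrow> (face \<Rightarrow> int) \<Rightarrow> (face \<Rightarrow> int) \<Rightarrow> (face \<Rightarrow> int) list set" where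
  "paths L \<sigma> \<eta> = {\<omega>. is_path L \<omega> \<and> hd \<omega> = \<sigma> \<and> last \<omega> = \<eta>}"

definition path_max :: "real \<Rightarrow> real \<Rightarrow> int \<Rightarrow> (face \<Rightarrow> int) list \<Rightarrow> real" where
  "path_max J h L \<omega> = Max (Ham J h L ` set \<omega>)"

text \<open>Communication height \<Phi>(\<sigma>,\<eta>); the set of values is finite (finitely many configurations).\<close>
definition Phi :: "real \<Rightarrow> real \<Rightarrow> int \<Rightarrow> (face \<Rightarrow> int) \<Rightarrow> (face \<Rightarrow> int) \<Rightarrow> real" where
  "Phi J h L \<sigma> \<eta> = Min (path_max J h L ` paths L \<sigma> \<eta>)"

definition opt_paths :: "real \<Rightarrow> real \<Rightarrow> int \<Rightarrow> (face \<Rightarrow> int) \<Rightarrow> (face \<Rightarrow> int) \<Rightarrow> (face \<Rightarrow> int) list set" where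
  "opt_paths J h L \<sigma> \<eta> = {\<omega> \<in> paths L \<sigma> \<eta>. path_max J h L \<omega> = Phi J h L \<sigma> \<eta>}"

definition min_saddles :: "real \<Rightarrow> real \<Rightarrow> int \<Rightarrow> (face \<Rightarrow> int) \<Rightarrow> (face \<Rightarrow> int) \<Rightarrow> (face \<Rightarrow> int) set" where
  "min_saddles J h L \<sigma> \<eta> = {\<zeta>. (\<exists>\<omega>\<in>opt_paths J h L \<sigma> \<eta>. \<zeta> \<in> set \<omega>) \<and> Ham J h L \<zeta> = Phi J h L \<sigma> \<eta>}"

definition is_gate :: "real \<Rightarrow> real \<Rightarrow> int \<Rightarrow> (face \<Rightarrow> int) \<Rightarrow> (face \<Rightarrow> int) \<Rightarrow> (face \<Rightarrow> int) set \<Rightarrow> bool" where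
  "is_gate J h L \<sigma> \<eta> W \<longleftrightarrow> W \<subseteq> min_saddles J h L \<sigma> \<eta> \<and>
     (\<forall>\<omega>\<in>opt_paths J h L \<sigma> \<eta>. set \<omega> \<inter> W \<noteq> {})"

definition is_min_gate :: "real \<Rightarrow> real \<Rightarrow> int \<Rightarrow> (face \<Rightarrow> int) \<Rightarrow> (face \<Rightarrow> int) \<Rightarrow> (face \<Rightarrow> int) set \<Rightarrow> bool" where
  "is_min_gate J h L \<sigma> \<eta> W \<longleftrightarrow> is_gate J h L \<sigma> \<eta> W \<and>
     (\<forall>W'. W' \<subset> W \<longrightarrow> \<not> is_gate J h L \<sigma> \<eta> W')"

text \<open>The big triangle of side d has corners (0,0), (d,0), (0,d). A face lies in a closed
  region iff all its vertices do. The corner sub-triangles of side a, b, c are at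
  (0,0), (d,0), (0,d) respectively.\<close>
definition Tshape :: "nat \<Rightarrow> nat \<Rightarrow> nat \<Rightarrow> nat \<Rightarrow> face set" where
  "Tshape d a b c =
     {f. (\<forall>(x,y)\<in>vs f. 0 \<le> x \<and> 0 \<le> y \<and> x + y \<le> int d)
       \<and> \<not> (\<forall>(x,y)\<in>vs f. 0 \<le> x \<and> 0 \<le> y \<and> x + y \<le> int a)
       \<and> \<not> (\<forall>(x,y)\<in>vs f. int d - int b \<le> x \<and> 0 \<le> y \<and> x + y \<le> int d)
       \<and> \<not> (\<forall>(x,y)\<in>vs f. 0 \<le> x \<and> int d - int c \<le> y \<and> x + y \<le> int d)}"

definition rstar :: "real \<Rightarrow> real \<Rightarrow> nat" where
  "rstar J h = nat \<lfloor>J / (2*h) - 1/2\<rfloor>"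

definition delta :: "real \<Rightarrow> real \<Rightarrow> real" where
  "delta J h = J / (2*h) - 1/2 - real (rstar J h)"

definition Qstar :: "real \<Rightarrow> real \<Rightarrow> face set" where
  "Qstar J h = (let r = rstar J h in
     if delta J h < 1/2 then Tshape (3*r+2) r r (r+1) else Tshape (3*r+3) r (r+1) (r+1))"

definition ell :: "real \<Rightarrow> real \<Rightarrow> nat" where
  "ell J h = rstar J h + 2"

text \<open>P has a side of length l on the horizontal line y = 0, running from vertex (x0,0)
  to (x0+l,0), with P on the upper side: the l upward faces above the segment are in P,
  the downward faces below are not, and the run of such boundary edges is maximal.\<close>
definition bottom_side :: "face set \<Rightarrow> nat \<Rightarrow> int \<Rightarrow> bool" where
  "bottom_side P l x0 \<longleftrightarrow>
     (\<forall>k. 0 \<le> k \<and> k < int l \<longrightarrow> (x0 + k, 0, True) \<in> P \<and> (x0 + k, -1, False) \<notin> P)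
     \<and> \<not> ((x0 - 1, 0, True) \<in> P \<and> (x0 - 1, -1, False) \<notin> P)
     \<and> \<not> ((x0 + int l, 0, True) \<in> P \<and> (x0 + int l, -1, False) \<notin> P)"

text \<open>For such a side: t_j = (x0+j-1,-1,down) for 1 \<le> j \<le> l, and u_j = (x0+j,-1,up)
  for 1 \<le> j \<le> l-1 (the face outside sharing an edge with t_j and t_{j+1}).\<close>
definition t_face :: "int \<Rightarrow> int \<Rightarrow> face" where
  "t_face x0 j = (x0 + j - 1, -1, False)"

definition u_face :: "int \<Rightarrow> int \<Rightarrow> face" where
  "u_face x0 j = (x0 + j, -1, True)"

text \<open>Sets of faces (in the plane) of the form Q \<union> R where Q is a copy of Q* and R is the
  attached pair; every copy/side is moved to the standard position by a symmetry g.\<close>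
definition S_shapes :: "real \<Rightarrow> real \<Rightarrow> face set set" where
  "S_shapes J h = {img g (P \<union> R) | g hh P x0 j R.
      lattice_sym g \<and> lattice_sym hh \<and> P = img hh (Qstar J h) \<and> bottom_side P (ell J h) x0
      \<and> 1 \<le> j \<and> j \<le> int (ell J h) - 1
      \<and> (R = {t_face x0 j, u_face x0 j} \<or> R = {t_face x0 (j+1), u_face x0 j})}"

definition D_shapes :: "real \<Rightarrow> real \<Rightarrow> face set set" where
  "D_shapes J h = {img g (P \<union> {t_face x0 j, t_face x0 (j+1)}) | g hh P x0 j.
      lattice_sym g \<and> lattice_sym hh \<and> P = img hh (Qstar J h) \<and> bottom_side P (ell J h) x0
      \<and> 1 \<le> j \<and> j \<le> int (ell J h) - 1}"

definition S_tilde :: "real \<Rightarrow> real \<Rightarrow> int \<Rightarrow> (face \<Rightarrow> int) set" where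
  "S_tilde J h L = {\<sigma> \<in> Conf L. \<exists>F\<in>S_shapes J h. plus_set L \<sigma> = proj L ` F}"

definition D_tilde :: "real \<Rightarrow> real \<Rightarrow> int \<Rightarrow> (face \<Rightarrow> int) set" where
  "D_tilde J h L = {\<sigma> \<in> Conf L. \<exists>F\<in>D_shapes J h. plus_set L \<sigma> = proj L ` F}"

end

theory Submission
  imports Defs
begin

text \<open>A face is given by the indices \<open>x, y, z\<close> of the three strips containing it, where \<open>x + y + z\<close> is \<open>0\<close> or \<open>-1\<close>.
  A droplet has at least as many boundary edges as it occupies strips, and peeling off extreme strips bounds the area
  of the intersection of the strips. Hence \<open>max_area n\<close> is the largest area with perimeter \<open>n\<close>, and the extremal
  droplets are exactly the central hexagons with nearly equal widths; \<open>Q*\<close> is the extremal one of perimeter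
  \<open>p = 6 r* + 5\<close> or \<open>6 r* + 7\<close>, unique up to congruence. The communication height turns out to be
  \<open>J (p + 2) - h (max_area p + 2)\<close>.

  On a path not exceeding this height, droplets larger than \<open>Q*\<close> whose area differs from that of \<open>Q*\<close> by an odd number have
  perimeter at most \<open>p + 1\<close>, and those in between at most \<open>p + 2\<close>. Following two steps at a time, a droplet that is a copy of \<open>Q*\<close>
  with one more face, or that does not fit into an extremal hexagon of perimeter \<open>p + 1\<close>, stays of that kind unless
  the middle configuration is \<open>Q*\<close> with two faces of the bar along a longest side. As the path must reach the area
  of the next hexagon, such a configuration is met.

  Conversely each of these configurations is the only point of maximal height on some path: downwards hexagons
  shrink bar by bar; upwards the bar is completed, and from perimeter \<open>6 r* + 8\<close> on translated
  hexagons are absorbed one after the other, where submodularity of the energy controls the height. So every gate contains all of them.\<close>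

section \<open>Strips and perimeter\<close>

text \<open>Flipping a face changes perimeter and area by odd numbers, so their parities always
  agree. Hence the face missing in \<open>max_area\<close>, and hence the sharper perimeter bound at
  odd offsets. At even offsets a droplet may leave the extremal shapes; no condition on it alone is
  preserved there, so the invariant remembers the droplet before. The critical size comes from
  \<open>2 r + 1 < J / h < 2 r + 3\<close>, the sizes of the last bar of \<open>Q*\<close> and of
  the bar following it. The first two faces of a bar cost one edge each, the third wins one back,
  and afterwards the perimeter alternates between one and two edges above that of \<open>Q*\<close>
  while the area grows; so the peak is at the second face. The torus is an obstacle twice. The
  isoperimetric inequality is planar, so droplets are cut open along an empty column and an empty
  row, and following a path needs room for one more face. And hexagons cannot grow forever without
  wrapping around; absorbing translates of one fixed size avoids every estimate on large
  droplets.\<close>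

fun xc :: "face \<Rightarrow> int" where "xc (a, b, u) = a"
fun yc :: "face \<Rightarrow> int" where "yc (a, b, u) = b"
fun zc :: "face \<Rightarrow> int" where "zc (a, b, u) = (if u then - a - b else - a - b - 1)"
fun isup :: "face \<Rightarrow> bool" where "isup (a, b, u) = u"

fun nx :: "face \<Rightarrow> face" where "nx (a, b, u) = (if u then (a - 1, b, False) else (a + 1, b, True))"
fun ny :: "face \<Rightarrow> face" where "ny (a, b, u) = (if u then (a, b - 1, False) else (a, b + 1, True))"
fun nz :: "face \<Rightarrow> face" where "nz (a, b, u) = (a, b, \<not> u)"

text \<open>Moving across an edge changes exactly one of the three coordinates; \<open>nx\<close>, \<open>ny\<close>, \<open>nz\<close> are the neighbours across the three kinds of edges.\<close>

definition sgn_up :: "face \<Rightarrow> int" where "sgn_up f = (if isup f then -1 else 1)"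

lemma nb_coords [simp]:
  "xc (nx f) = xc f + sgn_up f" "yc (nx f) = yc f" "zc (nx f) = zc f"
  "xc (ny f) = xc f" "yc (ny f) = yc f + sgn_up f" "zc (ny f) = zc f"
  "xc (nz f) = xc f" "yc (nz f) = yc f" "zc (nz f) = zc f + sgn_up f"
  "isup (nx f) = (\<not> isup f)" "isup (ny f) = (\<not> isup f)" "isup (nz f) = (\<not> isup f)"
  by (cases f; simp add: sgn_up_def)+

lemma coord_sum: "xc f + yc f + zc f = (if isup f then 0 else -1)"
  by (cases f) simp

lemma nb_nb [simp]: "nx (nx f) = f" "ny (ny f) = f" "nz (nz f) = f"
  by (cases f; simp)+

lemma nb_neq [simp]: "nx f \<noteq> f" "ny f \<noteq> f" "nz f \<noteq> f"
  by (cases f; simp)+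

lemma nb_distinct: "nx f \<noteq> ny f" "nx f \<noteq> nz f" "ny f \<noteq> nz f"
  by (cases f; simp)+

lemma face_eqI: "xc f = xc g \<Longrightarrow> yc f = yc g \<Longrightarrow> zc f = zc g \<Longrightarrow> f = g"
  by (cases f; cases g) (auto split: if_splits)

text \<open>The neighbour map is a parameter: the same count serves the three edge directions in the
  plane, their projections to the torus and the walks along strips.\<close>

definition bdry :: "('a \<Rightarrow> 'a) \<Rightarrow> 'a set \<Rightarrow> nat" where
  "bdry i W = card {f \<in> W. i f \<notin> W}"

definition per :: "face set \<Rightarrow> nat" where
  "per W = bdry nx W + bdry ny W + bdry nz W"

definition deg :: "face set \<Rightarrow> face \<Rightarrow> nat" where
  "deg W f = of_bool (nx f \<in> W) + of_bool (ny f \<in> W) + of_bool (nz f \<in> W)"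

text \<open>The involution pairs \<open>f\<close> with \<open>i f\<close>. If the partner is absent,
  the pair becomes a boundary edge; if it is present, the boundary edge at the partner
  disappears.\<close>

lemma bdry_insert:
  assumes fin: "finite W" and f: "f \<notin> W" and inv: "\<And>g. i (i g) = g" and nf: "i f \<noteq> f"
  shows "bdry i (insert f W) + 2 * of_bool (i f \<in> W) = bdry i W + 1"
proof (cases "i f \<in> W")
  case True
  have ifi: "i g = f \<longleftrightarrow> g = i f" for g using inv by metis
  have eq: "{g \<in> W. i g \<notin> W} = insert (i f) {g \<in> insert f W. i g \<notin> insert f W}"
    using True f inv ifi by auto
  have ni: "i f \<notin> {g \<in> insert f W. i g \<notin> insert f W}"
    using inv by simp
  have "bdry i W = bdry i (insert f W) + 1"
    unfolding bdry_def eq using fin ni by (subst card_insert_disjoint) auto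
  then show ?thesis using True by simp
next
  case False
  have ifi: "i g = f \<longleftrightarrow> g = i f" for g using inv by metis
  have eq: "{g \<in> insert f W. i g \<notin> insert f W} = insert f {g \<in> W. i g \<notin> W}"
    using False f nf ifi by auto
  have "bdry i (insert f W) = bdry i W + 1"
    unfolding bdry_def eq using fin f by (subst card_insert_disjoint) auto
  then show ?thesis using False by simp
qed

lemma per_insert:
  assumes "finite W" "f \<notin> W"
  shows "per (insert f W) + 2 * deg W f = per W + 3"
  using bdry_insert[OF assms, of nx] bdry_insert[OF assms, of ny] bdry_insert[OF assms, of nz]
  by (simp add: per_def deg_def)

lemma deg_mono: "A \<subseteq> B \<Longrightarrow> deg A f \<le> deg B f"
  unfolding deg_def by (intro add_mono) (auto simp: of_bool_def)

text \<open>An inserted face changes the perimeter by \<open>3 - 2 deg\<close>, which is odd, and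
  the area by 1.\<close>

lemma per_parity: "finite W \<Longrightarrow> even (per W + card W)"
proof (induction W rule: finite_induct)
  case empty
  then show ?case by (simp add: per_def bdry_def)
next
  case (insert f W)
  then have "per (insert f W) + 2 * deg W f = per W + 3" using per_insert by blast
  moreover have "card (insert f W) = card W + 1" using insert by simp
  ultimately show ?case using insert.IH by presburger
qed

lemma per_empty [simp]: "per {} = 0"
  by (simp add: per_def bdry_def)

lemma bdry_disjoint_Un:
  assumes "finite A" "finite B" "A \<inter> B = {}" "\<And>f. f \<in> A \<Longrightarrow> i f \<notin> B" "\<And>f. f \<in> B \<Longrightarrow> i f \<notin> A"
  shows "bdry i (A \<union> B) = bdry i A + bdry i B"
proof -
  have "{f \<in> A \<union> B. i f \<notin> A \<union> B} = {f \<in> A. i f \<notin> A} \<union> {f \<in> B. i f \<notin> B}"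
    using assms by blast
  moreover have "card ({f \<in> A. i f \<notin> A} \<union> {f \<in> B. i f \<notin> B}) = card {f \<in> A. i f \<notin> A} + card {f \<in> B. i f \<notin> B}"
    using assms by (intro card_Un_disjoint) auto
  ultimately show ?thesis by (simp add: bdry_def)
qed

text \<open>In the strips of a fixed coordinate \<open>c\<close>, a successor map \<open>s\<close> raises the key \<open>k\<close>;
  the last face of every occupied strip contributes a boundary edge.\<close>

lemma strips_le_bdry:
  fixes c k :: "'a \<Rightarrow> int"
  assumes "finite W" "\<And>f. c (s f) = c f" "\<And>f. k f < k (s f)"
  shows "card (c ` W) \<le> bdry s W"
proof -
  have "c ` W \<subseteq> c ` {f \<in> W. s f \<notin> W}"
  proof
    fix v assume "v \<in> c ` W"
    then have ne: "{f \<in> W. c f = v} \<noteq> {}" and fin: "finite {f \<in> W. c f = v}"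
      using assms(1) by auto
    obtain f where f: "f \<in> {f \<in> W. c f = v}" "k f = Max (k ` {f \<in> W. c f = v})"
      using Max_in[OF finite_imageI[OF fin] , of k] ne by (metis (no_types, lifting) imageE image_is_empty)
    have fmax: "k g \<le> k f" if "g \<in> {f \<in> W. c f = v}" for g
      unfolding f(2) using fin that by (intro Max_ge) auto
    have "s f \<notin> W"
    proof
      assume "s f \<in> W"
      then have "s f \<in> {f \<in> W. c f = v}" using f(1) assms(2) by simp
      then have "k (s f) \<le> k f" using fmax by blast
      then show False using assms(3)[of f] by simp
    qed
    then show "v \<in> c ` {f \<in> W. s f \<notin> W}" using f(1) by auto
  qed
  then have "card (c ` W) \<le> card (c ` {f \<in> W. s f \<notin> W})"
    using assms(1) by (intro card_mono) auto
  also have "\<dots> \<le> card {f \<in> W. s f \<notin> W}"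
    using assms(1) by (intro card_image_le) auto
  finally show ?thesis by (simp add: bdry_def)
qed

text \<open>Alternating two kinds of edges walks along a strip on which the third coordinate is constant.\<close>

definition alt :: "('a \<Rightarrow> bool) \<Rightarrow> ('a \<Rightarrow> 'a) \<Rightarrow> ('a \<Rightarrow> 'a) \<Rightarrow> 'a \<Rightarrow> 'a" where
  "alt u i j f = (if u f then i f else j f)"

text \<open>One alternation uses \<open>i\<close> on the faces satisfying \<open>u\<close> and
  \<open>j\<close> on the others, the opposite one the reverse; together they count every pair of a
  face and a direction once.\<close>

lemma bdry_alt:
  assumes "finite W"
  shows "bdry (alt u i j) W + bdry (alt u j i) W = bdry i W + bdry j W"
proof -
  have split: "bdry l W = card {f \<in> W. u f \<and> l f \<notin> W} + card {f \<in> W. \<not> u f \<and> l f \<notin> W}" for l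
  proof -
    have "{f \<in> W. l f \<notin> W} = {f \<in> W. u f \<and> l f \<notin> W} \<union> {f \<in> W. \<not> u f \<and> l f \<notin> W}"
      by blast
    moreover have "card ({f \<in> W. u f \<and> l f \<notin> W} \<union> {f \<in> W. \<not> u f \<and> l f \<notin> W})
        = card {f \<in> W. u f \<and> l f \<notin> W} + card {f \<in> W. \<not> u f \<and> l f \<notin> W}"
      using assms by (intro card_Un_disjoint) auto
    ultimately show ?thesis by (simp add: bdry_def)
  qed
  have 1: "{f \<in> W. u f \<and> alt u i j f \<notin> W} = {f \<in> W. u f \<and> i f \<notin> W}"
    "{f \<in> W. \<not> u f \<and> alt u i j f \<notin> W} = {f \<in> W. \<not> u f \<and> j f \<notin> W}" for i j
    by (auto simp: alt_def)
  show ?thesis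
    using split[of "alt u i j"] split[of "alt u j i"] split[of i] split[of j] by (simp add: 1)
qed

definition strips :: "face set \<Rightarrow> nat" where
  "strips W = card (xc ` W) + card (yc ` W) + card (zc ` W)"

text \<open>Every occupied strip has an end in both walking directions, and the edges crossed in
  strips of constant \<open>x\<close> are those of kinds \<open>ny\<close> and \<open>nz\<close>.
  Over the three coordinates each kind is used twice, so the factor 2 cancels.\<close>

lemma strips_le_per:
  assumes "finite W"
  shows "strips W \<le> per W"
proof -
  have "card (xc ` W) \<le> bdry (alt isup nz ny) W"
    by (rule strips_le_bdry[where k = "\<lambda>f. yc f - zc f"]) (use assms in \<open>auto simp: alt_def sgn_up_def\<close>)
  moreover have "card (xc ` W) \<le> bdry (alt isup ny nz) W"
    by (rule strips_le_bdry[where k = "\<lambda>f. zc f - yc f"]) (use assms in \<open>auto simp: alt_def sgn_up_def\<close>)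
  ultimately have x: "2 * card (xc ` W) \<le> bdry nz W + bdry ny W"
    using bdry_alt[OF assms, of isup nz ny] by linarith
  have "card (yc ` W) \<le> bdry (alt isup nx nz) W"
    by (rule strips_le_bdry[where k = "\<lambda>f. zc f - xc f"]) (use assms in \<open>auto simp: alt_def sgn_up_def\<close>)
  moreover have "card (yc ` W) \<le> bdry (alt isup nz nx) W"
    by (rule strips_le_bdry[where k = "\<lambda>f. xc f - zc f"]) (use assms in \<open>auto simp: alt_def sgn_up_def\<close>)
  ultimately have y: "2 * card (yc ` W) \<le> bdry nx W + bdry nz W"
    using bdry_alt[OF assms, of isup nx nz] by linarith
  have "card (zc ` W) \<le> bdry (alt isup ny nx) W"
    by (rule strips_le_bdry[where k = "\<lambda>f. xc f - yc f"]) (use assms in \<open>auto simp: alt_def sgn_up_def\<close>)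
  moreover have "card (zc ` W) \<le> bdry (alt isup nx ny) W"
    by (rule strips_le_bdry[where k = "\<lambda>f. yc f - xc f"]) (use assms in \<open>auto simp: alt_def sgn_up_def\<close>)
  ultimately have z: "2 * card (zc ` W) \<le> bdry ny W + bdry nx W"
    using bdry_alt[OF assms, of isup ny nx] by linarith
  show ?thesis using x y z by (simp add: strips_def per_def)
qed

section \<open>Area of an intersection of strips\<close>

text \<open>The index sets need not be intervals: the strips occupied by a droplet may have gaps,
  and the area bound has to cover those droplets too.\<close>

definition thull :: "int set \<Rightarrow> int set \<Rightarrow> int set \<Rightarrow> face set" where
  "thull X Y Z = {f. xc f \<in> X \<and> yc f \<in> Y \<and> zc f \<in> Z}"

lemma in_thull [simp]: "f \<in> thull X Y Z \<longleftrightarrow> xc f \<in> X \<and> yc f \<in> Y \<and> zc f \<in> Z"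
  by (simp add: thull_def)

text \<open>The turn by a third around the centre of the upward face at the origin. It cycles the
  coordinates, so that any one of them may be assumed to be the widest.\<close>

fun rot :: "face \<Rightarrow> face" where
  "rot (a, b, u) = (b, if u then - a - b else - a - b - 1, u)"

lemma rot_coords [simp]: "xc (rot f) = yc f" "yc (rot f) = zc f" "zc (rot f) = xc f"
  "isup (rot f) = isup f"
  by (cases f; simp)+

lemma rot3 [simp]: "rot (rot (rot f)) = f"
  by (rule face_eqI) simp_all

lemma bij_rot: "bij rot"
  by (rule o_bij[of "rot \<circ> rot"]) (auto simp: fun_eq_iff)

text \<open>Two coordinates and the orientation determine a face; the factor 2 is for the
  orientation.\<close>

lemma finite_hull:
  assumes "finite Y" "finite Z"
  shows "finite (thull X Y Z)" "card (thull X Y Z) \<le> 2 * card Y * card Z"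
proof -
  let ?g = "\<lambda>f. (yc f, zc f, isup f)"
  have inj: "inj_on ?g (thull X Y Z)"
    by (rule inj_onI) (auto intro: face_eqI)
  have sub: "?g ` thull X Y Z \<subseteq> Y \<times> Z \<times> UNIV"
    by auto
  have fin: "finite (Y \<times> Z \<times> (UNIV :: bool set))" using assms by simp
  show "finite (thull X Y Z)"
    using inj sub fin by (meson finite_imageD finite_subset)
  have "card (thull X Y Z) \<le> card (Y \<times> Z \<times> (UNIV :: bool set))"
    using inj sub fin by (rule card_inj_on_le)
  then show "card (thull X Y Z) \<le> 2 * card Y * card Z"
    by (simp add: card_cartesian_product)
qed

lemma image_rot_hull: "rot ` thull X Y Z = thull Y Z X"
proof
  show "rot ` thull X Y Z \<subseteq> thull Y Z X" by auto
  show "thull Y Z X \<subseteq> rot ` thull X Y Z"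
  proof
    fix f assume "f \<in> thull Y Z X"
    then have "rot (rot f) \<in> thull X Y Z" by simp
    then show "f \<in> rot ` thull X Y Z" by (metis image_eqI rot3)
  qed
qed

lemma card_hull_rot: "card (thull Y Z X) = card (thull X Y Z)"
  using card_image[OF inj_on_subset[OF bij_is_inj[OF bij_rot] subset_UNIV], of "thull X Y Z"]
  by (simp add: image_rot_hull)

text \<open>Both the strip of the least \<open>y\<close> and the strip of the largest \<open>z\<close> cut off the same end of a
  strip of constant \<open>x\<close>; together they remove at most two of its faces.\<close>

lemma hull_peel:
  assumes fin: "finite X" "finite Y" "finite Z" and ne: "Y \<noteq> {}" "Z \<noteq> {}"
  shows "card (thull X Y Z) \<le> 2 * card X + card (thull X (Y - {Min Y}) (Z - {Max Z}))"
proof -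
  let ?y = "Min Y" and ?z = "Max Z"
  let ?R = "\<lambda>a. {f \<in> thull X Y Z. xc f = a \<and> (yc f = ?y \<or> zc f = ?z)}"
  have R: "card (?R a) \<le> 2" for a
  proof -
    have low: "yc f \<ge> ?y" "zc f \<le> ?z" if "f \<in> ?R a" for f
      using that fin by auto
    \<comment> \<open>The test decides which of the two removed strips cuts the end of this column;
      the other one contributes no further face of the hull.\<close>
    have "?R a \<subseteq> (if - a - ?y \<le> ?z then {(a, ?y, True), (a, ?y, False)}
                 else {(a, - a - ?z, True), (a, - a - ?z - 1, False)})" (is "_ \<subseteq> ?S")
    proof
      fix f assume f: "f \<in> ?R a"
      then show "f \<in> ?S" using low[OF f] by (cases f) (auto split: if_splits)
    qed
    then have "card (?R a) \<le> card ?S" by (intro card_mono) auto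
    also have "\<dots> \<le> 2" by (auto simp: card_insert_if)
    finally show ?thesis .
  qed
  have finR: "finite (\<Union>a\<in>X. ?R a)"
    by (rule finite_subset[of _ "thull X Y Z"]) (use fin finite_hull in auto)
  have "thull X Y Z \<subseteq> thull X (Y - {?y}) (Z - {?z}) \<union> (\<Union>a\<in>X. ?R a)"
    by auto
  then have "card (thull X Y Z) \<le> card (thull X (Y - {?y}) (Z - {?z}) \<union> (\<Union>a\<in>X. ?R a))"
    using finR fin finite_hull(1) by (intro card_mono finite_UnI) auto
  also have "\<dots> \<le> card (thull X (Y - {?y}) (Z - {?z})) + card (\<Union>a\<in>X. ?R a)"
    by (rule card_Un_le)
  also have "card (\<Union>a\<in>X. ?R a) \<le> (\<Sum>a\<in>X. card (?R a))"
    using fin(1) by (rule card_UN_le)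
  also have "\<dots> \<le> (\<Sum>a\<in>X. 2)" by (intro sum_mono R)
  finally show ?thesis by simp
qed

text \<open>The upward faces of least \<open>y\<close> and the downward faces of largest \<open>z\<close> lie in different
  strips of constant \<open>x\<close>, so at most \<open>card X\<close> of them belong to the hull.\<close>

lemma hull_base:
  assumes fin: "finite X" "finite Y" "finite Z" and ne: "Y \<noteq> {}" "Z \<noteq> {}"
  shows "card (thull X Y Z) + card Y + card Z \<le> 2 * card Y * card Z + card X"
proof -
  let ?y = "Min Y" and ?z = "Max Z"
  let ?A = "{f \<in> thull X Y Z. isup f \<and> yc f = ?y \<or> \<not> isup f \<and> zc f = ?z}"
  let ?g = "\<lambda>f. (yc f, zc f)"
  let ?U = "{f \<in> thull X (Y - {?y}) Z. isup f}" and ?D = "{f \<in> thull X Y (Z - {?z}). \<not> isup f}"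
  have inj: "inj_on xc ?A"
  proof (rule inj_onI)
    fix f g assume f: "f \<in> ?A" and g: "g \<in> ?A" and eq: "xc f = xc g"
    have low: "yc f \<ge> ?y" "zc f \<le> ?z" "yc g \<ge> ?y" "zc g \<le> ?z"
      using f g fin by auto
    show "f = g" using f g eq low by (cases f; cases g) (auto split: if_splits)
  qed
  have A: "card ?A \<le> card X"
    using inj fin by (intro card_inj_on_le[of xc]) auto
  have U: "card ?U \<le> (card Y - 1) * card Z"
  proof -
    have "card ?U \<le> card ((Y - {?y}) \<times> Z)"
      using fin by (intro card_inj_on_le[of ?g]) (auto intro!: inj_onI face_eqI)
    then show ?thesis using fin ne by (simp add: card_cartesian_product)
  qed
  have D: "card ?D \<le> card Y * (card Z - 1)"
  proof -
    have "card ?D \<le> card (Y \<times> (Z - {?z}))"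
      using fin by (intro card_inj_on_le[of ?g]) (auto intro!: inj_onI face_eqI)
    then show ?thesis using fin ne by (simp add: card_cartesian_product)
  qed
  have "thull X Y Z \<subseteq> ?A \<union> (?U \<union> ?D)"
    by auto
  then have "card (thull X Y Z) \<le> card (?A \<union> (?U \<union> ?D))"
    using fin finite_hull(1) by (intro card_mono) (auto intro: finite_subset[OF _ finite_hull(1)[of Y Z X]])
  also have "\<dots> \<le> card ?A + (card ?U + card ?D)"
    by (meson add_left_mono card_Un_le order_trans)
  finally have *: "card (thull X Y Z) \<le> card X + ((card Y - 1) * card Z + card Y * (card Z - 1))"
    using A U D by linarith
  obtain m n where mn: "card Y = Suc m" "card Z = Suc n"
    using fin ne by (metis card_gt_0_iff gr0_implies_Suc)
  show ?thesis using * by (simp add: mn algebra_simps)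
qed

text \<open>The first bound ends the peeling with the product bound, the second with
  \<open>hull_base\<close>. The latter acts as half a peeling step, needed when the best number of
  steps, half of \<open>card Y + card Z - card X\<close>, is not an integer.\<close>

lemma hull_peel_iter:
  assumes "finite X" "finite Y" "finite Z" "t \<le> card Y" "t \<le> card Z"
  shows "card (thull X Y Z) \<le> 2 * t * card X + 2 * (card Y - t) * (card Z - t)"
    and "t < card Y \<Longrightarrow> t < card Z \<Longrightarrow> card (thull X Y Z) + (card Y - t) + (card Z - t)
        \<le> (2 * t + 1) * card X + 2 * (card Y - t) * (card Z - t)"
  using assms
proof (induction t arbitrary: Y Z)
  case 0
  {
    case 1
    then show ?case using finite_hull[of Y Z X] by simp
  next
    case 2
    then have "Y \<noteq> {}" "Z \<noteq> {}" by auto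
    then show ?case using hull_base[of X Y Z] 2 by simp
  }
next
  case (Suc t)
  have *: "card (thull X Y Z) \<le> 2 * card X + card (thull X (Y - {Min Y}) (Z - {Max Z}))"
    "card (Y - {Min Y}) = card Y - 1" "card (Z - {Max Z}) = card Z - 1"
    if "finite X" "finite Y" "finite Z" "Suc t \<le> card Y" "Suc t \<le> card Z" for Y Z
  proof -
    have "Y \<noteq> {}" "Z \<noteq> {}" using that by auto
    then show "card (thull X Y Z) \<le> 2 * card X + card (thull X (Y - {Min Y}) (Z - {Max Z}))"
      "card (Y - {Min Y}) = card Y - 1" "card (Z - {Max Z}) = card Z - 1"
      using hull_peel that by auto
  qed
  {
    case 1
    have "card (thull X (Y - {Min Y}) (Z - {Max Z}))
      \<le> 2 * t * card X + 2 * (card Y - 1 - t) * (card Z - 1 - t)"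
      using Suc.IH(1)[of "Y - {Min Y}" "Z - {Max Z}"] *(2,3)[OF 1] 1 by auto
    then show ?case using *(1)[OF 1] by (simp add: algebra_simps)
  next
    case 2
    note 3 = 2(3-7)
    have "card (thull X (Y - {Min Y}) (Z - {Max Z})) + (card Y - 1 - t) + (card Z - 1 - t)
      \<le> (2 * t + 1) * card X + 2 * (card Y - 1 - t) * (card Z - 1 - t)"
      using Suc.IH(2)[of "Y - {Min Y}" "Z - {Max Z}"] *(2,3)[OF 3] 2 by auto
    then show ?case using *(1)[OF 3] by (simp add: algebra_simps)
  }
qed

section \<open>Isoperimetric inequality\<close>

text \<open>The floor of \<open>n^2 / 6\<close>, except for \<open>n\<close> congruent to \<open>1\<close> or \<open>5\<close> modulo \<open>6\<close>: there this bound is not attained and one face is missing.\<close>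

definition max_area :: "nat \<Rightarrow> nat" where
  "max_area n = n * n div 6 - (if n mod 6 = 1 \<or> n mod 6 = 5 then 1 else 0)"

lemma max_area_mod6:
  "max_area (6 * k) = 6 * k * k"
  "max_area (6 * k + 1) = 6 * k * k + 2 * k - 1"
  "max_area (6 * k + 2) = 6 * k * k + 4 * k"
  "max_area (6 * k + 3) = 6 * k * k + 6 * k + 1"
  "max_area (6 * k + 4) = 6 * k * k + 8 * k + 2"
  "max_area (6 * k + 5) = 6 * k * k + 10 * k + 3"
proof -
  have e: "(6 * k) * (6 * k) = 6 * (6 * k * k)"
    "(6 * k + 1) * (6 * k + 1) = 1 + 6 * (6 * k * k + 2 * k)"
    "(6 * k + 2) * (6 * k + 2) = 4 + 6 * (6 * k * k + 4 * k)"
    "(6 * k + 3) * (6 * k + 3) = 3 + 6 * (6 * k * k + 6 * k + 1)"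
    "(6 * k + 4) * (6 * k + 4) = 4 + 6 * (6 * k * k + 8 * k + 2)"
    "(6 * k + 5) * (6 * k + 5) = 1 + 6 * (6 * k * k + 10 * k + 4)"
    by (simp_all add: algebra_simps)
  have m: "(6 * k) mod 6 = 0" "(6 * k + 1) mod 6 = 1" "(6 * k + 2) mod 6 = 2"
    "(6 * k + 3) mod 6 = 3" "(6 * k + 4) mod 6 = 4" "(6 * k + 5) mod 6 = 5"
    by presburger+
  have d: "(c + 6 * x) div 6 = x" if "c < 6" for c x :: nat
    using that by presburger
  show "max_area (6 * k) = 6 * k * k" unfolding max_area_def m e(1) by simp
  show "max_area (6 * k + 1) = 6 * k * k + 2 * k - 1" unfolding max_area_def m e(2) by (subst d) simp_all
  show "max_area (6 * k + 2) = 6 * k * k + 4 * k" unfolding max_area_def m e(3) by (subst d) simp_all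
  show "max_area (6 * k + 3) = 6 * k * k + 6 * k + 1" unfolding max_area_def m e(4) by (subst d) simp_all
  show "max_area (6 * k + 4) = 6 * k * k + 8 * k + 2" unfolding max_area_def m e(5) by (subst d) simp_all
  show "max_area (6 * k + 5) = 6 * k * k + 10 * k + 3" unfolding max_area_def m e(6) by (subst d) simp_all
qed

lemma mod6_exhaust:
  obtains k :: nat where "n = 6 * k" | k where "n = 6 * k + 1" | k where "n = 6 * k + 2"
    | k where "n = 6 * k + 3" | k where "n = 6 * k + 4" | k where "n = 6 * k + 5"
proof -
  have "n = 6 * (n div 6) + n mod 6" by simp
  moreover have "n mod 6 = 0 \<or> n mod 6 = 1 \<or> n mod 6 = 2 \<or> n mod 6 = 3 \<or> n mod 6 = 4 \<or> n mod 6 = 5"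
    by presburger
  ultimately show ?thesis using that by (metis add_0_right)
qed

text \<open>The 7 comes from \<open>n\<close> congruent to 1 or 5 modulo 6: the remainder 1 of the
  square, and 6 for the missing face.\<close>

lemma max_area_lower: "n * n \<le> 6 * max_area n + 7"
  by (cases n rule: mod6_exhaust; simp only: max_area_mod6) (auto simp: algebra_simps)

lemma max_area_lower_even: "even n \<Longrightarrow> n * n \<le> 6 * max_area n + 4"
  by (cases n rule: mod6_exhaust; simp only: max_area_mod6) (auto simp: algebra_simps)

lemma max_area_upper: "6 * max_area n \<le> n * n"
  by (cases n rule: mod6_exhaust; simp only: max_area_mod6) (auto simp: algebra_simps)

text \<open>For \<open>n\<close> congruent to 1 or 5 modulo 6 the floor of \<open>n^2 / 6\<close> is
  even while \<open>n\<close> is odd, so the parity condition excludes it. This is the origin of the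
  missing face.\<close>

lemma max_area_greatest:
  assumes "6 * m \<le> n * n" "even (m + n)"
  shows "m \<le> max_area n"
proof -
  have "m \<le> n * n div 6" using assms(1) by (simp add: less_eq_div_iff_mult_less_eq)
  moreover have "m \<noteq> n * n div 6" if c: "n mod 6 = 1 \<or> n mod 6 = 5"
  proof -
    define k where "k = n div 6"
    have "n = 6 * k + 1 \<or> n = 6 * k + 5" using c unfolding k_def by presburger
    then have "n * n = 6 * (2 * (3 * k * k + k)) + 1 \<or> n * n = 6 * (2 * (3 * k * k + 5 * k + 2)) + 1"
      by (elim disjE) (simp_all add: algebra_simps)
    moreover have "(6 * x + 1) div 6 = x" for x :: nat by presburger
    ultimately have "n * n div 6 = 2 * (3 * k * k + k) \<or> n * n div 6 = 2 * (3 * k * k + 5 * k + 2)"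
      by metis
    then have "even (n * n div 6)" by (metis dvd_triv_left)
    moreover have "odd n" using c by presburger
    ultimately show ?thesis using assms(2) by auto
  qed
  ultimately show ?thesis by (auto simp: max_area_def)
qed

lemma max_area_mod6_pred:
  "max_area (6 * k + 6) = 6 * k * k + 12 * k + 6"
  "max_area (6 * k + 7) = 6 * k * k + 14 * k + 7"
  "max_area (6 * k + 8) = 6 * k * k + 16 * k + 10"
  using max_area_mod6(1,2,3)[of "k + 1"] by (simp_all add: algebra_simps)

lemma max_area_less_Suc:
  assumes "2 \<le> n"
  shows "max_area n < max_area (Suc n)"
proof (cases n rule: mod6_exhaust)
  case (1 k)
  then have k: "k \<ge> 1" and n: "Suc n = 6 * k + 1" using assms by auto
  show ?thesis unfolding n unfolding 1 max_area_mod6 max_area_mod6_pred using k by linarith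
next
  case (2 k)
  then have k: "k \<ge> 1" and n: "Suc n = 6 * k + 2" using assms by auto
  show ?thesis unfolding n unfolding 2 max_area_mod6 max_area_mod6_pred using k by linarith
next
  case (3 k)
  then have n: "Suc n = 6 * k + 3" by simp
  show ?thesis unfolding n unfolding 3 max_area_mod6 max_area_mod6_pred by linarith
next
  case (4 k)
  then have n: "Suc n = 6 * k + 4" by simp
  show ?thesis unfolding n unfolding 4 max_area_mod6 max_area_mod6_pred by linarith
next
  case (5 k)
  then have n: "Suc n = 6 * k + 5" by simp
  show ?thesis unfolding n unfolding 5 max_area_mod6 max_area_mod6_pred by linarith
next
  case (6 k)
  then have n: "Suc n = 6 * k + 6" by simp
  show ?thesis unfolding n unfolding 6 max_area_mod6 max_area_mod6_pred by linarith
qed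

lemma max_area_mono: "m \<le> n \<Longrightarrow> max_area m \<le> max_area n"
proof (rule lift_Suc_mono_le[of max_area])
  fix n show "max_area n \<le> max_area (Suc n)"
    by (cases "2 \<le> n") (use max_area_less_Suc[of n] in \<open>auto simp: max_area_def not_le numeral_2_eq_2 less_Suc_eq\<close>)
qed

lemma max_area_strict:
  assumes "m < n" "3 \<le> n"
  shows "max_area m < max_area n"
proof -
  have "max_area m \<le> max_area (n - 1)" using assms by (intro max_area_mono) auto
  also have "\<dots> < max_area n" using max_area_less_Suc[of "n - 1"] assms by (simp add: Suc_diff_1)
  finally show ?thesis .
qed

text \<open>For extremal hexagons the increment is the size of the bar that leads from one to the
  next; comparing it with \<open>J / h\<close> tells whether the bar pays off.\<close>

lemma max_area_diff:
  assumes "n \<ge> 1"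
  shows "max_area n \<le> max_area (n - 1) + 2 * (n div 6) + 1"
proof (cases n rule: mod6_exhaust)
  case (1 k)
  then obtain j where "k = Suc j" using assms by (cases k) auto
  then have "n - 1 = 6 * j + 5" "n = 6 * j + 6" "n div 6 = j + 1" using 1 by auto
  then show ?thesis by (simp only: max_area_mod6 max_area_mod6_pred) simp
next
  case (2 k)
  then have m: "n - 1 = 6 * k" "n div 6 = k" by auto
  show ?thesis unfolding m unfolding 2 max_area_mod6 by linarith
next
  case (3 k)
  then have m: "n - 1 = 6 * k + 1" "n div 6 = k" by auto
  show ?thesis unfolding m unfolding 3 max_area_mod6 by linarith
next
  case (4 k)
  then have m: "n - 1 = 6 * k + 2" "n div 6 = k" by auto
  show ?thesis unfolding m unfolding 4 max_area_mod6 by linarith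
next
  case (5 k)
  then have m: "n - 1 = 6 * k + 3" "n div 6 = k" by auto
  show ?thesis unfolding m unfolding 5 max_area_mod6 by linarith
next
  case (6 k)
  then have m: "n - 1 = 6 * k + 4" "n div 6 = k" by auto
  show ?thesis unfolding m unfolding 6 max_area_mod6 by linarith
qed

text \<open>Translates a defect of at most 4 between \<open>n^2\<close> and six times an area bound
  into widths that differ by at most one.\<close>

lemma sumsq_small:
  fixes u v w :: int
  assumes "2 * ((u - v)\<^sup>2 + (v - w)\<^sup>2 + (w - u)\<^sup>2) \<le> 4"
  shows "\<bar>u - v\<bar> \<le> 1" "\<bar>v - w\<bar> \<le> 1" "\<bar>w - u\<bar> \<le> 1"
proof -
  have *: "\<bar>x\<bar> \<le> 1" if "x\<^sup>2 \<le> 2" for x :: int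
  proof (rule ccontr)
    assume "\<not> \<bar>x\<bar> \<le> 1"
    then have "2\<^sup>2 \<le> \<bar>x\<bar>\<^sup>2" by (intro power_mono) auto
    then show False using that by simp
  qed
  have "(u - v)\<^sup>2 \<ge> 0" "(v - w)\<^sup>2 \<ge> 0" "(w - u)\<^sup>2 \<ge> 0" by simp_all
  moreover have "x \<le> 2 \<and> y \<le> 2 \<and> z \<le> 2" if "2 * (x + y + z) \<le> 4" "0 \<le> x" "0 \<le> y" "0 \<le> z" for x y z :: int
    using that by presburger
  ultimately have "(u - v)\<^sup>2 \<le> 2" "(v - w)\<^sup>2 \<le> 2" "(w - u)\<^sup>2 \<le> 2"
    using assms by blast+
  then show "\<bar>u - v\<bar> \<le> 1" "\<bar>v - w\<bar> \<le> 1" "\<bar>w - u\<bar> \<le> 1"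
    using * by blast+
qed

text \<open>The peeling bound with \<open>t = (b + c - a) div 2\<close>, rewritten symmetrically: up to rounding the
  widths are \<open>u + v\<close>, \<open>u + t\<close>, \<open>v + t\<close> and the bound is \<open>2 (t u + t v + u v)\<close>.\<close>

lemma hull_area_max_first:
  fixes X Y Z :: "int set"
  defines "a \<equiv> card X" and "b \<equiv> card Y" and "c \<equiv> card Z"
  assumes fin: "finite X" "finite Y" "finite Z" and ge: "b \<le> a" "c \<le> a"
  shows "card (thull X Y Z) \<le> max_area (a + b + c)"
    and "card (thull X Y Z) = max_area (a + b + c) \<Longrightarrow> 3 \<le> a + b + c \<Longrightarrow> a \<le> b + 1 \<and> a \<le> c + 1"
proof -
  let ?T = "card (thull X Y Z)" and ?n = "a + b + c"
  have "?T \<le> max_area ?n \<and> (?T = max_area ?n \<longrightarrow> 3 \<le> ?n \<longrightarrow> a \<le> b + 1 \<and> a \<le> c + 1)"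
  proof (cases "a \<le> b + c")
    \<comment> \<open>One width exceeds the sum of the others, so there is nothing to balance by
      peeling; for a total of at least 3 the product bound alone stays strictly below
      \<open>max_area\<close>, and the equality case is void.\<close>
    case False
    have T: "?T \<le> 2 * b * c" using finite_hull[of Y Z X] fin by (simp add: b_def c_def)
    show ?thesis
    proof (cases "b = 0 \<or> c = 0")
      case True
      then have "?T = 0" using T by auto
      moreover have "max_area ?n > 0" if "3 \<le> ?n" using max_area_strict[of 0 ?n] that by linarith
      ultimately show ?thesis by auto
    next
      case bc: False
      have "(2 * (b + c) + 1) * (2 * (b + c) + 1) \<le> ?n * ?n"
        using False by (intro mult_mono) auto
      moreover have "12 * (b * c) + 7 < (2 * (b + c) + 1) * (2 * (b + c) + 1)"
      proof -
        have "int b \<ge> 1" "int c \<ge> 1" using bc by auto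
        moreover have "(int b - int c)\<^sup>2 \<ge> 0" by simp
        moreover have "int b * int c \<ge> 1" using \<open>int b \<ge> 1\<close> \<open>int c \<ge> 1\<close> by (simp add: mult_le_cancel_left1 order_trans zero_less_mult_iff int_one_le_iff_zero_less)
        ultimately have "12 * (int b * int c) + 7 < (2 * (int b + int c) + 1) * (2 * (int b + int c) + 1)"
          by (simp add: power2_eq_square algebra_simps)
        then have "int (12 * (b * c) + 7) < int ((2 * (b + c) + 1) * (2 * (b + c) + 1))"
          by (simp only: of_nat_add of_nat_mult of_nat_numeral of_nat_1)
        then show ?thesis using of_nat_less_iff by blast
      qed
      ultimately have "6 * ?T < 6 * max_area ?n" using T max_area_lower[of ?n] by (simp add: algebra_simps)
      then show ?thesis by simp
    qed
  next
    case True
    define t where "t = (b + c - a) div 2"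
    have tb: "t \<le> b" "t \<le> c" using ge True by (auto simp: t_def)
    define u v where "u = b - t" and "v = c - t"
    have bc: "b = u + t" "c = v + t" using tb by (auto simp: u_def v_def)
    show ?thesis
    proof (cases "even (b + c - a)")
      case ev: True
      then have "b + c - a = 2 * t" by (simp add: t_def)
      then have a: "a = u + v" using True bc by simp
      let ?B = "2 * (t * u + t * v + u * v)"
      have T: "?T \<le> ?B"
        using hull_peel_iter(1)[OF fin, of t] tb bc a
        by (simp add: b_def[symmetric] c_def[symmetric] a_def[symmetric] algebra_simps)
      have n: "?n = 2 * (u + v + t)" using a bc by simp
      \<comment> \<open>\<open>D\<close> is the exact gap between the square of the total and six
        times the bound. For an even total \<open>max_area\<close> leaves a gap of at most 4, so
        equality forces \<open>D\<close> to be at most 4.\<close>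
      define D where "D = 2 * ((int u - int v)\<^sup>2 + (int v - int t)\<^sup>2 + (int t - int u)\<^sup>2)"
      have "int (?n * ?n) = 6 * int ?B + D"
        unfolding n D_def by (simp add: power2_eq_square algebra_simps)
      moreover have "D \<ge> 0" by (simp add: D_def)
      ultimately have eq: "?n * ?n = 6 * ?B + nat D" by linarith
      then have B: "?B \<le> max_area ?n" by (intro max_area_greatest) (auto simp: n)
      have "?n * ?n \<le> 6 * max_area ?n + 4" by (rule max_area_lower_even) (auto simp: n)
      then have "D \<le> 4" if "?T = max_area ?n"
        using T that eq by linarith
      then have "\<bar>int v - int t\<bar> \<le> 1 \<and> \<bar>int t - int u\<bar> \<le> 1" if "?T = max_area ?n"
        using sumsq_small[of "int u" "int v" "int t"] that unfolding D_def by blast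
      then show ?thesis using T B a bc by auto
    next
      case odd: False
      then have m: "b + c - a = 2 * t + 1" unfolding t_def by presburger
      then have a: "a + 1 = u + v" using True bc by simp
      have uv: "u \<ge> 1" "v \<ge> 1" using m ge bc a by auto
      let ?B = "2 * (int t * u + int t * v + int u * v) - 2 * t - 1"
      have "?T + u + v \<le> (2 * t + 1) * a + 2 * u * v"
        using hull_peel_iter(2)[OF fin, of t] tb bc a uv
        by (simp add: b_def[symmetric] c_def[symmetric] a_def[symmetric] algebra_simps)
      then have "int ?T + u + v \<le> (2 * int t + 1) * int a + 2 * int u * int v"
        by (metis (mono_tags, lifting) of_nat_1 of_nat_add of_nat_le_iff of_nat_mult of_nat_numeral)
      moreover have ia: "int a = int u + int v - 1" using a by simp
      ultimately have T: "int ?T \<le> ?B" by (simp add: algebra_simps)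
      have n: "int ?n = 2 * (int u + int v + int t) - 1" using ia bc by simp
      \<comment> \<open>Rounding moves the balance point from \<open>t\<close> to
        \<open>t + 1\<close> and leaves a remainder 3; of the possible defect 7 again only 4 remains
        for \<open>D\<close>.\<close>
      define D where "D = 2 * ((int u - int v)\<^sup>2 + (int v - (int t + 1))\<^sup>2 + ((int t + 1) - int u)\<^sup>2)"
      have "int ?n * int ?n = 6 * ?B + D + 3"
        unfolding n D_def by (simp add: power2_eq_square algebra_simps)
      moreover have "D \<ge> 0" by (simp add: D_def)
      moreover have B0: "?B \<ge> 0" using T by linarith
      moreover have "N = 6 * nat B + nat D + 3" if "int N = 6 * B + D + 3" "0 \<le> D" "0 \<le> B" for N B D
        using that by linarith
      ultimately have eq: "?n * ?n = 6 * nat ?B + nat D + 3"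
        unfolding of_nat_mult[symmetric] by blast
      have "odd (nat ?B)" using B0 by (simp add: even_nat_iff)
      moreover have "odd (int ?n)" unfolding n by simp
      then have "odd ?n" by (metis even_of_nat)
      ultimately have B: "nat ?B \<le> max_area ?n" using eq by (intro max_area_greatest) auto
      have "?n * ?n \<le> 6 * max_area ?n + 7" by (rule max_area_lower)
      then have "D \<le> 4" if "?T = max_area ?n"
        using T that eq by linarith
      then have "\<bar>int v - (int t + 1)\<bar> \<le> 1 \<and> \<bar>(int t + 1) - int u\<bar> \<le> 1" if "?T = max_area ?n"
        using sumsq_small[of "int u" "int v" "int t + 1"] that unfolding D_def by blast
      then show ?thesis using T B a bc by auto
    qed
  qed
  then show "?T \<le> max_area ?n" "?T = max_area ?n \<Longrightarrow> 3 \<le> ?n \<Longrightarrow> a \<le> b + 1 \<and> a \<le> c + 1"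
    by auto
qed

lemma hull_area:
  assumes fin: "finite X" "finite Y" "finite Z"
  shows "card (thull X Y Z) \<le> max_area (card X + card Y + card Z)"
    and "card (thull X Y Z) = max_area (card X + card Y + card Z) \<Longrightarrow> 3 \<le> card X + card Y + card Z \<Longrightarrow>
      \<bar>int (card X) - int (card Y)\<bar> \<le> 1 \<and> \<bar>int (card Y) - int (card Z)\<bar> \<le> 1 \<and> \<bar>int (card Z) - int (card X)\<bar> \<le> 1"
proof -
  consider "card Y \<le> card X" "card Z \<le> card X" | "card Z \<le> card Y" "card X \<le> card Y"
    | "card X \<le> card Z" "card Y \<le> card Z"
    by linarith
  then have "card (thull X Y Z) \<le> max_area (card X + card Y + card Z) \<and>
    (card (thull X Y Z) = max_area (card X + card Y + card Z) \<longrightarrow> 3 \<le> card X + card Y + card Z \<longrightarrow>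
      \<bar>int (card X) - int (card Y)\<bar> \<le> 1 \<and> \<bar>int (card Y) - int (card Z)\<bar> \<le> 1 \<and> \<bar>int (card Z) - int (card X)\<bar> \<le> 1)"
  proof cases
    case 1
    then show ?thesis using hull_area_max_first[of X Y Z] fin by auto
  next
    case 2
    have "card Y + card Z + card X = card X + card Y + card Z" by simp
    then show ?thesis using hull_area_max_first[of Y Z X] fin 2 unfolding card_hull_rot[of Y Z X] \<open>card Y + card Z + card X = _\<close> by auto
  next
    case 3
    have "card Z + card X + card Y = card X + card Y + card Z" by simp
    then show ?thesis using hull_area_max_first[of Z X Y] fin 3 unfolding card_hull_rot[of Z X Y] card_hull_rot[of Y Z X] \<open>card Z + card X + card Y = _\<close> by auto
  qed
  then show "card (thull X Y Z) \<le> max_area (card X + card Y + card Z)"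
    "card (thull X Y Z) = max_area (card X + card Y + card Z) \<Longrightarrow> 3 \<le> card X + card Y + card Z \<Longrightarrow>
      \<bar>int (card X) - int (card Y)\<bar> \<le> 1 \<and> \<bar>int (card Y) - int (card Z)\<bar> \<le> 1 \<and> \<bar>int (card Z) - int (card X)\<bar> \<le> 1"
    by auto
qed

definition face_hull :: "face set \<Rightarrow> face set" where
  "face_hull W = thull (xc ` W) (yc ` W) (zc ` W)"

lemma face_hull_superset: "W \<subseteq> face_hull W"
  by (intro subsetI) (simp add: face_hull_def)

lemma finite_face_hull: "finite W \<Longrightarrow> finite (face_hull W)"
  by (simp add: face_hull_def finite_hull)

lemma card_le_strips:
  assumes "finite W"
  shows "card (face_hull W) \<le> max_area (strips W)" "card W \<le> card (face_hull W)"
  using hull_area(1)[of "xc ` W" "yc ` W" "zc ` W"] assms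
    card_mono[OF finite_face_hull face_hull_superset]
  by (auto simp: face_hull_def strips_def)

text \<open>The isoperimetric inequality of the triangular lattice: filling up to the hull keeps the
  occupied strips, and these are at most as many as the boundary edges.\<close>

lemma card_le_per: "finite W \<Longrightarrow> card W \<le> max_area (per W)"
  using card_le_strips[of W] strips_le_per[of W] max_area_mono order_trans by meson

section \<open>Isometries and extremal droplets\<close>

definition face_nb :: "face \<Rightarrow> face \<Rightarrow> bool" where
  "face_nb f g \<longleftrightarrow> g = nx f \<or> g = ny f \<or> g = nz f"

lemma face_nb_sym: "face_nb f g \<longleftrightarrow> face_nb g f"
  by (auto simp: face_nb_def)

definition face_iso :: "(face \<Rightarrow> face) \<Rightarrow> bool" where
  "face_iso \<phi> \<longleftrightarrow> bij \<phi> \<and> (\<forall>f g. face_nb (\<phi> f) (\<phi> g) \<longleftrightarrow> face_nb f g)"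

text \<open>A coordinate-free form of the perimeter, from which its invariance under automorphisms
  of the adjacency follows.\<close>

lemma per_pairs:
  assumes "finite W"
  shows "per W = card {(f, g). f \<in> W \<and> g \<notin> W \<and> face_nb f g}"
proof -
  let ?S = "\<lambda>i. (\<lambda>f. (f, i f)) ` {f \<in> W. i f \<notin> W}"
  have c: "card (?S i) = bdry i W" for i
    unfolding bdry_def by (rule card_image) (auto simp: inj_on_def)
  have fin: "finite (?S i)" for i using assms by auto
  have "{(f, g). f \<in> W \<and> g \<notin> W \<and> face_nb f g} = ?S nx \<union> ?S ny \<union> ?S nz"
    by (auto simp: face_nb_def)
  moreover have "card (?S nx \<union> ?S ny \<union> ?S nz) = card (?S nx) + card (?S ny) + card (?S nz)"
  proof -
    have "?S nx \<inter> ?S ny = {}" "(?S nx \<union> ?S ny) \<inter> ?S nz = {}"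
      using nb_distinct by blast+
    then show ?thesis using fin by (simp add: card_Un_disjoint)
  qed
  ultimately show ?thesis by (simp add: c per_def)
qed

lemma face_iso_inj: "face_iso \<phi> \<Longrightarrow> inj \<phi>"
  by (simp add: face_iso_def bij_def)

lemma face_iso_card: "face_iso \<phi> \<Longrightarrow> card (\<phi> ` W) = card W"
  by (meson card_image face_iso_inj inj_on_subset subset_UNIV)

lemma face_iso_per:
  assumes "face_iso \<phi>" "finite W"
  shows "per (\<phi> ` W) = per W"
proof -
  have inj: "inj \<phi>" and sur: "surj \<phi>" and nb: "\<And>f g. face_nb (\<phi> f) (\<phi> g) = face_nb f g"
    using assms(1) by (auto simp: face_iso_def bij_def)
  have "{(f, g). f \<in> \<phi> ` W \<and> g \<notin> \<phi> ` W \<and> face_nb f g}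
      = map_prod \<phi> \<phi> ` {(f, g). f \<in> W \<and> g \<notin> W \<and> face_nb f g}" (is "?A = ?B")
  proof
    show "?A \<subseteq> ?B"
    proof
      fix q assume q: "q \<in> ?A"
      obtain f g where fg: "q = (\<phi> f, \<phi> g)" using sur by (metis surj_def surj_pair)
      then have "f \<in> W" "g \<notin> W" "face_nb f g" using q inj nb by (auto simp: inj_image_mem_iff)
      then have "(f, g) \<in> {(f, g). f \<in> W \<and> g \<notin> W \<and> face_nb f g}" by simp
      then show "q \<in> ?B" unfolding fg by (metis (no_types, lifting) image_eqI map_prod_simp)
    qed
    show "?B \<subseteq> ?A"
    proof
      fix q assume "q \<in> ?B"
      then obtain f g where "q = (\<phi> f, \<phi> g)" "f \<in> W" "g \<notin> W" "face_nb f g" by blast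
      then show "q \<in> ?A" using inj nb by (simp add: inj_image_mem_iff)
    qed
  qed
  moreover have "inj_on (map_prod \<phi> \<phi>) {(f, g). f \<in> W \<and> g \<notin> W \<and> face_nb f g}"
    using inj_on_subset[OF prod.inj_map[OF inj inj]] by blast
  ultimately show ?thesis
    using assms(2) by (simp add: per_pairs card_image)
qed

lemma face_isoI:
  assumes "\<And>f. \<psi> (\<phi> f) = f" "\<And>f. \<phi> (\<psi> f) = f" "\<And>f. {\<phi> (nx f), \<phi> (ny f), \<phi> (nz f)} = {nx (\<phi> f), ny (\<phi> f), nz (\<phi> f)}"
  shows "face_iso \<phi>"
proof -
  have "bij \<phi>" using assms(1,2) by (intro o_bij[of \<psi>]) (auto simp: fun_eq_iff)
  moreover have "face_nb (\<phi> f) (\<phi> g) \<longleftrightarrow> face_nb f g" for f g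
  proof -
    have "face_nb (\<phi> f) (\<phi> g) \<longleftrightarrow> \<phi> g \<in> {nx (\<phi> f), ny (\<phi> f), nz (\<phi> f)}" by (simp add: face_nb_def)
    also have "\<dots> \<longleftrightarrow> \<phi> g \<in> {\<phi> (nx f), \<phi> (ny f), \<phi> (nz f)}" by (simp only: assms(3))
    also have "\<dots> \<longleftrightarrow> face_nb f g" using assms(1) by (auto simp: face_nb_def; metis)
    finally show ?thesis .
  qed
  ultimately show ?thesis by (simp add: face_iso_def)
qed

fun invf :: "face \<Rightarrow> face" where "invf (a, b, u) = (- a, - b, \<not> u)"
fun trf :: "int \<Rightarrow> int \<Rightarrow> face \<Rightarrow> face" where "trf i j (a, b, u) = (a + i, b + j, u)"

lemma invf_coords [simp]: "xc (invf f) = - xc f" "yc (invf f) = - yc f" "zc (invf f) = - zc f - 1"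
  "isup (invf f) = (\<not> isup f)"
  by (cases f; simp)+

lemma invf_invf [simp]: "invf (invf f) = f"
  by (cases f) simp

lemma trf_coords [simp]: "xc (trf i j f) = xc f + i" "yc (trf i j f) = yc f + j" "zc (trf i j f) = zc f - i - j"
  "isup (trf i j f) = isup f"
  by (cases f; simp)+

lemma trf_trf [simp]: "trf i j (trf k l f) = trf (i + k) (j + l) f" "trf 0 0 f = f"
  by (cases f; simp)+

lemma face_iso_invf: "face_iso invf"
proof (rule face_isoI[of invf])
  fix f show "{invf (nx f), invf (ny f), invf (nz f)} = {nx (invf f), ny (invf f), nz (invf f)}"
    by (cases f) auto
qed auto

lemma face_iso_trf: "face_iso (trf i j)"
proof (rule face_isoI[of "trf (- i) (- j)"])
  fix f show "{trf i j (nx f), trf i j (ny f), trf i j (nz f)} = {nx (trf i j f), ny (trf i j f), nz (trf i j f)}"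
    by (cases f) auto
qed auto

text \<open>A set whose area exceeds what two separated pieces of the same total perimeter can have.\<close>

definition tight :: "face set \<Rightarrow> bool" where
  "tight W \<longleftrightarrow> finite W \<and> 9 + (per W - 3) * (per W - 3) < 6 * card W"

lemma per_disjoint_Un:
  assumes "finite A" "finite B" "A \<inter> B = {}" "\<And>f g. f \<in> A \<Longrightarrow> g \<in> B \<Longrightarrow> \<not> face_nb f g"
  shows "per (A \<union> B) = per A + per B"
proof -
  have "nx f \<notin> B \<and> ny f \<notin> B \<and> nz f \<notin> B" if "f \<in> A" for f
    using assms(4)[OF that] unfolding face_nb_def by blast
  moreover have "nx f \<notin> A \<and> ny f \<notin> A \<and> nz f \<notin> A" if "f \<in> B" for f
    using assms(4)[OF _ that] face_nb_sym[of f] unfolding face_nb_def[of f] by blast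
  ultimately show ?thesis
    unfolding per_def using bdry_disjoint_Un[OF assms(1-3)] by simp
qed

lemma per_ge_3:
  assumes "finite A" "A \<noteq> {}"
  shows "3 \<le> per A"
proof -
  have "1 \<le> card (c ` A)" for c :: "face \<Rightarrow> int"
    using assms by (simp add: Suc_le_eq card_gt_0_iff)
  from this[of xc] this[of yc] this[of zc] show ?thesis
    using strips_le_per[OF assms(1)] unfolding strips_def by linarith
qed

text \<open>Each piece has perimeter at least 3 and area at most a sixth of its squared perimeter.
  For a fixed total perimeter the two squares add up to most when one piece is as small as possible,
  which gives the constants 9 and 3 in \<open>tight\<close>.\<close>

lemma tight_connected:
  assumes "tight (A \<union> B)" "A \<inter> B = {}" "\<And>f g. f \<in> A \<Longrightarrow> g \<in> B \<Longrightarrow> \<not> face_nb f g"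
  shows "A = {} \<or> B = {}"
proof (rule ccontr)
  assume ne: "\<not> (A = {} \<or> B = {})"
  have fin: "finite A" "finite B" using assms(1) by (auto simp: tight_def)
  have p: "per (A \<union> B) = per A + per B" using per_disjoint_Un fin assms by blast
  have c: "card (A \<union> B) = card A + card B" using card_Un_disjoint fin assms by blast
  have "6 * card A \<le> per A * per A" "6 * card B \<le> per B * per B"
    using card_le_per[OF fin(1)] card_le_per[OF fin(2)] max_area_upper[of "per A"] max_area_upper[of "per B"]
    by linarith+
  moreover obtain a b where "per A = 3 + a" "per B = 3 + b"
    using per_ge_3 fin ne le_Suc_ex by metis
  moreover have "per A * per A + per B * per B \<le> 9 + (per A + per B - 3) * (per A + per B - 3)"
    unfolding calculation by (simp add: algebra_simps)
  ultimately show False using assms(1) p c by (simp add: tight_def)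
qed

text \<open>A coordinate changes by at most one between neighbours, so a skipped value would
  separate the set into two pieces.\<close>

lemma tight_interval:
  fixes c :: "face \<Rightarrow> int"
  assumes W: "tight W" and c: "\<And>f g. face_nb f g \<Longrightarrow> \<bar>c f - c g\<bar> \<le> 1"
    and "u \<in> c ` W" "v \<in> c ` W" "u \<le> w" "w \<le> v"
  shows "w \<in> c ` W"
proof (rule ccontr)
  assume w: "w \<notin> c ` W"
  let ?A = "{f \<in> W. c f < w}" and ?B = "{f \<in> W. c f > w}"
  have AB: "?A \<union> ?B = W" using w by force
  have "?A = {} \<or> ?B = {}"
  proof (rule tight_connected)
    show "tight (?A \<union> ?B)" using W AB by simp
    fix f g assume "f \<in> ?A" "g \<in> ?B"
    then show "\<not> face_nb f g" using c[of f g] by fastforce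
  qed auto
  moreover have "u \<noteq> w" "v \<noteq> w" using w assms by auto
  ultimately show False using assms(3-6) by force
qed

lemma coord_nb:
  "face_nb f g \<Longrightarrow> \<bar>xc f - xc g\<bar> \<le> 1" "face_nb f g \<Longrightarrow> \<bar>yc f - yc g\<bar> \<le> 1" "face_nb f g \<Longrightarrow> \<bar>zc f - zc g\<bar> \<le> 1"
  by (auto simp: face_nb_def sgn_up_def)

lemma interval_eq:
  fixes S :: "int set"
  assumes "finite S" "S \<noteq> {}" "\<And>u v w. u \<in> S \<Longrightarrow> v \<in> S \<Longrightarrow> u \<le> w \<Longrightarrow> w \<le> v \<Longrightarrow> w \<in> S"
  shows "S = {Min S..Max S}" "Min S \<le> Max S"
proof -
  show "S = {Min S..Max S}"
  proof (intro set_eqI iffI)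
    fix w assume "w \<in> {Min S..Max S}"
    then show "w \<in> S" using assms(3)[OF Min_in[OF assms(1,2)] Max_in[OF assms(1,2)], of w] by simp
  next
    fix w assume "w \<in> S"
    then show "w \<in> {Min S..Max S}" using assms(1) by simp
  qed
  show "Min S \<le> Max S" using assms by simp
qed

section \<open>Hexagons and the equality case\<close>

definition hexa :: "int \<Rightarrow> int \<Rightarrow> int \<Rightarrow> int \<Rightarrow> int \<Rightarrow> int \<Rightarrow> face set" where
  "hexa x0 x1 y0 y1 z0 z1 = thull {x0..x1} {y0..y1} {z0..z1}"

lemma in_hexa [simp]: "f \<in> hexa x0 x1 y0 y1 z0 z1 \<longleftrightarrow>
    x0 \<le> xc f \<and> xc f \<le> x1 \<and> y0 \<le> yc f \<and> yc f \<le> y1 \<and> z0 \<le> zc f \<and> zc f \<le> z1"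
  by (auto simp: hexa_def)

lemma finite_hexa [simp]: "finite (hexa x0 x1 y0 y1 z0 z1)"
  by (simp add: hexa_def finite_hull)

lemma arg_cong3: "a = a' \<Longrightarrow> b = b' \<Longrightarrow> c = c' \<Longrightarrow> f a b c = f a' b' c'"
  by simp

lemma tight_hexa:
  assumes "tight W" "W \<noteq> {}"
  obtains x0 x1 y0 y1 z0 z1 where "x0 \<le> x1" "y0 \<le> y1" "z0 \<le> z1"
    "xc ` W = {x0..x1}" "yc ` W = {y0..y1}" "zc ` W = {z0..z1}" "face_hull W = hexa x0 x1 y0 y1 z0 z1"
proof -
  have fin: "finite W" using assms by (simp add: tight_def)
  have *: "c ` W = {Min (c ` W)..Max (c ` W)}" "Min (c ` W) \<le> Max (c ` W)"
    if "\<And>f g. face_nb f g \<Longrightarrow> \<bar>c f - c g\<bar> \<le> 1" for c :: "face \<Rightarrow> int"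
    using interval_eq[of "c ` W"] fin assms(2) tight_interval[where c = c, OF assms(1) that] by blast+
  have x: "xc ` W = {Min (xc ` W)..Max (xc ` W)}" "Min (xc ` W) \<le> Max (xc ` W)"
    by (rule *; fact coord_nb)+
  have y: "yc ` W = {Min (yc ` W)..Max (yc ` W)}" "Min (yc ` W) \<le> Max (yc ` W)"
    by (rule *; fact coord_nb)+
  have z: "zc ` W = {Min (zc ` W)..Max (zc ` W)}" "Min (zc ` W) \<le> Max (zc ` W)"
    by (rule *; fact coord_nb)+
  have "face_hull W = hexa (Min (xc ` W)) (Max (xc ` W)) (Min (yc ` W)) (Max (yc ` W)) (Min (zc ` W)) (Max (zc ` W))"
    unfolding face_hull_def hexa_def by (rule arg_cong3[where f = thull, OF x(1) y(1) z(1)])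
  then show thesis by (rule that[OF x(2) y(2) z(2) x(1) y(1) z(1)])
qed

text \<open>The last condition says that the three pairs of parallel sides are centred around a common point up to rounding.\<close>

definition opt_params :: "nat \<Rightarrow> int \<Rightarrow> int \<Rightarrow> int \<Rightarrow> int \<Rightarrow> int \<Rightarrow> int \<Rightarrow> bool" where
  "opt_params n x0 x1 y0 y1 z0 z1 \<longleftrightarrow> x0 \<le> x1 \<and> y0 \<le> y1 \<and> z0 \<le> z1 \<and>
     (x1 - x0) + (y1 - y0) + (z1 - z0) + 3 = int n \<and>
     \<bar>(x1 - x0) - (y1 - y0)\<bar> \<le> 1 \<and> \<bar>(y1 - y0) - (z1 - z0)\<bar> \<le> 1 \<and> \<bar>(z1 - z0) - (x1 - x0)\<bar> \<le> 1 \<and>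
     \<bar>2 * (x0 + y0 + z0) + int n - 2\<bar> \<le> 1"

definition opt_hex :: "nat \<Rightarrow> face set \<Rightarrow> bool" where
  "opt_hex n W \<longleftrightarrow> (\<exists>x0 x1 y0 y1 z0 z1. opt_params n x0 x1 y0 y1 z0 z1 \<and> W = hexa x0 x1 y0 y1 z0 z1)"

text \<open>The assumptions say that the sides \<open>x0\<close> and \<open>z0\<close> do not bound
  this strip, so it runs from the side \<open>z1\<close> to the side \<open>x1\<close>, with a
  downward face at both ends.\<close>

lemma bar_eq:
  assumes "x0 + y + z1 < 0" "x1 + y + z0 < 0"
  shows "hexa x0 x1 y y z0 z1 =
    (\<lambda>x. (x, y, False)) ` {- y - 1 - z1..x1} \<union> (\<lambda>x. (x, y, True)) ` {- y - z1..x1}"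
proof (rule set_eqI)
  fix f show "f \<in> hexa x0 x1 y y z0 z1 \<longleftrightarrow> f \<in>
    (\<lambda>x. (x, y, False)) ` {- y - 1 - z1..x1} \<union> (\<lambda>x. (x, y, True)) ` {- y - z1..x1}"
    using assms by (cases f; cases "isup f") auto
qed

lemma card_bar:
  assumes "x0 + y + z1 < 0" "x1 + y + z0 < 0"
  shows "card (hexa x0 x1 y y z0 z1) = nat (x1 + y + z1 + 2) + nat (x1 + y + z1 + 1)"
proof -
  have "card ((\<lambda>x. (x, y, False)) ` {- y - 1 - z1..x1} \<union> (\<lambda>x. (x, y, True)) ` {- y - z1..x1})
     = card ((\<lambda>x. (x, y, False)) ` {- y - 1 - z1..x1}) + card ((\<lambda>x. (x, y, True)) ` {- y - z1..x1})"
    by (intro card_Un_disjoint) auto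
  also have "\<dots> = card {- y - 1 - z1..x1} + card {- y - z1..x1}"
    by (simp add: card_image inj_on_def)
  finally show ?thesis unfolding bar_eq[OF assms] by (simp add: algebra_simps)
qed

lemma card_top_le:
  "card (hexa x0 x1 y y z0 z1) \<le> nat (- x0 - y - z0) + nat (1 - x0 - y - z0)"
proof -
  have "hexa x0 x1 y y z0 z1 \<subseteq>
    (\<lambda>x. (x, y, False)) ` {x0..- y - 1 - z0} \<union> (\<lambda>x. (x, y, True)) ` {x0..- y - z0}"
  proof
    fix f assume "f \<in> hexa x0 x1 y y z0 z1"
    then show "f \<in> (\<lambda>x. (x, y, False)) ` {x0..- y - 1 - z0} \<union> (\<lambda>x. (x, y, True)) ` {x0..- y - z0}"
      by (cases f; cases "isup f") auto
  qed
  then have "card (hexa x0 x1 y y z0 z1) \<le>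
    card ((\<lambda>x. (x, y, False)) ` {x0..- y - 1 - z0} \<union> (\<lambda>x. (x, y, True)) ` {x0..- y - z0})"
    by (intro card_mono) auto
  also have "\<dots> \<le> card ((\<lambda>x. (x, y, False)) ` {x0..- y - 1 - z0}) + card ((\<lambda>x. (x, y, True)) ` {x0..- y - z0})"
    by (rule card_Un_le)
  also have "\<dots> = card {x0..- y - 1 - z0} + card {x0..- y - z0}"
    by (simp add: card_image inj_on_def)
  finally show ?thesis by (simp add: algebra_simps)
qed

text \<open>Moving the top strip to the bottom keeps the widths, so it cannot enlarge a set of maximal area.\<close>

lemma central_upper:
  assumes W: "W = hexa x0 x1 y0 y1 z0 z1" and n: "(x1 - x0) + (y1 - y0) + (z1 - z0) + 3 = int n"
    and im: "xc ` W = {x0..x1}" "yc ` W = {y0..y1}" "zc ` W = {z0..z1}"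
    and le: "x0 \<le> x1" "y0 \<le> y1" "z0 \<le> z1" and c: "card W = max_area n"
  shows "2 * (x0 + y0 + z0) + int n - 3 \<le> 0"
proof -
  have "x1 \<in> xc ` W" "y0 \<in> yc ` W" "z1 \<in> zc ` W" "y1 \<in> yc ` W" using im le by auto
  then obtain f1 f2 f3 f4 where f: "f1 \<in> W" "xc f1 = x1" "f2 \<in> W" "yc f2 = y0" "f3 \<in> W" "zc f3 = z1" "f4 \<in> W" "yc f4 = y1"
    by auto
  have cond: "x1 + y0 + z0 \<le> 0" "x1 + y0 + z1 \<ge> -1" "x0 + y0 + z1 \<le> 0" "x0 + y1 + z0 \<le> 0"
    using f coord_sum[of f1] coord_sum[of f2] coord_sum[of f3] coord_sum[of f4] unfolding W in_hexa
    by (smt (verit))+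
  let ?B = "hexa x0 x1 (y0 - 1) (y0 - 1) z0 z1" and ?T = "hexa x0 x1 y1 y1 z0 z1"
    and ?H = "hexa x0 x1 (y0 - 1) (y1 - 1) z0 z1"
  have "card W + card ?B = card (W \<union> ?B)"
    unfolding W by (subst card_Un_disjoint) auto
  also have "W \<union> ?B = ?H \<union> ?T" unfolding W using le by auto
  also have "card (?H \<union> ?T) \<le> card ?H + card ?T" by (rule card_Un_le)
  also have "card ?H \<le> max_area n"
  proof -
    have "card {x0..x1} + card {y0 - 1..y1 - 1} + card {z0..z1} = n" using n le by simp
    then show ?thesis using hull_area(1)[of "{x0..x1}" "{y0 - 1..y1 - 1}" "{z0..z1}"] by (simp add: hexa_def)
  qed
  finally have "card ?B \<le> card ?T" using c by simp
  moreover have "int (card ?B) \<ge> 2 * (x1 + y0 + z1) + 1"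
    using card_bar[of x0 "y0 - 1" z1 x1 z0] cond by simp
  moreover have "int (card ?T) \<le> - 2 * (x0 + y1 + z0) + 1"
    using card_top_le[of x0 x1 y1 z0 z1] cond by simp
  ultimately show ?thesis using n by presburger
qed

lemma image_invf_hexa: "invf ` hexa x0 x1 y0 y1 z0 z1 = hexa (- x1) (- x0) (- y1) (- y0) (- z1 - 1) (- z0 - 1)"
proof
  show "hexa (- x1) (- x0) (- y1) (- y0) (- z1 - 1) (- z0 - 1) \<subseteq> invf ` hexa x0 x1 y0 y1 z0 z1"
  proof
    fix f assume "f \<in> hexa (- x1) (- x0) (- y1) (- y0) (- z1 - 1) (- z0 - 1)"
    then have "invf f \<in> hexa x0 x1 y0 y1 z0 z1" by auto
    then show "f \<in> invf ` hexa x0 x1 y0 y1 z0 z1" by (metis image_eqI invf_invf)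
  qed
qed auto

lemma image_rot_hexa: "rot ` hexa x0 x1 y0 y1 z0 z1 = hexa y0 y1 z0 z1 x0 x1"
  by (simp add: hexa_def image_rot_hull)

lemma image_trf_hexa: "trf i j ` hexa x0 x1 y0 y1 z0 z1 = hexa (x0 + i) (x1 + i) (y0 + j) (y1 + j) (z0 - i - j) (z1 - i - j)"
proof
  show "hexa (x0 + i) (x1 + i) (y0 + j) (y1 + j) (z0 - i - j) (z1 - i - j) \<subseteq> trf i j ` hexa x0 x1 y0 y1 z0 z1"
  proof
    fix f assume "f \<in> hexa (x0 + i) (x1 + i) (y0 + j) (y1 + j) (z0 - i - j) (z1 - i - j)"
    then have "trf (- i) (- j) f \<in> hexa x0 x1 y0 y1 z0 z1" by auto
    moreover have "f = trf i j (trf (- i) (- j) f)" by simp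
    ultimately show "f \<in> trf i j ` hexa x0 x1 y0 y1 z0 z1" by blast
  qed
qed auto

lemma opt_params_invf: "opt_params n x0 x1 y0 y1 z0 z1 \<Longrightarrow> opt_params n (- x1) (- x0) (- y1) (- y0) (- z1 - 1) (- z0 - 1)"
  by (auto simp: opt_params_def)

lemma opt_params_rot: "opt_params n x0 x1 y0 y1 z0 z1 \<Longrightarrow> opt_params n y0 y1 z0 z1 x0 x1"
  by (auto simp: opt_params_def)

text \<open>Equality must hold in every link from the area to the perimeter: the set is its own
  hull, no edge is spent beyond one per strip, and the widths are balanced. From
  \<open>n = 5\<close> on the worst defect 7 still leaves the set \<open>tight\<close>, which makes
  its strips consecutive.\<close>

theorem extremal_structure:
  assumes n: "5 \<le> n" and fin: "finite W" and per: "per W = n" and card: "card W = max_area n"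
  shows "opt_hex n W"
proof -
  obtain m where m: "n = m + 5" using n le_Suc_ex by (metis add.commute)
  have "9 + (n - 3) * (n - 3) < 6 * max_area n"
    using max_area_lower[of n] unfolding m by (simp add: algebra_simps)
  then have t: "tight W" using fin per card by (simp add: tight_def)
  have pos: "max_area n > 0" using max_area_strict[of 0 n] n by linarith
  then have "W \<noteq> {}" using card by auto
  then obtain x0 x1 y0 y1 z0 z1 where le: "x0 \<le> x1" "y0 \<le> y1" "z0 \<le> z1"
    and im: "xc ` W = {x0..x1}" "yc ` W = {y0..y1}" "zc ` W = {z0..z1}"
    and h: "face_hull W = hexa x0 x1 y0 y1 z0 z1"
    using tight_hexa[OF t] by metis
  have sn: "strips W = n"
  proof (rule ccontr)
    assume "strips W \<noteq> n"
    then have "strips W < n" using strips_le_per[OF fin] per by linarith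
    then have "max_area (strips W) < max_area n" using max_area_strict n by simp
    then show False using card_le_strips[OF fin] card by linarith
  qed
  have H: "W = hexa x0 x1 y0 y1 z0 z1"
  proof -
    have "card (face_hull W) = card W" using card_le_strips[OF fin] unfolding sn card by simp
    then have "W = face_hull W"
      using face_hull_superset finite_face_hull[OF fin] card_subset_eq by metis
    then show ?thesis using h by simp
  qed
  have wn: "(x1 - x0) + (y1 - y0) + (z1 - z0) + 3 = int n"
    using sn le unfolding strips_def im by auto
  have bal: "\<bar>(x1 - x0) - (y1 - y0)\<bar> \<le> 1 \<and> \<bar>(y1 - y0) - (z1 - z0)\<bar> \<le> 1 \<and> \<bar>(z1 - z0) - (x1 - x0)\<bar> \<le> 1"
  proof -
    have "card {x0..x1} + card {y0..y1} + card {z0..z1} = n" using sn unfolding strips_def im by simp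
    then have "\<bar>int (card {x0..x1}) - int (card {y0..y1})\<bar> \<le> 1 \<and> \<bar>int (card {y0..y1}) - int (card {z0..z1})\<bar> \<le> 1
       \<and> \<bar>int (card {z0..z1}) - int (card {x0..x1})\<bar> \<le> 1"
      using hull_area(2)[of "{x0..x1}" "{y0..y1}" "{z0..z1}"] card n H unfolding hexa_def by simp
    then show ?thesis using le by auto
  qed
  have up: "2 * (x0 + y0 + z0) + int n - 3 \<le> 0"
    using central_upper[OF H wn im le card] .
  \<comment> \<open>The point reflection exchanges opposite sides; it supplies the other half of the
    centring condition.\<close>
  have "2 * (- x1 - y1 + (- z1 - 1)) + int n - 3 \<le> 0"
  proof -
    have "2 * ((- x1) + (- y1) + (- z1 - 1)) + int n - 3 \<le> 0"
    proof (rule central_upper[of "invf ` W" _ "- x0" _ "- y0" _ "- z0 - 1"])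
      show "invf ` W = hexa (- x1) (- x0) (- y1) (- y0) (- z1 - 1) (- z0 - 1)"
        unfolding H by (rule image_invf_hexa)
      have "xc ` invf ` W = uminus ` xc ` W" "yc ` invf ` W = uminus ` yc ` W" "zc ` invf ` W = (\<lambda>v. - v - 1) ` zc ` W"
        by (auto simp: image_image)
      moreover have "(\<lambda>v. - v - 1) ` {z0..z1} = {- z1 - 1..- z0 - 1}"
      proof -
        have "v \<in> (\<lambda>v. - v - 1) ` {z0..z1}" if "v \<in> {- z1 - 1..- z0 - 1}" for v
          by (rule image_eqI[of _ _ "- v - 1"]) (use that in auto)
        then show ?thesis by auto
      qed
      ultimately show "xc ` invf ` W = {- x1..- x0}" "yc ` invf ` W = {- y1..- y0}" "zc ` invf ` W = {- z1 - 1..- z0 - 1}"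
        by (simp_all add: im)
      show "card (invf ` W) = max_area n" using card face_iso_card[OF face_iso_invf] by simp
    qed (use le wn in auto)
    then show ?thesis by simp
  qed
  then have "opt_params n x0 x1 y0 y1 z0 z1"
    using up wn bal le by (auto simp: opt_params_def)
  then show ?thesis using H unfolding opt_hex_def by blast
qed

section \<open>Lattice symmetries\<close>

text \<open>Faces with a common vertex have base points differing by at most one in each coordinate,
  which leaves finitely many cases.\<close>

lemma face_adj_nb: "face_adj f g \<longleftrightarrow> face_nb f g"
proof -
  obtain a b u where f: "f = (a, b, u)" by (cases f)
  obtain c d w where g: "g = (c, d, w)" by (cases g)
  have near: "(c = a - 1 \<or> c = a \<or> c = a + 1) \<and> (d = b - 1 \<or> d = b \<or> d = b + 1)" if "vs f \<inter> vs g \<noteq> {}"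
    using that unfolding f g by (cases u; cases w) auto
  show ?thesis
  proof (cases "(c = a - 1 \<or> c = a \<or> c = a + 1) \<and> (d = b - 1 \<or> d = b \<or> d = b + 1)")
    case True
    then show ?thesis
      unfolding f g by (cases u; cases w) (auto simp: face_adj_def face_nb_def card_insert_if)
  next
    case False
    then have "vs f \<inter> vs g = {}" using near by blast
    moreover have "\<not> face_nb f g" using False unfolding f g face_nb_def by auto
    ultimately show ?thesis by (simp add: face_adj_def)
  qed
qed

lemma vs_sums:
  "(\<Sum>p\<in>vs (a, b, u). fst p) = 3 * a + (if u then 1 else 2)"
  "(\<Sum>p\<in>vs (a, b, u). snd p) = 3 * b + (if u then 1 else 2)"
  by (cases u; simp)+

text \<open>Modulo 3 the sum of the first coordinates is 1 for upward and 2 for downward faces, so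
  the vertex set reveals the orientation and then the base point.\<close>

lemma inj_vs: "inj vs"
proof (rule injI)
  fix f g assume eq: "vs f = vs g"
  obtain a b u where f: "f = (a, b, u)" by (cases f)
  obtain c d w where g: "g = (c, d, w)" by (cases g)
  have "3 * a + (if u then 1 else 2) = 3 * c + (if w then 1 else 2)"
    "3 * b + (if u then 1 else 2) = 3 * d + (if w then 1 else 2)"
    using vs_sums[of a b u] vs_sums[of c d w] eq unfolding f g by simp_all
  then show "f = g" unfolding f g by (cases u; cases w; simp; presburger)
qed

lemma tri_adj_iff:
  "tri_adj u v \<longleftrightarrow> \<bar>fst v - fst u\<bar> \<le> 1 \<and> \<bar>snd v - snd u\<bar> \<le> 1 \<and> \<bar>fst v - fst u + (snd v - snd u)\<bar> \<le> 1
     \<and> (fst v \<noteq> fst u \<or> snd v \<noteq> snd u)"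
proof -
  have "(i, j) \<in> {(1,0),(-1,0),(0,1),(0,-1),(1,-1),(-1,1)} \<longleftrightarrow>
     \<bar>i\<bar> \<le> 1 \<and> \<bar>j\<bar> \<le> 1 \<and> \<bar>i + j\<bar> \<le> 1 \<and> (i \<noteq> 0 \<or> j \<noteq> 0)" for i j :: int
    by (simp only: insert_iff prod.inject empty_iff simp_thms) presburger
  from this[of "fst v - fst u" "snd v - snd u"] show ?thesis
    unfolding tri_adj_def by simp
qed

lemma triangle_face:
  assumes "tri_adj u v" "tri_adj v w" "tri_adj u w"
  shows "\<exists>f. vs f = {u, v, w}"
proof -
  obtain p q where u: "u = (p, q)" by (cases u)
  obtain i j where v: "v = (p + i, q + j)" by (rule that[of "fst v - p" "snd v - q"]) simp
  obtain k l where w: "w = (p + k, q + l)" by (rule that[of "fst w - p" "snd w - q"]) simp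
  have 1: "\<bar>i\<bar> \<le> 1" "\<bar>j\<bar> \<le> 1" "\<bar>i + j\<bar> \<le> 1" "i \<noteq> 0 \<or> j \<noteq> 0"
    "\<bar>k\<bar> \<le> 1" "\<bar>l\<bar> \<le> 1" "\<bar>k + l\<bar> \<le> 1" "k \<noteq> 0 \<or> l \<noteq> 0"
    "\<bar>k - i\<bar> \<le> 1" "\<bar>l - j\<bar> \<le> 1" "\<bar>k - i + (l - j)\<bar> \<le> 1" "k \<noteq> i \<or> l \<noteq> j"
    using assms by (simp_all add: tri_adj_iff u v w)
  have d: "x = -1 \<or> x = 0 \<or> x = 1" if "\<bar>x\<bar> \<le> 1" for x :: int using that by linarith
  \<comment> \<open>The base point is the coordinatewise minimum of the corners; the sum of the
    first coordinates exceeds three times their minimum by 1 for an upward face and by 2 for a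
    downward one.\<close>
  have "vs (p + min 0 (min i k), q + min 0 (min j l), i + k = 3 * min 0 (min i k) + 1) = {u, v, w}"
  proof -
    have "(i, j, k, l) \<in> {(1,0,0,1),(1,0,1,-1),(-1,0,0,-1),(-1,0,-1,1),(0,1,1,0),(0,1,-1,1),(0,-1,-1,0),(0,-1,1,-1),(1,-1,1,0),(1,-1,0,-1),(-1,1,-1,0),(-1,1,0,1)}"
      using d[OF 1(1)] d[OF 1(2)] d[OF 1(5)] d[OF 1(6)] 1(3,4,7-12) by (elim disjE) simp_all
    then show ?thesis
      unfolding u v w by (elim insertE emptyE; clarsimp; auto)
  qed
  then show ?thesis by blast
qed

text \<open>Symmetries are given on vertices, droplets are sets of faces; this is the induced action
  on faces.\<close>

definition lat_face :: "(face \<Rightarrow> face) \<Rightarrow> bool" where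
  "lat_face \<phi> \<longleftrightarrow> (\<exists>g. lattice_sym g \<and> (\<forall>f. vs (\<phi> f) = g ` vs f))"

lemma tri_adj_vs: "u \<in> vs f \<Longrightarrow> v \<in> vs f \<Longrightarrow> u \<noteq> v \<Longrightarrow> tri_adj u v"
  by (cases f; cases "isup f") (auto simp: tri_adj_iff)

lemma vs_triple:
  obtains u v w where "vs f = {u, v, w}" "u \<noteq> v" "v \<noteq> w" "u \<noteq> w"
proof -
  obtain a b u where f: "f = (a, b, u)" by (cases f)
  show thesis
    by (cases u; rule that[of "if u then (a, b) else (a + 1, b + 1)" "(a + 1, b)" "(a, b + 1)"]) (auto simp: f)
qed

text \<open>Faces are the triples of pairwise adjacent vertices, a notion that depends on adjacency
  alone.\<close>

lemma lattice_sym_face: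
  assumes "lattice_sym g"
  shows "\<exists>f'. vs f' = g ` vs f"
proof -
  obtain u v w where f: "vs f = {u, v, w}" "u \<noteq> v" "v \<noteq> w" "u \<noteq> w" by (rule vs_triple)
  have "tri_adj u v" "tri_adj v w" "tri_adj u w"
    using f tri_adj_vs[of _ f] by auto
  then have "tri_adj (g u) (g v)" "tri_adj (g v) (g w)" "tri_adj (g u) (g w)"
    using assms unfolding lattice_sym_def by blast+
  then show ?thesis using triangle_face f(1) by fastforce
qed

lemma lattice_sym_lat_face:
  assumes "lattice_sym g"
  obtains \<phi> where "lat_face \<phi>" "\<And>f. vs (\<phi> f) = g ` vs f" "\<And>F. img g F = \<phi> ` F"
proof -
  obtain \<phi> where \<phi>: "\<And>f. vs (\<phi> f) = g ` vs f"
    using lattice_sym_face[OF assms] by metis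
  moreover from this have "lat_face \<phi>" using assms unfolding lat_face_def by blast
  moreover have "img g F = \<phi> ` F" for F
    using \<phi> inj_vs unfolding img_def image_def by (auto; metis injD)
  ultimately show thesis by (intro that)
qed

lemma lat_face_img:
  assumes "lat_face \<phi>"
  obtains g where "lattice_sym g" "\<And>F. img g F = \<phi> ` F"
proof -
  obtain g where g: "lattice_sym g" "\<And>f. vs (\<phi> f) = g ` vs f" using assms lat_face_def by blast
  obtain \<psi> where \<psi>: "\<And>f. vs (\<psi> f) = g ` vs f" "\<And>F. img g F = \<psi> ` F"
    using lattice_sym_lat_face[OF g(1)] by metis
  have "\<psi> f = \<phi> f" for f using g(2) \<psi>(1) inj_vs by (metis injD)
  then have "\<psi> = \<phi>" by (rule ext)
  then show thesis using that g(1) \<psi>(2) by blast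
qed

lemma lattice_sym_inv: "lattice_sym g \<Longrightarrow> lattice_sym (inv g)"
  unfolding lattice_sym_def by (metis bij_imp_bij_inv bij_inv_eq_iff)

lemma lattice_sym_comp: "lattice_sym g \<Longrightarrow> lattice_sym h \<Longrightarrow> lattice_sym (g \<circ> h)"
  by (simp add: lattice_sym_def bij_comp del: split_paired_All)

lemma lat_face_comp: "lat_face \<phi> \<Longrightarrow> lat_face \<psi> \<Longrightarrow> lat_face (\<phi> \<circ> \<psi>)"
  unfolding lat_face_def using lattice_sym_comp by (metis (no_types, lifting) comp_apply image_comp)

lemma lat_face_has_inv:
  assumes "lat_face \<phi>"
  obtains \<psi> where "lat_face \<psi>" "\<And>f. \<psi> (\<phi> f) = f" "\<And>f. \<phi> (\<psi> f) = f"
proof -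
  obtain g where g: "lattice_sym g" "\<And>f. vs (\<phi> f) = g ` vs f" using assms lat_face_def by blast
  have b: "bij g" using g(1) lattice_sym_def by blast
  obtain \<psi> where \<psi>: "lat_face \<psi>" "\<And>f. vs (\<psi> f) = inv g ` vs f"
    using lattice_sym_lat_face[OF lattice_sym_inv[OF g(1)]] by metis
  have "vs (\<psi> (\<phi> f)) = vs f" "vs (\<phi> (\<psi> f)) = vs f" for f
    unfolding g(2) \<psi>(2) by (rule image_inv_f_f[OF bij_is_inj[OF b]], rule image_f_inv_f[OF bij_is_surj[OF b]])
  then have "\<psi> (\<phi> f) = f" "\<phi> (\<psi> f) = f" for f using inj_vs by (metis injD)+
  then show thesis using that \<psi>(1) by blast
qed

text \<open>Adjacency means two common vertices, a number preserved by an injective map of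
  vertices.\<close>

lemma lat_face_iso:
  assumes "lat_face \<phi>"
  shows "face_iso \<phi>"
proof -
  obtain \<psi> where \<psi>: "\<And>f. \<psi> (\<phi> f) = f" "\<And>f. \<phi> (\<psi> f) = f"
    using lat_face_has_inv[OF assms] by metis
  have "bij \<phi>"
  proof (rule bijI)
    show "inj \<phi>" by (rule injI) (metis \<psi>(1))
    show "surj \<phi>" by (rule surjI) (rule \<psi>(2))
  qed
  obtain g where g: "lattice_sym g" "\<And>f. vs (\<phi> f) = g ` vs f" using assms lat_face_def by blast
  have inj: "inj g" using g(1) by (simp add: lattice_sym_def bij_is_inj del: split_paired_All)
  have "face_nb (\<phi> f) (\<phi> k) \<longleftrightarrow> face_nb f k" for f k
    unfolding face_adj_nb[symmetric] face_adj_def g(2) image_Int[OF inj, symmetric]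
    by (simp add: card_image[OF inj_on_subset[OF inj subset_UNIV]])
  then show ?thesis using \<open>bij \<phi>\<close> by (simp add: face_iso_def del: split_paired_All)
qed

lemma lattice_symI:
  assumes "\<And>u. h (g u) = u" "\<And>u. g (h u) = u" "\<And>u v. tri_adj (g u) (g v) \<longleftrightarrow> tri_adj u v"
  shows "lattice_sym g"
proof -
  have "bij g"
  proof (rule bijI)
    show "inj g" by (rule injI) (metis assms(1))
    show "surj g" by (rule surjI) (rule assms(2))
  qed
  then show ?thesis using assms(3) by (simp add: lattice_sym_def del: split_paired_All)
qed

lemma lat_face_id: "lat_face (\<lambda>f. f)"
proof -
  have "lattice_sym (\<lambda>u. u)" by (rule lattice_symI) auto
  then show ?thesis unfolding lat_face_def by force
qed

lemma lat_face_rot: "lat_face rot"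
proof -
  have "lattice_sym (\<lambda>(x, y). (y, 1 - x - y))"
    by (rule lattice_symI[of "\<lambda>(x, y). (1 - x - y, x)"]) (auto simp: tri_adj_iff split: prod.splits)
  moreover have "vs (rot f) = (\<lambda>(x, y). (y, 1 - x - y)) ` vs f" for f
    by (cases f; cases "isup f") auto
  ultimately show ?thesis unfolding lat_face_def by blast
qed

lemma lat_face_invf: "lat_face invf"
proof -
  have "lattice_sym (\<lambda>(x, y). (1 - x, 1 - y))"
    by (rule lattice_symI[of "\<lambda>(x, y). (1 - x, 1 - y)"]) (auto simp: tri_adj_iff split: prod.splits)
  moreover have "vs (invf f) = (\<lambda>(x, y). (1 - x, 1 - y)) ` vs f" for f
    by (cases f; cases "isup f") auto
  ultimately show ?thesis unfolding lat_face_def by blast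
qed

lemma lat_face_trf: "lat_face (trf i j)"
proof -
  have "lattice_sym (\<lambda>(x, y). (x + i, y + j))"
    by (rule lattice_symI[of "\<lambda>(x, y). (x - i, y - j)"]) (auto simp: tri_adj_iff split: prod.splits)
  moreover have "vs (trf i j f) = (\<lambda>(x, y). (x + i, y + j)) ` vs f" for f
    by (cases f; cases "isup f") auto
  ultimately show ?thesis unfolding lat_face_def by blast
qed

lemmas lat_face_intros = lat_face_id lat_face_rot lat_face_invf lat_face_trf lat_face_comp

text \<open>The big triangle gives the lower bounds of the three coordinates, and each removed
  corner caps one of them.\<close>

lemma Tshape_hexa:
  "Tshape d a b c = hexa 0 (int d - int b - 1) 0 (int d - int c - 1) (1 - int d) (- int a)"
proof (rule set_eqI)
  fix f show "f \<in> Tshape d a b c \<longleftrightarrow> f \<in> hexa 0 (int d - int b - 1) 0 (int d - int c - 1) (1 - int d) (- int a)"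
    by (cases f; cases "isup f") (auto simp: Tshape_def)
qed

section \<open>Growing a hexagon by a bar\<close>

definition energy :: "real \<Rightarrow> real \<Rightarrow> face set \<Rightarrow> real" where
  "energy J h W = J * real (per W) - h * real (card W)"

text \<open>The moves stay between \<open>A\<close> and \<open>U\<close>: if \<open>U\<close> fits
  into the torus they can be projected, and above \<open>A\<close> their overlap with a larger
  droplet containing \<open>A\<close> has an energy bounded from below.\<close>

definition reach_rel :: "real \<Rightarrow> real \<Rightarrow> real \<Rightarrow> face set \<Rightarrow> face set \<Rightarrow> (face set \<times> face set) set" where
  "reach_rel J h C A U = {(V, W). A \<subseteq> V \<and> V \<subseteq> U \<and> A \<subseteq> W \<and> W \<subseteq> U \<and> energy J h V < C \<and> energy J h W < C \<and>
     (\<exists>f. f \<notin> V \<and> W = insert f V \<or> f \<notin> W \<and> V = insert f W)}"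

text \<open>An extremal hexagon \<open>P\<close> and the next one \<open>H\<close>, obtained by filling the bar below \<open>P\<close> from \<open>lft\<close> to \<open>x1\<close>;
  \<open>tt\<close> and \<open>uu\<close> are the faces \<open>t_j\<close> and \<open>u_j\<close> of the informal statement.\<close>

locale hex_bar =
  fixes n :: nat and x0 x1 y0 y1 z0 z1 :: int
  assumes core: "opt_params n x0 x1 y0 y1 z0 z1"
    and full: "opt_params (Suc n) x0 x1 (y0 - 1) y1 z0 z1"
begin

definition P :: "face set" where "P = hexa x0 x1 y0 y1 z0 z1"
definition H :: "face set" where "H = hexa x0 x1 (y0 - 1) y1 z0 z1"
text \<open>The first column of the bar, where the side \<open>z1\<close> meets the strip
  \<open>y0 - 1\<close> in a downward face.\<close>

definition lft :: int where "lft = - y0 - z1"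
definition tt :: "int \<Rightarrow> face" where "tt x = (x, y0 - 1, False)"
definition uu :: "int \<Rightarrow> face" where "uu x = (x, y0 - 1, True)"
text \<open>\<open>uu x\<close> lies between \<open>tt (x - 1)\<close> and \<open>tt x\<close>; the
  half-open range makes the bar begin and end with a face attached to \<open>P\<close>.\<close>

definition bar :: "int \<Rightarrow> int \<Rightarrow> face set" where "bar a b = tt ` {a..b} \<union> uu ` {a<..b}"
definition seg :: "int \<Rightarrow> int \<Rightarrow> face set" where "seg a b = P \<union> bar a b"

lemma ineqs: "x0 + y0 + z1 \<le> 0" "x1 + y0 + z0 \<le> 0" "y0 \<le> y1" "x0 \<le> lft" "x1 \<le> - y0 - z0"
  using core unfolding opt_params_def lft_def by (smt (verit))+

lemma lft_le: "lft \<le> x1"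
  using core full unfolding opt_params_def lft_def of_nat_Suc by (smt (verit))

lemma tu_simps [simp]: "tt x = tt y \<longleftrightarrow> x = y" "uu x = uu y \<longleftrightarrow> x = y" "tt x \<noteq> uu y" "uu x \<noteq> tt y"
  "tt x \<notin> P" "uu x \<notin> P" "yc (tt x) = y0 - 1" "yc (uu x) = y0 - 1"
  by (auto simp: tt_def uu_def P_def)

lemma finite_P [simp]: "finite P"
  by (simp add: P_def)

lemma bar_mem [simp]: "tt x \<in> bar a b \<longleftrightarrow> a \<le> x \<and> x \<le> b" "uu x \<in> bar a b \<longleftrightarrow> a < x \<and> x \<le> b"
  "finite (bar a b)"
  by (auto simp: bar_def)

lemma yc_bar: "f \<in> bar a b \<Longrightarrow> yc f = y0 - 1"
  unfolding bar_def by (elim UnE imageE) simp_all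

lemma finite_seg [simp]: "finite (seg a b)"
  by (simp add: seg_def)

lemma H_eq: "H = seg lft x1"
proof -
  have "H = P \<union> hexa x0 x1 (y0 - 1) (y0 - 1) z0 z1"
    using ineqs by (auto simp: H_def P_def)
  moreover have "{lft<..x1} = {lft + 1..x1}" by auto
  then have "hexa x0 x1 (y0 - 1) (y0 - 1) z0 z1 = tt ` {lft..x1} \<union> uu ` {lft<..x1}"
    using bar_eq[of x0 "y0 - 1" z1 x1 z0] ineqs unfolding tt_def uu_def lft_def by (simp add: algebra_simps)
  ultimately show ?thesis by (simp add: seg_def bar_def)
qed

lemma nb_tt: "nx (tt x) = uu (x + 1)" "nz (tt x) = uu x" "ny (tt x) = (x, y0, True)"
  by (simp_all add: tt_def uu_def)

lemma nb_uu: "nx (uu x) = tt (x - 1)" "nz (uu x) = tt x" "ny (uu x) = (x, y0 - 2, False)"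
  by (simp_all add: tt_def uu_def)

lemma deg_tt:
  assumes "lft \<le> x" "x \<le> x1" "\<And>f. f \<in> B \<Longrightarrow> yc f = y0 - 1"
  shows "deg (P \<union> B) (tt x) = 1 + of_bool (uu (x + 1) \<in> B) + of_bool (uu x \<in> B)"
proof -
  have "(x, y0, True) \<in> P" using assms ineqs by (auto simp: P_def lft_def)
  then show ?thesis by (simp add: deg_def nb_tt)
qed

lemma deg_uu:
  assumes "\<And>f. f \<in> B \<Longrightarrow> yc f = y0 - 1"
  shows "deg (P \<union> B) (uu x) = of_bool (tt (x - 1) \<in> B) + of_bool (tt x \<in> B)"
proof -
  have "(x, y0 - 2, False) \<notin> P" by (auto simp: P_def)
  moreover have "(x, y0 - 2, False) \<notin> B" using assms by fastforce
  ultimately show ?thesis by (simp add: deg_def nb_uu)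
qed

lemma seg_single: "seg a a = insert (tt a) P"
  by (simp add: seg_def bar_def)

lemma bar_right:
  assumes "a \<le> b"
  shows "bar a (b + 1) = insert (tt (b + 1)) (insert (uu (b + 1)) (bar a b))"
proof -
  have "{a..b + 1} = insert (b + 1) {a..b}" "{a<..b + 1} = insert (b + 1) {a<..b}" using assms by auto
  then show ?thesis by (simp add: bar_def insert_commute)
qed

lemma bar_left:
  assumes "a \<le> b"
  shows "bar (a - 1) b = insert (tt (a - 1)) (insert (uu a) (bar a b))"
proof -
  have "{a - 1..b} = insert (a - 1) {a..b}" "{a - 1<..b} = insert a {a<..b}" using assms by auto
  then show ?thesis by (simp add: bar_def insert_commute)
qed

lemma seg_right: "a \<le> b \<Longrightarrow> seg a (b + 1) = insert (tt (b + 1)) (insert (uu (b + 1)) (seg a b))"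
  by (simp add: seg_def bar_right)

lemma seg_left: "a \<le> b \<Longrightarrow> seg (a - 1) b = insert (tt (a - 1)) (insert (uu a) (seg a b))"
  by (simp add: seg_def bar_left)

lemma seg_mem [simp]: "tt x \<in> seg a b \<longleftrightarrow> a \<le> x \<and> x \<le> b" "uu x \<in> seg a b \<longleftrightarrow> a < x \<and> x \<le> b"
  by (simp_all add: seg_def)

lemma per_insert_tt:
  assumes "lft \<le> x" "x \<le> x1" "\<And>f. f \<in> B \<Longrightarrow> yc f = y0 - 1" "finite B" "tt x \<notin> B"
  shows "per (insert (tt x) (P \<union> B)) + 2 * (of_bool (uu (x + 1) \<in> B) + of_bool (uu x \<in> B)) = per (P \<union> B) + 1"
    "card (insert (tt x) (P \<union> B)) = card (P \<union> B) + 1"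
  using per_insert[of "P \<union> B" "tt x"] deg_tt[OF assms(1-3)] assms by simp_all

lemma per_insert_uu:
  assumes "\<And>f. f \<in> B \<Longrightarrow> yc f = y0 - 1" "finite B" "uu x \<notin> B"
  shows "per (insert (uu x) (P \<union> B)) + 2 * (of_bool (tt (x - 1) \<in> B) + of_bool (tt x \<in> B)) = per (P \<union> B) + 3"
    "card (insert (uu x) (P \<union> B)) = card (P \<union> B) + 1"
  using per_insert[of "P \<union> B" "uu x"] deg_uu[OF assms(1)] assms by simp_all

lemma per_single:
  assumes "lft \<le> a" "a \<le> x1"
  shows "per (insert (tt a) P) = per P + 1" "card (insert (tt a) P) = card P + 1"
  using per_insert_tt[OF assms, of "{}"] by simp_all

text \<open>The \<open>uu\<close> face touches only the end of the bar and costs an edge; the next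
  \<open>tt\<close> face touches it and \<open>P\<close> and wins the edge back.\<close>

lemma step_right:
  assumes "a \<le> b" "lft \<le> a" "b < x1"
  shows "per (insert (uu (b + 1)) (seg a b)) = per (seg a b) + 1"
    "card (insert (uu (b + 1)) (seg a b)) = card (seg a b) + 1"
    "per (seg a (b + 1)) = per (seg a b)" "card (seg a (b + 1)) = card (seg a b) + 2"
proof -
  let ?B = "bar a b"
  have yB: "yc f = y0 - 1" if "f \<in> insert (uu c) ?B" for f c
    using that yc_bar[of f a b] by (elim insertE) simp_all
  have 1: "per (insert (uu (b + 1)) (P \<union> ?B)) + 2 * 1 = per (P \<union> ?B) + 3"
    "card (insert (uu (b + 1)) (P \<union> ?B)) = card (P \<union> ?B) + 1"
    using per_insert_uu[of ?B "b + 1"] yc_bar assms by simp_all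
  have 2: "per (insert (tt (b + 1)) (P \<union> insert (uu (b + 1)) ?B)) + 2 * 1 = per (P \<union> insert (uu (b + 1)) ?B) + 1"
    "card (insert (tt (b + 1)) (P \<union> insert (uu (b + 1)) ?B)) = card (P \<union> insert (uu (b + 1)) ?B) + 1"
    using per_insert_tt[of "b + 1" "insert (uu (b + 1)) ?B"] yB[of _ "b + 1"] assms by simp_all
  have 3: "P \<union> insert (uu (b + 1)) ?B = insert (uu (b + 1)) (P \<union> ?B)" by simp
  show "per (insert (uu (b + 1)) (seg a b)) = per (seg a b) + 1"
    "card (insert (uu (b + 1)) (seg a b)) = card (seg a b) + 1"
    "per (seg a (b + 1)) = per (seg a b)" "card (seg a (b + 1)) = card (seg a b) + 2"
    using 1 2 unfolding 3 seg_right[OF assms(1)] unfolding seg_def by linarith+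
qed

lemma step_left:
  assumes "a \<le> b" "lft < a" "b \<le> x1"
  shows "per (insert (uu a) (seg a b)) = per (seg a b) + 1"
    "card (insert (uu a) (seg a b)) = card (seg a b) + 1"
    "per (seg (a - 1) b) = per (seg a b)" "card (seg (a - 1) b) = card (seg a b) + 2"
proof -
  let ?B = "bar a b"
  have yB: "yc f = y0 - 1" if "f \<in> insert (uu c) ?B" for f c
    using that yc_bar[of f a b] by (elim insertE) simp_all
  have 1: "per (insert (uu a) (P \<union> ?B)) + 2 * 1 = per (P \<union> ?B) + 3"
    "card (insert (uu a) (P \<union> ?B)) = card (P \<union> ?B) + 1"
    using per_insert_uu[of ?B a] yc_bar assms by simp_all
  have 2: "per (insert (tt (a - 1)) (P \<union> insert (uu a) ?B)) + 2 * 1 = per (P \<union> insert (uu a) ?B) + 1"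
    "card (insert (tt (a - 1)) (P \<union> insert (uu a) ?B)) = card (P \<union> insert (uu a) ?B) + 1"
    using per_insert_tt[of "a - 1" "insert (uu a) ?B"] yB[of _ a] assms by simp_all
  have 3: "P \<union> insert (uu a) ?B = insert (uu a) (P \<union> ?B)" by simp
  show "per (insert (uu a) (seg a b)) = per (seg a b) + 1"
    "card (insert (uu a) (seg a b)) = card (seg a b) + 1"
    "per (seg (a - 1) b) = per (seg a b)" "card (seg (a - 1) b) = card (seg a b) + 2"
    using 1 2 unfolding 3 seg_left[OF assms(1)] unfolding seg_def by linarith+
qed

lemma seg_size:
  assumes "a \<le> b" "lft \<le> a" "b \<le> x1"
  shows "per (seg a b) = per P + 1 \<and> card (seg a b) = card P + 2 * nat (b - a) + 1"
  using assms(1,3)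
proof (induction b rule: int_ge_induct)
  case base
  then show ?case using per_single[of a] assms by (simp add: seg_single)
next
  case (step b)
  then show ?case using step_right[of a b] assms by auto
qed

lemma H_size: "per H = per P + 1" "card H = card P + 2 * nat (x1 - lft) + 1"
  using seg_size[OF lft_le] H_eq by simp_all

lemma seg_subset: "lft \<le> a \<Longrightarrow> b \<le> x1 \<Longrightarrow> seg a b \<subseteq> H" "P \<subseteq> seg a b"
  unfolding H_eq by (auto simp: seg_def bar_def)

lemma uu_in_H: "lft < x \<Longrightarrow> x \<le> x1 \<Longrightarrow> uu x \<in> H"
  unfolding H_eq by simp

lemma tt_in_H: "lft \<le> x \<Longrightarrow> x \<le> x1 \<Longrightarrow> tt x \<in> H"
  unfolding H_eq by simp

text \<open>The peak of each extension is a bar with a lone \<open>uu\<close> at its end, two edges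
  above \<open>P\<close>. Later peaks carry more area, so the bound for the first one
  suffices.\<close>

lemma reach_seg:
  assumes h: "0 < h" "h < J" and ab: "lft \<le> a" "a \<le> b" "b \<le> x1"
    and C: "J * (real (per P) + 2) - h * (real (card P) + 2 + 2 * of_int (b - a)) < C"
  shows "(seg a b, H) \<in> (reach_rel J h C P H)\<^sup>*"
  using ab C
proof (induction "nat ((x1 - b) + (a - lft))" arbitrary: a b rule: less_induct)
  case less
  have s: "per (seg a b) = per P + 1" "card (seg a b) = card P + 2 * nat (b - a) + 1"
    using seg_size less.prems by auto
  have cs: "real (card (seg a b)) = real (card P) + 2 * of_int (b - a) + 1"
    unfolding s(2) using less.prems by simp
  have e0: "energy J h (seg a b) < C"
    using less.prems(4) h unfolding energy_def s(1) cs by (simp add: algebra_simps)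
  have step: ?case if a': "lft \<le> a'" "a' \<le> b'" "b' \<le> x1" "b' - a' = b - a + 1"
    and sub: "nat ((x1 - b') + (a' - lft)) < nat ((x1 - b) + (a - lft))"
    and u: "uu v \<in> H" "uu v \<notin> seg a b" "per (insert (uu v) (seg a b)) = per (seg a b) + 1"
    "card (insert (uu v) (seg a b)) = card (seg a b) + 1"
    and t: "seg a' b' = insert (tt w) (insert (uu v) (seg a b))" "tt w \<notin> insert (uu v) (seg a b)"
    "per (seg a' b') = per (seg a b)" "card (seg a' b') = card (seg a b) + 2" for a' b' v w
  proof -
    have ba: "real_of_int (b - a) \<ge> 0" using less.prems by simp
    have e1: "energy J h (insert (uu v) (seg a b)) < C"
      using less.prems(4) h unfolding energy_def u(3,4) of_nat_add cs s(1) by (simp add: algebra_simps)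
    have e2: "energy J h (seg a' b') < C"
      using e0 h unfolding energy_def t(3,4) by (simp add: algebra_simps)
    have "(seg a b, insert (uu v) (seg a b)) \<in> reach_rel J h C P H"
      using seg_subset(1)[OF less.prems(1,3)] seg_subset(2)[of a b] u(1,2) e0 e1
      unfolding reach_rel_def by blast
    moreover have "(insert (uu v) (seg a b), seg a' b') \<in> reach_rel J h C P H"
      using seg_subset(1)[OF less.prems(1,3)] seg_subset(2)[of a b] seg_subset(1)[OF a'(1,3)] seg_subset(2)[of a' b'] u(1) e1 e2 t(1,2)
      unfolding reach_rel_def by blast
    moreover have "(seg a' b', H) \<in> (reach_rel J h C P H)\<^sup>*"
    proof (rule less.hyps[OF sub a'(1-3)])
      have "h * (2 * of_int (b - a)) \<le> h * (2 * of_int (b' - a'))" using a'(4) h by simp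
      then show "J * (real (per P) + 2) - h * (real (card P) + 2 + 2 * of_int (b' - a')) < C"
        using less.prems(4) by (simp add: algebra_simps)
    qed
    ultimately show ?thesis by (meson converse_rtrancl_into_rtrancl)
  qed
  show ?case
  proof (cases "b < x1")
    case True
    show ?thesis
      by (rule step[of a "b + 1" "b + 1" "b + 1"])
        (use True less.prems step_right[of a b] seg_right[of a b] in \<open>auto intro: uu_in_H\<close>)
  next
    case False
    then have b: "b = x1" using less.prems by simp
    show ?thesis
    proof (cases "lft < a")
      case True
      show ?thesis
        by (rule step[of "a - 1" b a "a - 1"])
          (use True less.prems step_left[of a b] seg_left[of a b] in \<open>auto intro: uu_in_H\<close>)
    next
      case False
      then show ?thesis using b less.prems H_eq by simp
    qed
  qed
qed

text \<open>The level \<open>C\<close> may equal that of two added faces, since a single one stays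
  \<open>J - h\<close> below it. At the gate the level is exactly this.\<close>

lemma reach_single:
  assumes h: "0 < h" "h < J" and x: "lft \<le> x" "x \<le> x1"
    and C: "J * (real (per P) + 2) - h * (real (card P) + 2) \<le> C"
  shows "(P, insert (tt x) P) \<in> reach_rel J h C P H"
proof -
  have "energy J h P < C" "energy J h (insert (tt x) P) < C"
    using C h unfolding energy_def per_single[OF x] by (simp_all add: algebra_simps)
  moreover have "insert (tt x) P \<subseteq> H" "P \<subseteq> H" using tt_in_H[OF x] seg_subset[of lft x1] by (auto simp: H_eq)
  ultimately show ?thesis using tu_simps(5)[of x] unfolding reach_rel_def by blast
qed

lemma reach_full:
  assumes h: "0 < h" "h < J" and C: "J * (real (per P) + 2) - h * (real (card P) + 2) < C"
  shows "(P, H) \<in> (reach_rel J h C P H)\<^sup>*"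
proof -
  have "(P, seg lft lft) \<in> reach_rel J h C P H"
    unfolding seg_single using reach_single[OF h] lft_le C by simp
  moreover have "(seg lft lft, H) \<in> (reach_rel J h C P H)\<^sup>*"
    using reach_seg[OF h] lft_le C by simp
  ultimately show ?thesis by (meson converse_rtrancl_into_rtrancl)
qed

end

section \<open>Chains of extremal hexagons and their areas\<close>

lemma opt_hexE:
  assumes "opt_hex n W"
  obtains x0 x1 y0 y1 z0 z1 where "opt_params n x0 x1 y0 y1 z0 z1" "W = hexa x0 x1 y0 y1 z0 z1"
  using assms unfolding opt_hex_def by (elim exE conjE)

text \<open>With one more edge in total exactly one of the six bounds moves, by one. The rotations,
  alone or followed by the point reflection, bring that side to the bottom.\<close>

lemma bar_normal:
  assumes K: "opt_params n k0 k1 l0 l1 m0 m1" and M: "opt_params (Suc n) x0 x1 y0 y1 z0 z1"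
    and sub: "x0 \<le> k0" "k1 \<le> x1" "y0 \<le> l0" "l1 \<le> y1" "z0 \<le> m0" "m1 \<le> z1"
  obtains \<phi> a0 a1 b0 b1 c0 c1 where "lat_face \<phi>" "hex_bar n a0 a1 b0 b1 c0 c1"
    "\<phi> ` hexa k0 k1 l0 l1 m0 m1 = hex_bar.P a0 a1 b0 b1 c0 c1" "\<phi> ` hexa x0 x1 y0 y1 z0 z1 = hex_bar.H a0 a1 b0 b1 c0 c1"
proof -
  have res: thesis if low: "x0 = k0" "x1 = k1" "y0 = l0 - 1" "y1 = l1" "z0 = m0" "z1 = m1"
    and K: "opt_params n k0 k1 l0 l1 m0 m1" and M: "opt_params (Suc n) x0 x1 y0 y1 z0 z1"
    and \<phi>: "lat_face \<phi>" and im: "\<phi> ` A = hexa k0 k1 l0 l1 m0 m1" "\<phi> ` B = hexa x0 x1 y0 y1 z0 z1"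
    and AB: "A = hexa k0' k1' l0' l1' m0' m1'" "B = hexa x0' x1' y0' y1' z0' z1'"
    and that: "\<And>\<phi> a0 a1 b0 b1 c0 c1. lat_face \<phi> \<Longrightarrow> hex_bar n a0 a1 b0 b1 c0 c1 \<Longrightarrow>
      \<phi> ` hexa k0' k1' l0' l1' m0' m1' = hex_bar.P a0 a1 b0 b1 c0 c1 \<Longrightarrow>
      \<phi> ` hexa x0' x1' y0' y1' z0' z1' = hex_bar.H a0 a1 b0 b1 c0 c1 \<Longrightarrow> thesis"
    for k0 k1 l0 l1 m0 m1 x0 x1 y0 y1 z0 z1 \<phi> A B k0' k1' l0' l1' m0' m1' x0' x1' y0' y1' z0' z1'
  proof -
    have hb: "hex_bar n k0 k1 l0 l1 m0 m1" using K M unfolding low by (simp add: hex_bar_def)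
    show thesis
      by (rule that[OF \<phi> hb]) (use im in \<open>simp_all add: AB hex_bar.P_def[OF hb] hex_bar.H_def[OF hb] low\<close>)
  qed
  have rr: "(\<lambda>f. rot (rot f)) ` hexa x0 x1 y0 y1 z0 z1 = hexa z0 z1 x0 x1 y0 y1" for x0 x1 y0 y1 z0 z1
    by (simp add: image_rot_hexa flip: image_image)
  have ir: "(\<lambda>f. invf (rot f)) ` hexa x0 x1 y0 y1 z0 z1 = hexa (- y1) (- y0) (- z1) (- z0) (- x1 - 1) (- x0 - 1)"
    for x0 x1 y0 y1 z0 z1
    by (simp add: image_rot_hexa image_invf_hexa flip: image_image)
  have irr: "(\<lambda>f. invf (rot (rot f))) ` hexa x0 x1 y0 y1 z0 z1 = hexa (- z1) (- z0) (- x1) (- x0) (- y1 - 1) (- y0 - 1)"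
    for x0 x1 y0 y1 z0 z1
    by (simp only: image_image[of invf "\<lambda>f. rot (rot f)", symmetric] rr image_invf_hexa)
  note rots = lat_face_id lat_face_rot lat_face_comp[OF lat_face_rot lat_face_rot, unfolded comp_def]
  note invs = lat_face_invf lat_face_comp[OF lat_face_invf lat_face_rot, unfolded comp_def]
    lat_face_comp[OF lat_face_invf lat_face_comp[OF lat_face_rot lat_face_rot], unfolded comp_def]
  note K2 = opt_params_rot[OF K] and M2 = opt_params_rot[OF M]
  note K3 = opt_params_rot[OF K2] and M3 = opt_params_rot[OF M2]
  have tot: "(x1 - x0) + (y1 - y0) + (z1 - z0) = (k1 - k0) + (l1 - l0) + (m1 - m0) + 1"
    using K M by (simp add: opt_params_def)
  then have "y0 < l0 \<or> l1 < y1 \<or> x0 < k0 \<or> k1 < x1 \<or> z0 < m0 \<or> m1 < z1"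
    using sub by (smt (verit))
  then consider (y0) "y0 < l0" | (y1) "l1 < y1" | (x0) "x0 < k0" | (x1) "k1 < x1" | (z0) "z0 < m0" | (z1) "m1 < z1"
    by blast
  then show thesis
  proof cases
    case y0
    then have y0: "y0 = l0 - 1" "y1 = l1" "x0 = k0" "x1 = k1" "z0 = m0" "z1 = m1"
      using sub tot by linarith+
    show thesis by (rule res[OF _ _ _ _ _ _ K M rots(1) _ _ refl refl that]) (use y0 in auto)
  next
    case z0
    then have z0: "y0 = l0" "y1 = l1" "x0 = k0" "x1 = k1" "z0 = m0 - 1" "z1 = m1"
      using sub tot by linarith+
    show thesis
      by (rule res[OF _ _ _ _ _ _ K2 M2 rots(2) _ _ refl refl that])
        (use z0 in \<open>simp_all add: image_rot_hexa\<close>)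
  next
    case x0
    then have x0: "y0 = l0" "y1 = l1" "x0 = k0 - 1" "x1 = k1" "z0 = m0" "z1 = m1"
      using sub tot by linarith+
    show thesis
      by (rule res[OF _ _ _ _ _ _ K3 M3 rots(3) _ _ refl refl that])
        (use x0 in \<open>simp_all add: rr\<close>)
  next
    case y1
    then have y1: "y0 = l0" "y1 = l1 + 1" "x0 = k0" "x1 = k1" "z0 = m0" "z1 = m1"
      using sub tot by linarith+
    show thesis
      by (rule res[OF _ _ _ _ _ _ opt_params_invf[OF K] opt_params_invf[OF M] invs(1) _ _ refl refl that])
        (use y1 in \<open>simp_all add: image_invf_hexa\<close>)
  next
    case z1
    then have z1: "y0 = l0" "y1 = l1" "x0 = k0" "x1 = k1" "z0 = m0" "z1 = m1 + 1"
      using sub tot by linarith+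
    show thesis
      by (rule res[OF _ _ _ _ _ _ opt_params_invf[OF K2] opt_params_invf[OF M2] invs(2) _ _ refl refl that])
        (use z1 in \<open>simp_all add: ir\<close>)
  next
    case x1
    then have x1: "y0 = l0" "y1 = l1" "x0 = k0" "x1 = k1 + 1" "z0 = m0" "z1 = m1"
      using sub tot by linarith+
    show thesis
      by (rule res[OF _ _ _ _ _ _ opt_params_invf[OF K3] opt_params_invf[OF M3] invs(3) _ _ refl refl that])
        (use x1 in \<open>simp_all add: irr\<close>)
  qed
qed

text \<open>Removing a strip in a widest direction keeps the widths balanced; the sign of
  \<open>?v\<close> picks the end at which it must go to keep the hexagon centred.\<close>

lemma opt_params_pred:
  assumes "opt_params (Suc n) x0 x1 y0 y1 z0 z1" "3 \<le> n"
  obtains k0 k1 l0 l1 m0 m1 where "opt_params n k0 k1 l0 l1 m0 m1"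
    "x0 \<le> k0" "k1 \<le> x1" "y0 \<le> l0" "l1 \<le> y1" "z0 \<le> m0" "m1 \<le> z1"
proof -
  let ?v = "2 * (x0 + y0 + z0) + int n - 1"
  consider "y1 - y0 \<le> x1 - x0" "z1 - z0 \<le> x1 - x0" "?v \<le> 0" | "y1 - y0 \<le> x1 - x0" "z1 - z0 \<le> x1 - x0" "?v > 0"
    | "x1 - x0 \<le> y1 - y0" "z1 - z0 \<le> y1 - y0" "?v \<le> 0" | "x1 - x0 \<le> y1 - y0" "z1 - z0 \<le> y1 - y0" "?v > 0"
    | "x1 - x0 \<le> z1 - z0" "y1 - y0 \<le> z1 - z0" "?v \<le> 0" | "x1 - x0 \<le> z1 - z0" "y1 - y0 \<le> z1 - z0" "?v > 0"
    by linarith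
  then show thesis
  proof cases
    case 1 show thesis by (rule that[of "x0 + 1" x1 y0 y1 z0 z1]) (use assms 1 in \<open>auto simp: opt_params_def\<close>)
  next
    case 2 show thesis by (rule that[of x0 "x1 - 1" y0 y1 z0 z1]) (use assms 2 in \<open>auto simp: opt_params_def\<close>)
  next
    case 3 show thesis by (rule that[of x0 x1 "y0 + 1" y1 z0 z1]) (use assms 3 in \<open>auto simp: opt_params_def\<close>)
  next
    case 4 show thesis by (rule that[of x0 x1 y0 "y1 - 1" z0 z1]) (use assms 4 in \<open>auto simp: opt_params_def\<close>)
  next
    case 5 show thesis by (rule that[of x0 x1 y0 y1 "z0 + 1" z1]) (use assms 5 in \<open>auto simp: opt_params_def\<close>)
  next
    case 6 show thesis by (rule that[of x0 x1 y0 y1 z0 "z1 - 1"]) (use assms 6 in \<open>auto simp: opt_params_def\<close>)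
  qed
qed

text \<open>Dually, a narrowest direction is widened, at the end that keeps the centre.\<close>

lemma opt_params_succ:
  assumes "opt_params n k0 k1 l0 l1 m0 m1"
  obtains x0 x1 y0 y1 z0 z1 where "opt_params (Suc n) x0 x1 y0 y1 z0 z1"
    "x0 \<le> k0" "k1 \<le> x1" "y0 \<le> l0" "l1 \<le> y1" "z0 \<le> m0" "m1 \<le> z1"
proof -
  let ?v = "2 * (k0 + l0 + m0) + int n - 2"
  consider "k1 - k0 \<le> l1 - l0" "k1 - k0 \<le> m1 - m0" "?v \<ge> 0" | "k1 - k0 \<le> l1 - l0" "k1 - k0 \<le> m1 - m0" "?v < 0"
    | "l1 - l0 \<le> k1 - k0" "l1 - l0 \<le> m1 - m0" "?v \<ge> 0" | "l1 - l0 \<le> k1 - k0" "l1 - l0 \<le> m1 - m0" "?v < 0"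
    | "m1 - m0 \<le> k1 - k0" "m1 - m0 \<le> l1 - l0" "?v \<ge> 0" | "m1 - m0 \<le> k1 - k0" "m1 - m0 \<le> l1 - l0" "?v < 0"
    by linarith
  then show thesis
  proof cases
    case 1 show thesis by (rule that[of "k0 - 1" k1 l0 l1 m0 m1]) (use assms 1 in \<open>auto simp: opt_params_def\<close>)
  next
    case 2 show thesis by (rule that[of k0 "k1 + 1" l0 l1 m0 m1]) (use assms 2 in \<open>auto simp: opt_params_def\<close>)
  next
    case 3 show thesis by (rule that[of k0 k1 "l0 - 1" l1 m0 m1]) (use assms 3 in \<open>auto simp: opt_params_def\<close>)
  next
    case 4 show thesis by (rule that[of k0 k1 l0 "l1 + 1" m0 m1]) (use assms 4 in \<open>auto simp: opt_params_def\<close>)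
  next
    case 5 show thesis by (rule that[of k0 k1 l0 l1 "m0 - 1" m1]) (use assms 5 in \<open>auto simp: opt_params_def\<close>)
  next
    case 6 show thesis by (rule that[of k0 k1 l0 l1 m0 "m1 + 1"]) (use assms 6 in \<open>auto simp: opt_params_def\<close>)
  qed
qed

lemma opt_hex_pred:
  assumes "opt_hex (Suc n) W" "3 \<le> n"
  obtains \<phi> a0 a1 b0 b1 c0 c1 where "lat_face \<phi>" "hex_bar n a0 a1 b0 b1 c0 c1" "\<phi> ` W = hex_bar.H a0 a1 b0 b1 c0 c1"
proof -
  obtain x0 x1 y0 y1 z0 z1 where W: "opt_params (Suc n) x0 x1 y0 y1 z0 z1" "W = hexa x0 x1 y0 y1 z0 z1"
    using assms(1) by (rule opt_hexE)
  obtain k0 k1 l0 l1 m0 m1 where k: "opt_params n k0 k1 l0 l1 m0 m1"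
    "x0 \<le> k0" "k1 \<le> x1" "y0 \<le> l0" "l1 \<le> y1" "z0 \<le> m0" "m1 \<le> z1"
    using opt_params_pred[OF W(1) assms(2)] .
  show thesis by (rule bar_normal[OF k(1) W(1) k(2-)]) (use that W(2) in blast)
qed

lemma opt_hex_succ:
  assumes "opt_hex n W"
  obtains \<phi> a0 a1 b0 b1 c0 c1 where "lat_face \<phi>" "hex_bar n a0 a1 b0 b1 c0 c1" "\<phi> ` W = hex_bar.P a0 a1 b0 b1 c0 c1"
proof -
  obtain x0 x1 y0 y1 z0 z1 where W: "opt_params n x0 x1 y0 y1 z0 z1" "W = hexa x0 x1 y0 y1 z0 z1"
    using assms(1) by (rule opt_hexE)
  obtain k0 k1 l0 l1 m0 m1 where k: "opt_params (Suc n) k0 k1 l0 l1 m0 m1"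
    "k0 \<le> x0" "x1 \<le> k1" "l0 \<le> y0" "y1 \<le> l1" "m0 \<le> z0" "z1 \<le> m1"
    using opt_params_succ[OF W(1)] .
  show thesis by (rule bar_normal[OF W(1) k(1) k(2-)]) (use that W(2) in blast)
qed

lemma (in hex_bar) opt_hex_PH: "opt_hex n P" "opt_hex (Suc n) H"
  using core full unfolding opt_hex_def P_def H_def by blast+

text \<open>\<open>s + dx + dz\<close> is the number of upward faces in the bar. That the enlarged
  hexagon is balanced and centred too makes \<open>dy\<close> a narrowest width and excludes the
  lowest value of \<open>s\<close>; then \<open>n\<close> modulo 6 determines the rest.\<close>

lemma bar_arith:
  fixes s dx dy dz k :: int
  assumes "dx = dy \<or> dx = dy + 1" "dz = dy \<or> dz = dy + 1" "2 * s + n = 2 \<or> 2 * s + n = 3" "dx + dy + dz + 3 = n"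
  shows "n = 6 * k \<Longrightarrow> s + dx + dz = k - 1"
    "n = 6 * k + 1 \<Longrightarrow> s + dx + dz = k"
    "n = 6 * k + 2 \<Longrightarrow> s + dx + dz = k"
    "n = 6 * k + 3 \<Longrightarrow> s + dx + dz = k"
    "n = 6 * k + 4 \<Longrightarrow> s + dx + dz = k"
    "n = 6 * k + 5 \<Longrightarrow> s + dx + dz = k + 1"
proof -
  show "s + dx + dz = k - 1" if "n = 6 * k"
    using that assms by (elim disjE) arith+
  show "s + dx + dz = k" if "n = 6 * k + 1"
    using that assms by (elim disjE) arith+
  show "s + dx + dz = k" if "n = 6 * k + 2"
    using that assms by (elim disjE) arith+
  show "s + dx + dz = k" if "n = 6 * k + 3"
    using that assms by (elim disjE) arith+
  show "s + dx + dz = k" if "n = 6 * k + 4"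
    using that assms by (elim disjE) arith+
  show "s + dx + dz = k + 1" if "n = 6 * k + 5"
    using that assms by (elim disjE) arith+
qed

lemma (in hex_bar) bar_length:
  assumes "3 \<le> n"
  shows "max_area (Suc n) = max_area n + 2 * nat (x1 - lft) + 1"
proof -
  define s dx dy dz where "s = x0 + y0 + z0" and "dx = x1 - x0" and "dy = y1 - y0" and "dz = z1 - z0"
  have "x1 - lft = s + dx + dz" by (simp add: s_def dx_def dz_def lft_def)
  have c: "dx + dy + dz + 3 = int n" "\<bar>dx - dy\<bar> \<le> 1" "\<bar>dy - dz\<bar> \<le> 1" "\<bar>dz - dx\<bar> \<le> 1" "\<bar>2 * s + int n - 2\<bar> \<le> 1"
    using core by (auto simp: opt_params_def s_def dx_def dy_def dz_def)
  have f: "\<bar>dx - dy - 1\<bar> \<le> 1" "\<bar>dy + 1 - dz\<bar> \<le> 1" "\<bar>2 * s + int n - 3\<bar> \<le> 1"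
    using full by (auto simp: opt_params_def s_def dx_def dy_def dz_def)
  have l: "x1 - lft = s + dx + dz" by (simp add: s_def dx_def dz_def lft_def)
  have e: "dx = dy \<or> dx = dy + 1" "dz = dy \<or> dz = dy + 1"
    using c(2-4) f(1,2) by linarith+
  have v: "2 * s + int n = 2 \<or> 2 * s + int n = 3"
    using c(5) f(3) by linarith
  show ?thesis
  proof (cases n rule: mod6_exhaust)
    case (1 k)
    then have i: "int n = 6 * int k" and k: "k \<ge> 1" using assms by auto
    have "s + dx + dz = int k - 1" using bar_arith(1)[OF e v c(1) i] .
    then have "nat (x1 - lft) = k - 1" using l k by simp
    moreover have "Suc n = 6 * k + 1" using 1 by simp
    ultimately show ?thesis unfolding \<open>Suc n = _\<close> unfolding 1 max_area_mod6 using k by simp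
  next
    case (2 k)
    then have i: "int n = 6 * int k + 1" by auto
    have "s + dx + dz = int k" using bar_arith(2)[OF e v c(1) i] .
    then have m: "nat (x1 - lft) = k" using l by simp
    have S: "Suc n = 6 * k + 2" using 2 by simp
    have "k \<ge> 1" using assms 2 by simp
    then show ?thesis unfolding S m unfolding 2 max_area_mod6 by simp
  next
    case (3 k)
    then have i: "int n = 6 * int k + 2" by auto
    have "s + dx + dz = int k" using bar_arith(3)[OF e v c(1) i] .
    then have m: "nat (x1 - lft) = k" using l by simp
    have S: "Suc n = 6 * k + 3" using 3 by simp
    show ?thesis unfolding S m unfolding 3 max_area_mod6 by simp
  next
    case (4 k)
    then have i: "int n = 6 * int k + 3" by auto
    have "s + dx + dz = int k" using bar_arith(4)[OF e v c(1) i] .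
    then have m: "nat (x1 - lft) = k" using l by simp
    have S: "Suc n = 6 * k + 4" using 4 by simp
    show ?thesis unfolding S m unfolding 4 max_area_mod6 by simp
  next
    case (5 k)
    then have i: "int n = 6 * int k + 4" by auto
    have "s + dx + dz = int k" using bar_arith(5)[OF e v c(1) i] .
    then have m: "nat (x1 - lft) = k" using l by simp
    have S: "Suc n = 6 * k + 5" using 5 by simp
    show ?thesis unfolding S m unfolding 5 max_area_mod6 by simp
  next
    case (6 k)
    then have i: "int n = 6 * int k + 5" by auto
    have "s + dx + dz = int k + 1" using bar_arith(6)[OF e v c(1) i] .
    then have m: "nat (x1 - lft) = k + 1" using l by simp
    have S: "Suc n = 6 * k + 6" using 6 by simp
    show ?thesis unfolding S m unfolding 6 max_area_mod6 max_area_mod6_pred by simp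
  qed
qed

lemma opt_hex_finite: "opt_hex n W \<Longrightarrow> finite W"
  by (auto simp: opt_hex_def)

text \<open>No area formula for hexagons is involved: perimeter 3 is a single face, and each further
  step adds a bar whose size is the increment of \<open>max_area\<close>.\<close>

lemma opt_hex_size:
  assumes "3 \<le> n" "opt_hex n W"
  shows "per W = n \<and> card W = max_area n"
  using assms
proof (induction n arbitrary: W rule: nat_induct_at_least)
  case base
  from base.prems obtain x0 x1 y0 y1 z0 z1 where W: "opt_params 3 x0 x1 y0 y1 z0 z1" "W = hexa x0 x1 y0 y1 z0 z1"
    by (rule opt_hexE)
  have eq: "x1 = x0" "y1 = y0" "z1 = z0" "x0 + y0 + z0 = 0 \<or> x0 + y0 + z0 = -1"
    using W(1) unfolding opt_params_def of_nat_numeral by (smt (z3))+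
  have "W = {(x0, y0, x0 + y0 + z0 = 0)}"
  proof (rule set_eqI)
    fix f show "f \<in> W \<longleftrightarrow> f \<in> {(x0, y0, x0 + y0 + z0 = 0)}"
      using eq unfolding W(2) by (cases f; cases "isup f") auto
  qed
  moreover have "per {f} = 3" for f using per_insert[of "{}" f] by (simp add: deg_def)
  moreover have "max_area 3 = 1" by (simp add: max_area_def)
  ultimately show ?case by simp
next
  case (Suc n)
  obtain \<phi> a0 a1 b0 b1 c0 c1 where \<phi>: "lat_face \<phi>" and hb: "hex_bar n a0 a1 b0 b1 c0 c1"
    and im: "\<phi> ` W = hex_bar.H a0 a1 b0 b1 c0 c1"
    using opt_hex_pred[OF Suc.prems Suc.hyps] .
  interpret hex_bar n a0 a1 b0 b1 c0 c1 by (rule hb)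
  have "per P = n \<and> card P = max_area n" using Suc.IH opt_hex_PH(1) by blast
  then have "per H = Suc n \<and> card H = max_area (Suc n)"
    using H_size bar_length[OF Suc.hyps] by simp
  then show ?case
    using im face_iso_per[OF lat_face_iso[OF \<phi>] opt_hex_finite[OF Suc.prems]] face_iso_card[OF lat_face_iso[OF \<phi>]]
    by metis
qed

text \<open>Perimeter and area are preserved, and together they characterise extremal hexagons,
  which spares transporting the parameters.\<close>

lemma opt_hex_image:
  assumes "5 \<le> n" "opt_hex n W" "face_iso \<phi>"
  shows "opt_hex n (\<phi> ` W)"
  using extremal_structure[OF assms(1)] opt_hex_size[of n W] face_iso_per[OF assms(3)] face_iso_card[OF assms(3)]
    opt_hex_finite[OF assms(2)] assms by simp

text \<open>As 3 does not divide \<open>p\<close>, exactly one width differs from the other two, and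
  a rotation makes it the \<open>y\<close> width. As \<open>p\<close> is odd, the centring condition
  leaves two values, exchanged by the point reflection. A translation fixes the corner.\<close>

lemma opt_params_canonical:
  assumes p: "opt_params p x0 x1 y0 y1 z0 z1" and odd: "odd p" and nd: "\<not> 3 dvd p"
  obtains \<phi> a b c where "lat_face \<phi>" "\<phi> ` hexa x0 x1 y0 y1 z0 z1 = hexa 0 a 0 b c (c + a)"
    "2 * a + b + 3 = int p" "a = b + 1 \<or> b = a + 1" "2 * c + int p = 3"
proof -
  have central: thesis if q: "opt_params p x0 x1 y0 y1 z0 z1" and e: "x1 - x0 = z1 - z0" and v: "2 * (x0 + y0 + z0) + int p = 3"
    and \<phi>: "lat_face \<phi>" "\<phi> ` W = hexa x0 x1 y0 y1 z0 z1"
    and that: "\<And>\<phi> a b c. lat_face \<phi> \<Longrightarrow> \<phi> ` W = hexa 0 a 0 b c (c + a) \<Longrightarrow>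
      2 * a + b + 3 = int p \<Longrightarrow> a = b + 1 \<or> b = a + 1 \<Longrightarrow> 2 * c + int p = 3 \<Longrightarrow> thesis"
    for x0 x1 y0 y1 z0 z1 \<phi> W
  proof (rule that)
    show "lat_face (\<lambda>f. trf (- x0) (- y0) (\<phi> f))"
      using lat_face_comp[OF lat_face_trf \<phi>(1)] by (simp add: comp_def)
    have "(\<lambda>f. trf (- x0) (- y0) (\<phi> f)) ` W = trf (- x0) (- y0) ` \<phi> ` W" by (simp add: image_image)
    also have "\<dots> = hexa 0 (x1 - x0) 0 (y1 - y0) (x0 + y0 + z0) (x0 + y0 + z0 + (x1 - x0))"
      unfolding \<phi>(2) image_trf_hexa using e by (simp add: algebra_simps)
    finally show "(\<lambda>f. trf (- x0) (- y0) (\<phi> f)) ` W = hexa 0 (x1 - x0) 0 (y1 - y0) (x0 + y0 + z0) (x0 + y0 + z0 + (x1 - x0))" .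
    show "2 * (x1 - x0) + (y1 - y0) + 3 = int p" using q e by (simp add: opt_params_def)
    then have "x1 - x0 \<noteq> y1 - y0" using nd by presburger
    then show "x1 - x0 = y1 - y0 + 1 \<or> y1 - y0 = x1 - x0 + 1" using q by (auto simp: opt_params_def)
  qed (use v in simp)
  have outer: thesis if q: "opt_params p x0 x1 y0 y1 z0 z1" and e: "x1 - x0 = z1 - z0"
    and \<phi>: "lat_face \<phi>" "\<phi> ` W = hexa x0 x1 y0 y1 z0 z1"
    and that: "\<And>\<phi> a b c. lat_face \<phi> \<Longrightarrow> \<phi> ` W = hexa 0 a 0 b c (c + a) \<Longrightarrow>
      2 * a + b + 3 = int p \<Longrightarrow> a = b + 1 \<or> b = a + 1 \<Longrightarrow> 2 * c + int p = 3 \<Longrightarrow> thesis"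
    for x0 x1 y0 y1 z0 z1 \<phi> W
  proof -
    have "\<bar>2 * (x0 + y0 + z0) + int p - 2\<bar> \<le> 1" using q by (simp add: opt_params_def)
    moreover have "odd (2 * (x0 + y0 + z0) + int p - 2)" using odd by simp
    moreover have "q = 1 \<or> q = -1" if "\<bar>q\<bar> \<le> 1" "odd q" for q :: int
      using that by presburger
    ultimately have "2 * (x0 + y0 + z0) + int p - 2 = 1 \<or> 2 * (x0 + y0 + z0) + int p - 2 = -1"
      by blast
    then consider "2 * (x0 + y0 + z0) + int p = 3" | "2 * (x0 + y0 + z0) + int p = 1"
      by linarith
    then show thesis
    proof cases
      case 1 show thesis by (rule central[OF q e 1 \<phi> that])
    next
      case 2
      have im: "(\<lambda>f. invf (\<phi> f)) ` W = hexa (- x1) (- x0) (- y1) (- y0) (- z1 - 1) (- z0 - 1)"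
        using \<phi>(2) image_invf_hexa by (simp flip: image_image)
      show thesis
        by (rule central[OF opt_params_invf[OF q] _ _ _ im that])
          (use e 2 q lat_face_comp[OF lat_face_invf \<phi>(1)] in \<open>auto simp: opt_params_def comp_def\<close>)
    qed
  qed
  have "x1 - x0 = z1 - z0 \<or> y1 - y0 = x1 - x0 \<or> z1 - z0 = y1 - y0"
    using p unfolding opt_params_def by (smt (z3))
  then consider "x1 - x0 = z1 - z0" | "y1 - y0 = x1 - x0" | "z1 - z0 = y1 - y0" by blast
  then show thesis
  proof cases
    case 1
    show thesis by (rule outer[OF p 1 lat_face_id _ that]) simp_all
  next
    case 2
    show thesis by (rule outer[OF opt_params_rot[OF p] 2 lat_face_rot _ that]) (simp_all add: image_rot_hexa)
  next
    case 3
    have im: "(\<lambda>f. rot (rot f)) ` hexa x0 x1 y0 y1 z0 z1 = hexa z0 z1 x0 x1 y0 y1"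
      by (simp add: image_rot_hexa flip: image_image)
    show thesis
      by (rule outer[OF opt_params_rot[OF opt_params_rot[OF p]] 3 _ im that])
        (use lat_face_comp[OF lat_face_rot lat_face_rot] in \<open>simp_all add: comp_def\<close>)
  qed
qed

text \<open>\<open>p\<close> modulo 3 decides which of the two width patterns of the normal form
  occurs, so the normal form is unique.\<close>

lemma opt_hex_congruent:
  assumes "odd p" "\<not> 3 dvd p" "opt_hex p V" "opt_hex p W"
  obtains \<phi> where "lat_face \<phi>" "W = \<phi> ` V"
proof -
  from assms(3) obtain x0 x1 y0 y1 z0 z1 where V: "opt_params p x0 x1 y0 y1 z0 z1" "V = hexa x0 x1 y0 y1 z0 z1"
    by (rule opt_hexE)
  from assms(4) obtain x0' x1' y0' y1' z0' z1' where W: "opt_params p x0' x1' y0' y1' z0' z1'" "W = hexa x0' x1' y0' y1' z0' z1'"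
    by (rule opt_hexE)
  obtain \<phi> a b c where \<phi>: "lat_face \<phi>" "\<phi> ` V = hexa 0 a 0 b c (c + a)"
    and 1: "2 * a + b + 3 = int p" "a = b + 1 \<or> b = a + 1" "2 * c + int p = 3"
    using opt_params_canonical[OF V(1) assms(1,2)] V(2) by metis
  obtain \<psi> a' b' c' where \<psi>: "lat_face \<psi>" "\<psi> ` W = hexa 0 a' 0 b' c' (c' + a')"
    and 2: "2 * a' + b' + 3 = int p" "a' = b' + 1 \<or> b' = a' + 1" "2 * c' + int p = 3"
    using opt_params_canonical[OF W(1) assms(1,2)] W(2) by metis
  have "c = c'" using 1 2 by simp
  moreover have "a = a' \<and> b = b'" using 1(1,2) 2(1,2) by (smt (z3))
  ultimately have eq: "\<psi> ` W = \<phi> ` V" using \<phi> \<psi> by simp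
  obtain \<chi> where \<chi>: "lat_face \<chi>" "\<And>f. \<chi> (\<psi> f) = f" using lat_face_has_inv[OF \<psi>(1)] by metis
  have "W = \<chi> ` \<psi> ` W" using \<chi>(2) by (simp add: image_image)
  then have "W = (\<chi> \<circ> \<phi>) ` V" unfolding eq by (simp add: image_comp)
  then show thesis using that lat_face_comp[OF \<chi>(1) \<phi>(1)] by blast
qed

section \<open>The torus\<close>

definition perT :: "int \<Rightarrow> face set \<Rightarrow> nat" where
  "perT L A = bdry (\<lambda>f. proj L (nx f)) A + bdry (\<lambda>f. proj L (ny f)) A + bdry (\<lambda>f. proj L (nz f)) A"

definition energyT :: "real \<Rightarrow> real \<Rightarrow> int \<Rightarrow> face set \<Rightarrow> real" where
  "energyT J h L A = J * real (perT L A) - h * real (card A)"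

lemma proj_coords [simp]: "xc (proj L f) = xc f mod L" "yc (proj L f) = yc f mod L" "isup (proj L f) = isup f"
  by (cases f; simp)+

lemma face_eqI3: "xc f = xc g \<Longrightarrow> yc f = yc g \<Longrightarrow> isup f = isup g \<Longrightarrow> f = g"
  by (cases f; cases g) auto

lemma in_Lam: "f \<in> Lam L \<longleftrightarrow> 0 \<le> xc f \<and> xc f < L \<and> 0 \<le> yc f \<and> yc f < L"
  by (cases f) (simp add: Lam_def)

lemma proj_in_Lam: "L > 0 \<Longrightarrow> proj L f \<in> Lam L"
  by (simp add: in_Lam)

lemma proj_Lam [simp]: "f \<in> Lam L \<Longrightarrow> proj L f = f"
  by (rule face_eqI3) (auto simp: in_Lam)

lemma proj_eq_iff: "proj L f = proj L g \<longleftrightarrow> xc f mod L = xc g mod L \<and> yc f mod L = yc g mod L \<and> isup f = isup g"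
  by (cases f; cases g) auto

lemma proj_nb [simp]: "proj L (nx (proj L f)) = proj L (nx f)" "proj L (ny (proj L f)) = proj L (ny f)"
  "proj L (nz (proj L f)) = proj L (nz f)"
  by (simp_all add: proj_eq_iff sgn_up_def mod_simps)

lemma finite_Lam: "finite (Lam L)"
proof -
  have "Lam L \<subseteq> {0..<L} \<times> {0..<L} \<times> UNIV" by (auto simp: Lam_def)
  then show ?thesis by (rule finite_subset) simp
qed

lemma card_Lam: "0 \<le> L \<Longrightarrow> int (card (Lam L)) = 2 * L * L"
proof -
  assume L: "0 \<le> L"
  have "Lam L = {0..<L} \<times> {0..<L} \<times> UNIV" by (auto simp: Lam_def)
  then show ?thesis using L by (simp add: card_cartesian_product)
qed

definition torus_nb :: "int \<Rightarrow> face \<Rightarrow> face \<Rightarrow> bool" where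
  "torus_nb L f g \<longleftrightarrow> g = proj L (nx f) \<or> g = proj L (ny f) \<or> g = proj L (nz f)"

lemma torus_adj_iff:
  assumes "L > 0"
  shows "torus_adj L x y \<longleftrightarrow> x \<in> Lam L \<and> torus_nb L x y"
proof
  assume "torus_adj L x y"
  then obtain x' y' where "x \<in> Lam L" "proj L x' = x" "proj L y' = y" "face_nb x' y'"
    unfolding torus_adj_def face_adj_nb by blast
  then show "x \<in> Lam L \<and> torus_nb L x y"
    unfolding face_nb_def torus_nb_def using proj_nb by metis
next
  assume *: "x \<in> Lam L \<and> torus_nb L x y"
  then obtain y' where "face_nb x y'" "y = proj L y'" unfolding face_nb_def torus_nb_def by blast
  then show "torus_adj L x y"
    unfolding torus_adj_def face_adj_nb using * proj_in_Lam[OF assms] proj_Lam by blast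
qed

lemma mod_eq_near:
  fixes x y L :: int
  assumes "x mod L = y mod L" "\<bar>x - y\<bar> < L"
  shows "x = y"
proof -
  have "L dvd x - y" using assms(1) by (simp add: mod_eq_dvd_iff)
  then have "L dvd y - x" by (simp add: dvd_diff_commute)
  show ?thesis
  proof (rule ccontr)
    assume "x \<noteq> y"
    then consider "0 < x - y" | "0 < y - x" by linarith
    then show False
      using zdvd_imp_le[OF \<open>L dvd x - y\<close>] zdvd_imp_le[OF \<open>L dvd y - x\<close>] assms(2) by cases linarith+
  qed
qed

lemma proj_eq_near:
  assumes "proj L f = proj L g" "\<bar>xc f - xc g\<bar> < L" "\<bar>yc f - yc g\<bar> < L"
  shows "f = g"
proof -
  have *: "xc f mod L = xc g mod L" "yc f mod L = yc g mod L" "isup f = isup g"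
    using assms(1) unfolding proj_eq_iff by blast+
  show ?thesis
    by (rule face_eqI3[OF mod_eq_near[OF *(1) assms(2)] mod_eq_near[OF *(2) assms(3)] *(3)])
qed

text \<open>For \<open>L = 1\<close> the three neighbours of a face coincide; from
  \<open>L = 2\<close> on, unordered pairs and edges correspond one to one.\<close>

lemma torus_nb_distinct:
  assumes "L \<ge> 2"
  shows "proj L (nx f) \<noteq> proj L (ny f)" "proj L (nx f) \<noteq> proj L (nz f)" "proj L (ny f) \<noteq> proj L (nz f)"
proof -
  have *: "(x + sgn_up f) mod L \<noteq> x mod L" for x
  proof
    assume eq: "(x + sgn_up f) mod L = x mod L"
    have "\<bar>x + sgn_up f - x\<bar> < L" using assms by (simp add: sgn_up_def)
    from mod_eq_near[OF eq this] show False by (simp add: sgn_up_def split: if_splits)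
  qed
  show "proj L (nx f) \<noteq> proj L (ny f)" "proj L (nx f) \<noteq> proj L (nz f)" "proj L (ny f) \<noteq> proj L (nz f)"
    unfolding proj_eq_iff nb_coords using * by metis+
qed

lemma torus_nb_sym:
  assumes "x \<in> Lam L" "torus_nb L x y"
  shows "torus_nb L y x"
proof -
  have "x = proj L (nx y) \<or> x = proj L (ny y) \<or> x = proj L (nz y)"
    using assms unfolding torus_nb_def
    by (elim disjE) (simp_all add: nb_nb)
  then show ?thesis by (simp add: torus_nb_def)
qed

lemma torus_nb_irrefl: "\<not> torus_nb L x x"
proof
  assume "torus_nb L x x"
  then have "isup x = (\<not> isup x)" unfolding torus_nb_def
    by (elim disjE) (metis nb_coords(10) nb_coords(11) nb_coords(12) proj_coords(3))+
  then show False by simp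
qed

lemma perT_pairs:
  assumes "finite A" "L \<ge> 2"
  shows "perT L A = card {(f, g). f \<in> A \<and> g \<notin> A \<and> torus_nb L f g}"
proof -
  let ?S = "\<lambda>i. (\<lambda>f. (f, proj L (i f))) ` {f \<in> A. proj L (i f) \<notin> A}"
  have c: "card (?S i) = bdry (\<lambda>f. proj L (i f)) A" for i
    unfolding bdry_def by (rule card_image) (auto simp: inj_on_def)
  have fin: "finite (?S i)" for i using assms by auto
  have "{(f, g). f \<in> A \<and> g \<notin> A \<and> torus_nb L f g} = ?S nx \<union> ?S ny \<union> ?S nz"
    by (auto simp: torus_nb_def)
  moreover have "card (?S nx \<union> ?S ny \<union> ?S nz) = card (?S nx) + card (?S ny) + card (?S nz)"
  proof -
    have "?S nx \<inter> ?S ny = {}" "(?S nx \<union> ?S ny) \<inter> ?S nz = {}"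
      using torus_nb_distinct[OF assms(2)] by blast+
    then show ?thesis using fin by (simp add: card_Un_disjoint)
  qed
  ultimately show ?thesis by (simp add: c perT_def)
qed

text \<open>Compared with all minus, the product of a pair changes by 2 exactly at boundary edges,
  and each plus spin changes the sum of spins by 2; the factors 1/2 absorb this.\<close>

lemma Ham_energyT:
  assumes L: "L \<ge> 2" and \<sigma>: "\<sigma> \<in> Conf L"
  shows "Ham J h L \<sigma> = Ham J h L (all_minus L) + energyT J h L (plus_set L \<sigma>)"
proof -
  let ?A = "plus_set L \<sigma>"
  let ?S = "{(f, g). f \<in> ?A \<and> g \<notin> ?A \<and> torus_nb L f g}"
  let ?D = "{e \<in> nn_pairs L. e \<inter> ?A \<noteq> {} \<and> \<not> e \<subseteq> ?A}"
  have ALam: "?A \<subseteq> Lam L" by (auto simp: plus_set_def)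
  then have finA: "finite ?A" using finite_Lam finite_subset by blast
  have nn: "nn_pairs L = {{x, y} | x y. x \<in> Lam L \<and> torus_nb L x y}"
    unfolding nn_pairs_def using torus_adj_iff[of L] L by simp
  have nbL: "y \<in> Lam L" if "torus_nb L x y" for x y
    using that proj_in_Lam[of L] L unfolding torus_nb_def by (elim disjE) (simp_all only:)
  have "nn_pairs L \<subseteq> Pow (Lam L)" unfolding nn using nbL by blast
  then have finN: "finite (nn_pairs L)" using finite_Lam by (meson finite_Pow_iff finite_subset)
  have val: "\<sigma> x = (if x \<in> ?A then 1 else -1)" if "x \<in> Lam L" for x
    using \<sigma> that unfolding Conf_def plus_set_def by fastforce
  have prod: "(\<Prod>i\<in>e. real_of_int (\<sigma> i)) = 1 - 2 * of_bool (e \<in> ?D)"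
    "(\<Prod>i\<in>e. real_of_int (all_minus L i)) = 1" if e0: "e \<in> nn_pairs L" for e
  proof -
    obtain x y where e: "e = {x, y}" "x \<in> Lam L" "torus_nb L x y" using e0 unfolding nn by blast
    have xy: "x \<noteq> y" "y \<in> Lam L" using e nbL torus_nb_irrefl by blast+
    show "(\<Prod>i\<in>e. real_of_int (\<sigma> i)) = 1 - 2 * of_bool (e \<in> ?D)"
      using val[OF e(2)] val[OF xy(2)] e0 xy(1) unfolding e(1) by auto
    show "(\<Prod>i\<in>e. real_of_int (all_minus L i)) = 1"
      unfolding e(1) using xy e(2) by (simp add: all_minus_def)
  qed
  \<comment> \<open>An unordered boundary pair has exactly one orientation from inside to outside,
    so it matches one ordered pair counted by \<open>perT\<close>.\<close>
  have im: "(\<lambda>(f, g). {f, g}) ` ?S = ?D"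
  proof
    show "(\<lambda>(f, g). {f, g}) ` ?S \<subseteq> ?D"
    proof
      fix e assume "e \<in> (\<lambda>(f, g). {f, g}) ` ?S"
      then obtain q where q: "q \<in> ?S" "e = (\<lambda>(f, g). {f, g}) q" by (rule imageE)
      obtain x y where "q = (x, y)" by (rule prod.exhaust)
      then have "e = {x, y}" "x \<in> ?A" "y \<notin> ?A" "torus_nb L x y" using q by simp_all
      moreover from this have "e \<in> nn_pairs L" unfolding nn using ALam by blast
      ultimately show "e \<in> ?D" by blast
    qed
    show "?D \<subseteq> (\<lambda>(f, g). {f, g}) ` ?S"
    proof
      fix e assume e: "e \<in> ?D"
      then obtain x y where xy: "e = {x, y}" "x \<in> Lam L" "torus_nb L x y" unfolding nn by blast
      have "(x, y) \<in> ?S \<or> (y, x) \<in> ?S" using e xy torus_nb_sym by auto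
      then show "e \<in> (\<lambda>(f, g). {f, g}) ` ?S" unfolding xy(1) by (metis (no_types, lifting) case_prod_conv image_eqI insert_commute)
    qed
  qed
  have inj: "inj_on (\<lambda>(f, g). {f, g}) ?S"
  proof (rule inj_onI)
    fix q q' assume q: "q \<in> ?S" "q' \<in> ?S" "(\<lambda>(f, g). {f, g}) q = (\<lambda>(f, g). {f, g}) q'"
    obtain x y where xy: "q = (x, y)" by (rule prod.exhaust)
    obtain x' y' where xy': "q' = (x', y')" by (rule prod.exhaust)
    have "{x, y} = {x', y'}" "x \<in> ?A" "x' \<in> ?A" "y \<notin> ?A" "y' \<notin> ?A" using q unfolding xy xy' by simp_all
    then show "q = q'" unfolding xy xy' doubleton_eq_iff by blast
  qed
  have D: "card ?D = perT L ?A"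
    using card_image[OF inj] unfolding im perT_pairs[OF finA L] .
  have "(\<Sum>e\<in>nn_pairs L. \<Prod>i\<in>e. real_of_int (\<sigma> i)) = (\<Sum>e\<in>nn_pairs L. 1 - 2 * of_bool (e \<in> ?D))"
    by (rule sum.cong) (use prod in auto)
  also have "\<dots> = (\<Sum>e\<in>nn_pairs L. 1) - 2 * real (card ?D)"
  proof -
    have "(\<Sum>e\<in>nn_pairs L. of_bool (e \<in> ?D) :: real) = real (card (nn_pairs L \<inter> ?D))"
      using finN by (simp add: of_bool_def sum.If_cases Int_def)
    moreover have "nn_pairs L \<inter> ?D = ?D" by blast
    ultimately show ?thesis by (simp add: sum_subtractf sum_distrib_left[symmetric])
  qed
  finally have s1: "(\<Sum>e\<in>nn_pairs L. \<Prod>i\<in>e. real_of_int (\<sigma> i)) = (\<Sum>e\<in>nn_pairs L. 1) - 2 * real (card ?D)" .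
  have s2: "(\<Sum>e\<in>nn_pairs L. \<Prod>i\<in>e. real_of_int (all_minus L i)) = (\<Sum>e\<in>nn_pairs L. 1)"
    by (rule sum.cong) (use prod in auto)
  have "(\<Sum>i\<in>Lam L. real_of_int (\<sigma> i)) = (\<Sum>i\<in>Lam L. real_of_int (all_minus L i) + 2 * of_bool (i \<in> ?A))"
    by (rule sum.cong) (use val in \<open>auto simp: all_minus_def\<close>)
  also have "\<dots> = (\<Sum>i\<in>Lam L. real_of_int (all_minus L i)) + 2 * real (card ?A)"
  proof -
    have "(\<Sum>i\<in>Lam L. of_bool (i \<in> ?A) :: real) = real (card (Lam L \<inter> ?A))"
      using finite_Lam by (simp add: of_bool_def sum.If_cases Int_def)
    moreover have "Lam L \<inter> ?A = ?A" using ALam by blast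
    ultimately show ?thesis by (simp add: sum.distrib sum_distrib_left[symmetric])
  qed
  finally show ?thesis
    unfolding Ham_def energyT_def s1 s2 D by (simp add: algebra_simps)
qed

text \<open>\<open>proj\<close> is injective on sets that fit, and with room for one more strip it also preserves perimeters.\<close>

definition fits :: "int \<Rightarrow> face set \<Rightarrow> bool" where
  "fits L W \<longleftrightarrow> (\<exists>a b. \<forall>f\<in>W. a \<le> xc f \<and> xc f < a + L \<and> b \<le> yc f \<and> yc f < b + L)"

lemma fits_mono: "fits L W \<Longrightarrow> V \<subseteq> W \<Longrightarrow> fits L V"
  unfolding fits_def by blast

text \<open>In both coordinates a neighbour of \<open>W\<close> differs by less than
  \<open>L\<close> from every face of \<open>W\<close>, so the projection glues no boundary edge to
  the opposite side.\<close>

lemma fits_proj_mem: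
  assumes "fits (L - 1) W" "f \<in> W" "face_nb f g" "proj L g \<in> proj L ` W"
  shows "g \<in> W"
proof -
  obtain a b where ab: "\<And>f. f \<in> W \<Longrightarrow> a \<le> xc f \<and> xc f < a + (L - 1) \<and> b \<le> yc f \<and> yc f < b + (L - 1)"
    using assms(1) fits_def by metis
  obtain k where k: "k \<in> W" "proj L g = proj L k" using assms(4) by blast
  have "\<bar>xc g - xc k\<bar> < L" "\<bar>yc g - yc k\<bar> < L"
    using coord_nb(1,2)[OF assms(3)] ab[OF assms(2)] ab[OF k(1)] by linarith+
  then have "g = k" using k(2) proj_eq_near by blast
  then show ?thesis using k(1) by simp
qed

lemma fits_inj:
  assumes "fits L W"
  shows "inj_on (proj L) W"
proof (rule inj_onI)
  obtain a b where ab: "\<And>f. f \<in> W \<Longrightarrow> a \<le> xc f \<and> xc f < a + L \<and> b \<le> yc f \<and> yc f < b + L"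
    using assms(1) fits_def by metis
  fix f g assume "f \<in> W" "g \<in> W" "proj L f = proj L g"
  moreover from this have "\<bar>xc f - xc g\<bar> < L" "\<bar>yc f - yc g\<bar> < L"
    using ab[of f] ab[of g] by linarith+
  ultimately show "f = g" using proj_eq_near by blast
qed

lemma fits_weaken: "fits M W \<Longrightarrow> M \<le> L \<Longrightarrow> fits L W"
  unfolding fits_def by force

lemma perT_proj:
  assumes f: "fits (L - 1) W" and fin: "finite W"
  shows "perT L (proj L ` W) = per W" "card (proj L ` W) = card W"
proof -
  have inj: "inj_on (proj L) W" using fits_inj[OF fits_weaken[OF f, of L]] by simp
  show "card (proj L ` W) = card W" using inj by (rule card_image)
  have *: "bdry (\<lambda>f. proj L (i f)) (proj L ` W) = bdry i W"
    if i: "\<And>f. proj L (i (proj L f)) = proj L (i f)" "\<And>f. face_nb f (i f)" for i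
  proof -
    have "{g \<in> proj L ` W. proj L (i g) \<notin> proj L ` W} = proj L ` {f \<in> W. i f \<notin> W}"
    proof
      show "{g \<in> proj L ` W. proj L (i g) \<notin> proj L ` W} \<subseteq> proj L ` {f \<in> W. i f \<notin> W}"
        using i(1) by (smt (verit) image_iff mem_Collect_eq subsetI)
      show "proj L ` {f \<in> W. i f \<notin> W} \<subseteq> {g \<in> proj L ` W. proj L (i g) \<notin> proj L ` W}"
      proof
        fix g assume "g \<in> proj L ` {f \<in> W. i f \<notin> W}"
        then obtain k where k: "g = proj L k" "k \<in> W" "i k \<notin> W" by blast
        then have "proj L (i k) \<notin> proj L ` W" using fits_proj_mem[OF f k(2) i(2)] by blast
        then show "g \<in> {g \<in> proj L ` W. proj L (i g) \<notin> proj L ` W}" using k i(1) by simp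
      qed
    qed
    then show ?thesis
      unfolding bdry_def using card_image[OF inj_on_subset[OF inj]] by (metis (no_types, lifting) mem_Collect_eq subsetI)
  qed
  show "perT L (proj L ` W) = per W"
    unfolding perT_def per_def using *[of nx] *[of ny] *[of nz] by (simp add: face_nb_def)
qed

lemma energyT_proj: "fits (L - 1) W \<Longrightarrow> finite W \<Longrightarrow> energyT J h L (proj L ` W) = energy J h W"
  by (simp add: energyT_def energy_def perT_proj)

section \<open>Droplets winding around the torus, and planar lifts of the others\<close>

text \<open>\<open>s\<close> maps the faces whose successor stays in \<open>A\<close> bijectively to
  those whose predecessor does, so equally many successors and predecessors leave
  \<open>A\<close>.\<close>

lemma bdry_inverse:
  assumes fin: "finite A" and inv: "\<And>f. f \<in> A \<Longrightarrow> p (s f) = f" "\<And>f. f \<in> A \<Longrightarrow> s (p f) = f"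
  shows "bdry s A = bdry p A"
proof -
  have split: "card A = card {f \<in> A. i f \<in> A} + bdry i A" for i
  proof -
    have "card ({f \<in> A. i f \<in> A} \<union> {f \<in> A. i f \<notin> A}) = card {f \<in> A. i f \<in> A} + card {f \<in> A. i f \<notin> A}"
      using fin by (intro card_Un_disjoint) auto
    moreover have "{f \<in> A. i f \<in> A} \<union> {f \<in> A. i f \<notin> A} = A" by blast
    ultimately show ?thesis by (simp add: bdry_def)
  qed
  have "bij_betw s {f \<in> A. s f \<in> A} {f \<in> A. p f \<in> A}"
    by (rule bij_betw_byWitness[where f' = p]) (use inv in auto)
  then show ?thesis using split[of s] split[of p] bij_betw_same_card by fastforce
qed

text \<open>On the torus a column is a cycle of \<open>2 L\<close> faces, so only columns that are
  not completely filled have an end.\<close>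

definition colsucc :: "int \<Rightarrow> face \<Rightarrow> face" where
  "colsucc L = alt isup (\<lambda>f. proj L (nz f)) (\<lambda>f. proj L (ny f))"

definition colpred :: "int \<Rightarrow> face \<Rightarrow> face" where
  "colpred L = alt isup (\<lambda>f. proj L (ny f)) (\<lambda>f. proj L (nz f))"

lemma bdry_col:
  assumes "A \<subseteq> Lam L"
  shows "2 * bdry (colsucc L) A \<le> perT L A"
proof -
  have fin: "finite A" using assms finite_Lam finite_subset by blast
  have "bdry (colsucc L) A = bdry (colpred L) A"
  proof (rule bdry_inverse[OF fin])
    fix f assume "f \<in> A"
    then have f: "proj L f = f" using assms by auto
    show "colpred L (colsucc L f) = f" "colsucc L (colpred L f) = f"
      using f by (simp_all add: colsucc_def colpred_def alt_def)
  qed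
  moreover have "bdry (colsucc L) A + bdry (colpred L) A = bdry (\<lambda>f. proj L (nz f)) A + bdry (\<lambda>f. proj L (ny f)) A"
    unfolding colsucc_def colpred_def using bdry_alt[OF fin] .
  ultimately show ?thesis by (simp add: perT_def)
qed

lemma column_full:
  assumes A: "A \<subseteq> Lam L" and L: "0 < L" and f0: "f0 \<in> A"
    and cl: "\<And>f. f \<in> A \<Longrightarrow> xc f = xc f0 \<Longrightarrow> colsucc L f \<in> A"
    and g: "g \<in> Lam L" "xc g = xc f0"
  shows "g \<in> A"
proof -
  obtain a b u where f: "f0 = (a, b, u)" by (cases f0)
  have fL: "0 \<le> a" "a < L" "0 \<le> b" "b < L" using f0 A unfolding f by (auto simp: Lam_def)
  have dn: "(a, c, False) \<in> A" if "(a, c, True) \<in> A" for c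
  proof -
    have "0 \<le> c" "c < L" using that A by (auto simp: Lam_def)
    then show ?thesis using cl[OF that] fL by (simp add: f colsucc_def alt_def)
  qed
  have up: "(a, (c + 1) mod L, True) \<in> A" if "(a, c, False) \<in> A" for c
    using cl[OF that] fL by (simp add: f colsucc_def alt_def)
  have "(a, b, False) \<in> A" using f0 dn unfolding f by (cases u) auto
  have all: "(a, (b + int m) mod L, False) \<in> A" for m
  proof (induction m)
    case 0
    then show ?case using \<open>(a, b, False) \<in> A\<close> fL by simp
  next
    case (Suc m)
    have "((b + int m) mod L + 1) mod L = (b + int (Suc m)) mod L" by (simp add: mod_simps algebra_simps)
    then show ?case using dn[OF up[OF Suc]] by simp
  qed
  have all': "(a, c mod L, False) \<in> A" for c
  proof -
    have "(b + int (nat ((c - b) mod L))) mod L = c mod L" using L by (simp add: mod_simps)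
    then show ?thesis using all by metis
  qed
  obtain c w where g': "g = (a, c, w)" using g(2) unfolding f by (cases g) auto
  have c: "c mod L = c" using g(1) unfolding g' by (auto simp: Lam_def)
  show ?thesis
  proof (cases w)
    case True
    have "((c - 1) mod L + 1) mod L = c" using c by (simp add: mod_simps)
    then show ?thesis using up[OF all'[of "c - 1"]] True g' by simp
  next
    case False
    then show ?thesis using all'[of c] c g' by simp
  qed
qed

text \<open>A column met by \<open>A\<close> is either full, with area \<open>2 L\<close>, or has
  two ends, each of them an edge. With edges weighted by \<open>L\<close>, every one of the
  \<open>L\<close> columns contributes at least \<open>2 L\<close>.\<close>

lemma perT_all_columns:
  assumes A: "A \<subseteq> Lam L" and L: "0 < L" and hit: "\<And>a. 0 \<le> a \<Longrightarrow> a < L \<Longrightarrow> \<exists>f\<in>A. xc f = a"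
  shows "2 * L * L \<le> L * int (perT L A) + int (card A)"
proof -
  have fin: "finite A" using A finite_Lam finite_subset by blast
  define F where "F = {a \<in> {0..<L}. \<forall>g\<in>Lam L. xc g = a \<longrightarrow> g \<in> A}"
  have finF: "finite F" by (rule finite_subset[of _ "{0..<L}"]) (auto simp: F_def)
  have "{0..<L} - F \<subseteq> xc ` {f \<in> A. colsucc L f \<notin> A}"
  proof
    fix a assume a: "a \<in> {0..<L} - F"
    then obtain f0 where f0: "f0 \<in> A" "xc f0 = a" using hit[of a] by auto
    obtain g where g: "g \<in> Lam L" "xc g = a" "g \<notin> A" using a unfolding F_def by blast
    have "\<exists>f\<in>A. xc f = xc f0 \<and> colsucc L f \<notin> A"
    proof (rule ccontr)
      assume "\<not> (\<exists>f\<in>A. xc f = xc f0 \<and> colsucc L f \<notin> A)"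
      then have cl: "colsucc L f \<in> A" if "f \<in> A" "xc f = xc f0" for f using that by blast
      have "xc g = xc f0" using g(2) f0(2) by simp
      from column_full[OF A L f0(1) cl g(1) this] show False using g(3) by contradiction
    qed
    then obtain f where "f \<in> A" "xc f = xc f0" "colsucc L f \<notin> A" by blast
    then show "a \<in> xc ` {f \<in> A. colsucc L f \<notin> A}" using f0(2) by (intro image_eqI[of _ _ f]) simp_all
  qed
  then have "card ({0..<L} - F) \<le> card (xc ` {f \<in> A. colsucc L f \<notin> A})"
    using fin by (intro card_mono) auto
  also have "\<dots> \<le> bdry (colsucc L) A" unfolding bdry_def using fin by (intro card_image_le) auto
  finally have 1: "card ({0..<L} - F) \<le> bdry (colsucc L) A" .
  have "card ({0..<L} - F) = card {0..<L} - card F" using finF by (intro card_Diff_subset) (auto simp: F_def)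
  then have 2: "L - int (card F) \<le> int (bdry (colsucc L) A)" using 1 L by simp
  have "F \<times> {0..<L} \<times> UNIV \<subseteq> A"
  proof
    fix q assume q: "q \<in> F \<times> {0..<L} \<times> (UNIV :: bool set)"
    obtain a b u where "q = (a, b, u)" by (cases q)
    then show "q \<in> A" using q by (auto simp: F_def Lam_def)
  qed
  then have "card (F \<times> {0..<L} \<times> (UNIV :: bool set)) \<le> card A" using fin by (intro card_mono)
  then have "card F * (nat L * 2) \<le> card A" by (simp add: card_cartesian_product)
  then have "int (card F * (nat L * 2)) \<le> int (card A)" by (simp only: of_nat_le_iff)
  then have 3: "int (card F) * (L * 2) \<le> int (card A)" using L by simp
  have "2 * (L - int (card F)) \<le> int (perT L A)" using 2 bdry_col[OF A] unfolding right_diff_distrib by linarith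
  then have "L * (2 * (L - int (card F))) \<le> L * int (perT L A)" using L by simp
  then show ?thesis using 3 by (simp add: algebra_simps)
qed

fun swapf :: "face \<Rightarrow> face" where "swapf (a, b, u) = (b, a, u)"

lemma swapf_simps [simp]: "xc (swapf f) = yc f" "yc (swapf f) = xc f" "isup (swapf f) = isup f"
  "swapf (swapf f) = f" "swapf (proj L f) = proj L (swapf f)"
  "nx (swapf f) = swapf (ny f)" "ny (swapf f) = swapf (nx f)" "nz (swapf f) = swapf (nz f)"
  by (cases f; simp)+

lemma perT_swapf: "finite A \<Longrightarrow> perT L (swapf ` A) = perT L A"
proof -
  assume fin: "finite A"
  have inj: "inj swapf" by (rule injI) (metis swapf_simps(4))
  have *: "bdry i (swapf ` A) = bdry j A" if "\<And>f. i (swapf f) = swapf (j f)" for i j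
  proof -
    have "{g \<in> swapf ` A. i g \<notin> swapf ` A} = swapf ` {f \<in> A. j f \<notin> A}"
    proof (rule set_eqI)
      fix g
      obtain f where "g = swapf f" by (metis swapf_simps(4))
      then show "g \<in> {g \<in> swapf ` A. i g \<notin> swapf ` A} \<longleftrightarrow> g \<in> swapf ` {f \<in> A. j f \<notin> A}"
        by (simp add: that inj_image_mem_iff[OF inj])
    qed
    then show ?thesis unfolding bdry_def by (simp add: card_image inj_on_subset[OF inj])
  qed
  show ?thesis
    unfolding perT_def
    using *[of "\<lambda>f. proj L (nx f)" "\<lambda>f. proj L (ny f)"] *[of "\<lambda>f. proj L (ny f)" "\<lambda>f. proj L (nx f)"]
      *[of "\<lambda>f. proj L (nz f)" "\<lambda>f. proj L (nz f)"] by simp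
qed

lemma perT_all_rows:
  assumes A: "A \<subseteq> Lam L" and L: "0 < L" and hit: "\<And>b. 0 \<le> b \<Longrightarrow> b < L \<Longrightarrow> \<exists>f\<in>A. yc f = b"
  shows "2 * L * L \<le> L * int (perT L A) + int (card A)"
proof -
  have fin: "finite A" using A finite_Lam finite_subset by blast
  have inj: "inj swapf" by (rule injI) (metis swapf_simps(4))
  have "swapf ` A \<subseteq> Lam L" using A by (auto simp: in_Lam)
  moreover have "\<exists>f\<in>swapf ` A. xc f = a" if "0 \<le> a" "a < L" for a using hit[OF that] by auto
  ultimately have "2 * L * L \<le> L * int (perT L (swapf ` A)) + int (card (swapf ` A))"
    using perT_all_columns L by blast
  then show ?thesis using perT_swapf[OF fin] by (simp add: card_image inj_on_subset[OF inj])
qed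

text \<open>A small droplet misses a column and a row; cutting the torus open there gives a planar
  copy with one strip of room to spare.\<close>

lemma lift_exists:
  assumes A: "A \<subseteq> Lam L" and L: "0 < L" and small: "L * int (perT L A) + int (card A) < 2 * L * L"
  obtains W where "finite W" "fits (L - 1) W" "proj L ` W = A"
proof -
  obtain a where a: "0 \<le> a" "a < L" "\<And>f. f \<in> A \<Longrightarrow> xc f \<noteq> a"
    using perT_all_columns[OF A L] small by (meson not_less)
  obtain b where b: "0 \<le> b" "b < L" "\<And>f. f \<in> A \<Longrightarrow> yc f \<noteq> b"
    using perT_all_rows[OF A L] small by (meson not_less)
  define W where "W = {f. a < xc f \<and> xc f < a + L \<and> b < yc f \<and> yc f < b + L \<and> proj L f \<in> A}"
  have fits: "fits (L - 1) W"
    unfolding fits_def by (rule exI[of _ "a + 1"], rule exI[of _ "b + 1"]) (auto simp: W_def)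
  have im: "proj L ` W = A"
  proof
    show "proj L ` W \<subseteq> A" by (auto simp: W_def)
    show "A \<subseteq> proj L ` W"
    proof
      fix f assume f: "f \<in> A"
      then have fL: "0 \<le> xc f" "xc f < L" "0 \<le> yc f" "yc f < L" using A by (auto simp: in_Lam)
      define g where "g = (if a < xc f then xc f else xc f + L, if b < yc f then yc f else yc f + L, isup f)"
      have "proj L g = f" unfolding g_def using fL by (intro face_eqI3) auto
      moreover from this have "g \<in> W" using f fL a(1,2) b(1,2) a(3)[OF f] b(3)[OF f] by (auto simp: W_def g_def)
      ultimately show "f \<in> proj L ` W" by blast
    qed
  qed
  have "finite (proj L ` W)" unfolding im using A finite_Lam finite_subset by blast
  then have "finite W" using finite_imageD fits_inj[OF fits_weaken[OF fits, of L]] by simp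
  then show thesis using that fits im by blast
qed

text \<open>Every face has a representative in the window of \<open>W\<close> or one step beyond it,
  on the left or on the right; so one of the two free strips is used up in each coordinate.\<close>

lemma lift_insert:
  assumes W: "fits (L - 2) W" "W \<noteq> {}" and L: "2 < L" and x: "x \<in> Lam L" "x \<notin> proj L ` W"
  obtains f where "proj L f = x" "f \<notin> W" "fits (L - 1) (insert f W)"
proof -
  obtain a b where ab: "\<And>f. f \<in> W \<Longrightarrow> a \<le> xc f \<and> xc f < a + (L - 2) \<and> b \<le> yc f \<and> yc f < b + (L - 2)"
    using W fits_def by metis
  have ex: "\<exists>v d. v mod L = u mod L \<and> d \<le> v \<and> v < d + (L - 1) \<and> (d = c \<or> d = c - 1)" for u c :: int
  proof -
    define v where "v = c - 1 + (u - (c - 1)) mod L"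
    have "v mod L = u mod L" by (simp add: v_def mod_simps)
    moreover have "c - 1 \<le> v" "v < c - 1 + L" using L by (simp_all add: v_def)
    ultimately show ?thesis using L
      by (intro exI[of _ v] exI[of _ "if v = c - 1 then c - 1 else c"]) auto
  qed
  obtain v d where v: "v mod L = xc x mod L" "d \<le> v" "v < d + (L - 1)" "d = a \<or> d = a - 1" using ex by blast
  obtain w e where w: "w mod L = yc x mod L" "e \<le> w" "w < e + (L - 1)" "e = b \<or> e = b - 1" using ex by blast
  have "proj L (v, w, isup x) = x"
    using v(1) w(1) x(1) by (intro face_eqI3) (auto simp: in_Lam)
  moreover have "fits (L - 1) (insert (v, w, isup x) W)"
    unfolding fits_def
  proof (rule exI[of _ d], rule exI[of _ e], intro ballI)
    fix f assume "f \<in> insert (v, w, isup x) W"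
    then show "d \<le> xc f \<and> xc f < d + (L - 1) \<and> e \<le> yc f \<and> yc f < e + (L - 1)"
      using v(2-4) w(2-4) ab[of f] by auto
  qed
  moreover from calculation(1) have "(v, w, isup x) \<notin> W" using x(2) by (metis imageI)
  ultimately show thesis by (intro that)
qed

section \<open>Submodularity and moves on the torus\<close>

text \<open>A boundary face of the union or of the intersection is one of \<open>A\<close> or of
  \<open>B\<close>, and a boundary face of both is one of \<open>A\<close> and of \<open>B\<close>;
  inclusion-exclusion on both sides does the rest.\<close>

lemma bdry_submodular:
  assumes "finite A" "finite B"
  shows "bdry i (A \<union> B) + bdry i (A \<inter> B) \<le> bdry i A + bdry i B"
proof -
  let ?X = "\<lambda>S. {f \<in> S. i f \<notin> S}"
  have fin: "finite (?X A)" "finite (?X B)" "finite (?X (A \<union> B))" "finite (?X (A \<inter> B))" using assms by auto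
  have "card (?X (A \<union> B)) + card (?X (A \<inter> B)) = card (?X (A \<union> B) \<union> ?X (A \<inter> B)) + card (?X (A \<union> B) \<inter> ?X (A \<inter> B))"
    using fin by (intro card_Un_Int)
  also have "\<dots> \<le> card (?X A \<union> ?X B) + card (?X A \<inter> ?X B)"
    using fin by (intro add_mono card_mono) auto
  also have "\<dots> = card (?X A) + card (?X B)" using fin by (intro card_Un_Int[symmetric])
  finally show ?thesis by (simp add: bdry_def)
qed

lemma energyT_submodular:
  assumes "finite A" "finite B" "0 < J"
  shows "energyT J h L (A \<union> B) + energyT J h L (A \<inter> B) \<le> energyT J h L A + energyT J h L B"
proof -
  have "perT L (A \<union> B) + perT L (A \<inter> B) \<le> perT L A + perT L B"
    unfolding perT_def using bdry_submodular[OF assms(1,2), of "\<lambda>f. proj L (nx f)"]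
      bdry_submodular[OF assms(1,2), of "\<lambda>f. proj L (ny f)"] bdry_submodular[OF assms(1,2), of "\<lambda>f. proj L (nz f)"]
    by linarith
  then have "real (perT L (A \<union> B)) + real (perT L (A \<inter> B)) \<le> real (perT L A) + real (perT L B)" by linarith
  then have "J * (real (perT L (A \<union> B)) + real (perT L (A \<inter> B))) \<le> J * (real (perT L A) + real (perT L B))"
    using assms(3) by simp
  moreover have "real (card (A \<union> B)) + real (card (A \<inter> B)) = real (card A) + real (card B)"
    using card_Un_Int[OF assms(1,2)] by simp
  then have "h * (real (card (A \<union> B)) + real (card (A \<inter> B))) = h * (real (card A) + real (card B))" by simp
  ultimately show ?thesis by (simp add: energyT_def algebra_simps)
qed

definition reachT :: "real \<Rightarrow> real \<Rightarrow> int \<Rightarrow> real \<Rightarrow> (face set \<times> face set) set" where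
  "reachT J h L C = {(A, B). A \<subseteq> Lam L \<and> B \<subseteq> Lam L \<and> energyT J h L A < C \<and> energyT J h L B < C \<and>
     (\<exists>f. f \<notin> A \<and> B = insert f A \<or> f \<notin> B \<and> A = insert f B)}"

lemma reachT_I:
  assumes "A \<subseteq> Lam L" "B \<subseteq> Lam L" "energyT J h L A < C" "energyT J h L B < C"
    "f \<notin> A \<and> B = insert f A \<or> f \<notin> B \<and> A = insert f B"
  shows "(A, B) \<in> reachT J h L C"
  unfolding reachT_def mem_Collect_eq prod.case using assms by blast

lemma reach_rel_I:
  assumes "A \<subseteq> V" "V \<subseteq> U" "A \<subseteq> W" "W \<subseteq> U" "energy J h V < C" "energy J h W < C"
    "f \<notin> V \<and> W = insert f V \<or> f \<notin> W \<and> V = insert f W"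
  shows "(V, W) \<in> reach_rel J h C A U"
  unfolding reach_rel_def mem_Collect_eq prod.case using assms by blast

lemma reach_rel_iso:
  assumes \<phi>: "face_iso \<phi>" and fin: "finite U" and r: "(V, W) \<in> (reach_rel J h C A U)\<^sup>*"
  shows "(\<phi> ` V, \<phi> ` W) \<in> (reach_rel J h C (\<phi> ` A) (\<phi> ` U))\<^sup>*"
  using r
proof (induction rule: rtrancl_induct)
  case base
  then show ?case by simp
next
  case (step W X)
  have inj: "inj \<phi>" using face_iso_inj[OF \<phi>] .
  have WX: "A \<subseteq> W" "W \<subseteq> U" "A \<subseteq> X" "X \<subseteq> U" "energy J h W < C" "energy J h X < C"
    "\<exists>f. f \<notin> W \<and> X = insert f W \<or> f \<notin> X \<and> W = insert f X"
    using step(2) unfolding reach_rel_def by blast+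
  have e: "energy J h (\<phi> ` S) = energy J h S" if "S \<subseteq> U" for S
    unfolding energy_def using face_iso_per[OF \<phi> finite_subset[OF that fin]] face_iso_card[OF \<phi>] by simp
  obtain f where "f \<notin> W \<and> X = insert f W \<or> f \<notin> X \<and> W = insert f X" using WX(7) by blast
  then have "\<phi> f \<notin> \<phi> ` W \<and> \<phi> ` X = insert (\<phi> f) (\<phi> ` W) \<or> \<phi> f \<notin> \<phi> ` X \<and> \<phi> ` W = insert (\<phi> f) (\<phi> ` X)"
    using inj by (auto simp: inj_image_mem_iff)
  then have "(\<phi> ` W, \<phi> ` X) \<in> reach_rel J h C (\<phi> ` A) (\<phi> ` U)"
    using WX(1-6) by (intro reach_rel_I) (simp_all only: e image_mono)
  then show ?case using step(3) by (rule rtrancl_into_rtrancl[rotated])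
qed

lemma reach_to_torus:
  assumes f: "fits (L - 1) U" and fin: "finite U" and L: "0 < L" and r: "(V, W) \<in> (reach_rel J h C A U)\<^sup>*"
  shows "(proj L ` V, proj L ` W) \<in> (reachT J h L C)\<^sup>*"
  using r
proof (induction rule: rtrancl_induct)
  case base
  then show ?case by simp
next
  case (step W X)
  have inj: "inj_on (proj L) U" using fits_inj[OF fits_weaken[OF f, of L]] by simp
  have WX: "W \<subseteq> U" "X \<subseteq> U" "energy J h W < C" "energy J h X < C"
    "\<exists>f. f \<notin> W \<and> X = insert f W \<or> f \<notin> X \<and> W = insert f X"
    using step(2) unfolding reach_rel_def by blast+
  have e: "energyT J h L (proj L ` S) = energy J h S" if "S \<subseteq> U" for S
    using energyT_proj[OF fits_mono[OF f that] finite_subset[OF that fin]] .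
  obtain f where f: "f \<notin> W \<and> X = insert f W \<or> f \<notin> X \<and> W = insert f X" using WX(5) by blast
  then have fU: "f \<in> U" using WX by blast
  have "proj L f \<in> proj L ` S \<longleftrightarrow> f \<in> S" if "S \<subseteq> U" for S
    using inj_on_image_mem_iff[OF inj fU that] .
  then have "proj L f \<notin> proj L ` W \<and> proj L ` X = insert (proj L f) (proj L ` W) \<or>
    proj L f \<notin> proj L ` X \<and> proj L ` W = insert (proj L f) (proj L ` X)"
    using f WX(1,2) by (metis image_insert)
  moreover have "proj L ` S \<subseteq> Lam L" for S using proj_in_Lam[OF L] by blast
  ultimately have "(proj L ` W, proj L ` X) \<in> reachT J h L C"
    using WX(1-4) by (intro reachT_I) (simp_all only: e)
  then show ?case using step(3) by (rule rtrancl_into_rtrancl[rotated])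
qed

section \<open>Spin configurations as droplets\<close>

definition conf :: "int \<Rightarrow> face set \<Rightarrow> face \<Rightarrow> int" where
  "conf L A = (\<lambda>x. if x \<in> Lam L then (if x \<in> A then 1 else -1) else 0)"

lemma conf_Conf: "conf L A \<in> Conf L"
  by (simp add: conf_def Conf_def del: split_paired_All)

lemma plus_set_conf: "A \<subseteq> Lam L \<Longrightarrow> plus_set L (conf L A) = A"
  by (auto simp: plus_set_def conf_def)

lemma conf_plus_set: "\<sigma> \<in> Conf L \<Longrightarrow> conf L (plus_set L \<sigma>) = \<sigma>"
  unfolding conf_def plus_set_def Conf_def by (rule ext) fastforce

lemma conf_insert:
  assumes "f \<in> Lam L" "f \<notin> A"
  shows "conf L (insert f A) = flip (conf L A) f" "conf L A = flip (conf L (insert f A)) f"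
  using assms by (auto simp: conf_def flip_def fun_eq_iff)

lemma plus_set_flip:
  assumes "\<sigma> \<in> Conf L" "x \<in> Lam L"
  shows "plus_set L (flip \<sigma> x) = (if x \<in> plus_set L \<sigma> then plus_set L \<sigma> - {x} else insert x (plus_set L \<sigma>))"
proof -
  have "\<sigma> x = 1 \<or> \<sigma> x = -1" using assms unfolding Conf_def by blast
  then show ?thesis using assms(2) by (auto simp: plus_set_def flip_def)
qed

lemma is_path_successively:
  "is_path L \<omega> \<longleftrightarrow> \<omega> \<noteq> [] \<and> set \<omega> \<subseteq> Conf L \<and> successively (\<lambda>\<sigma> \<tau>. \<exists>x\<in>Lam L. \<tau> = flip \<sigma> x) \<omega>"
  by (auto simp: is_path_def successively_conv_nth)

lemma reachT_flip:
  assumes "(A, B) \<in> reachT J h L C"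
  shows "\<exists>x\<in>Lam L. conf L B = flip (conf L A) x"
proof -
  obtain f where f: "f \<notin> A \<and> B = insert f A \<or> f \<notin> B \<and> A = insert f B" and s: "A \<subseteq> Lam L" "B \<subseteq> Lam L"
    using assms unfolding reachT_def by blast
  then show ?thesis using conf_insert[of f L A] conf_insert[of f L B] by blast
qed

lemma reachT_path:
  assumes "(A, B) \<in> (reachT J h L C)\<^sup>*" "A \<subseteq> Lam L" "energyT J h L A < C"
  shows "\<exists>\<omega>. is_path L \<omega> \<and> hd \<omega> = conf L A \<and> last \<omega> = conf L B \<and> (\<forall>\<sigma>\<in>set \<omega>. energyT J h L (plus_set L \<sigma>) < C)"
  using assms(1)
proof (induction rule: rtrancl_induct)
  case base
  have "is_path L [conf L A]" using conf_Conf by (simp add: is_path_def)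
  then show ?case using assms(2,3) plus_set_conf by (intro exI[of _ "[conf L A]"]) simp
next
  case (step B D)
  then obtain \<omega> where \<omega>: "is_path L \<omega>" "hd \<omega> = conf L A" "last \<omega> = conf L B"
    "\<forall>\<sigma>\<in>set \<omega>. energyT J h L (plus_set L \<sigma>) < C" by blast
  have "\<exists>x\<in>Lam L. conf L D = flip (conf L B) x" using reachT_flip[OF step(2)] .
  then have "is_path L (\<omega> @ [conf L D])"
    using \<omega>(1,3) conf_Conf by (auto simp: is_path_successively successively_append_iff)
  moreover have "energyT J h L (plus_set L (conf L D)) < C"
    using step(2) plus_set_conf unfolding reachT_def by auto
  ultimately show ?case
    using \<omega> by (intro exI[of _ "\<omega> @ [conf L D]"]) (auto simp: is_path_def)
qed

text \<open>Balanced widths with sum at most \<open>3 M\<close> are all at most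
  \<open>M\<close>.\<close>

lemma opt_hex_fits:
  assumes "opt_hex n W" "int n \<le> 3 * M"
  shows "fits M W"
proof -
  from assms(1) obtain x0 x1 y0 y1 z0 z1 where W: "opt_params n x0 x1 y0 y1 z0 z1" "W = hexa x0 x1 y0 y1 z0 z1"
    by (rule opt_hexE)
  have "x1 < x0 + M" "y1 < y0 + M" using W(1) assms(2) unfolding opt_params_def by (smt (verit))+
  then show ?thesis unfolding fits_def W(2) by (intro exI[of _ x0] exI[of _ y0]) auto
qed

text \<open>A width above \<open>M\<close> would leave at most \<open>per W - (M + 1)\<close> for
  the other two, and the area is at most twice their product, hence at most half the square of their
  sum.\<close>

lemma tight_fits:
  assumes t: "tight W" and ne: "W \<noteq> {}" and M: "(per W - (M + 1)) * (per W - (M + 1)) < 2 * card W"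
  shows "fits (int M) W"
proof -
  obtain x0 x1 y0 y1 z0 z1 where le: "x0 \<le> x1" "y0 \<le> y1" "z0 \<le> z1"
    and im: "xc ` W = {x0..x1}" "yc ` W = {y0..y1}" "zc ` W = {z0..z1}"
    using tight_hexa[OF t ne] by metis
  have fin: "finite W" using t by (simp add: tight_def)
  let ?X = "xc ` W" and ?Y = "yc ` W" and ?Z = "zc ` W"
  have tot: "card ?X + card ?Y + card ?Z \<le> per W" using strips_le_per[OF fin] by (simp add: strips_def)
  have c: "card W \<le> card (thull ?X ?Y ?Z)" using card_le_strips(2)[OF fin] by (simp add: face_hull_def)
  have 1: "card W \<le> 2 * card ?Y * card ?Z" "card W \<le> 2 * card ?Z * card ?X"
    using c finite_hull(2)[of ?Y ?Z ?X] finite_hull(2)[of ?Z ?X ?Y] card_hull_rot[of ?Y ?Z ?X] fin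
    by (auto intro: order_trans)
  have aux: "card W \<le> 2 * b * c \<Longrightarrow> a + b + c \<le> per W \<Longrightarrow> a \<le> M" for a b c
  proof (rule ccontr)
    assume *: "card W \<le> 2 * b * c" "a + b + c \<le> per W" "\<not> a \<le> M"
    then have "b + c \<le> per W - (M + 1)" by simp
    then have "(b + c) * (b + c) \<le> (per W - (M + 1)) * (per W - (M + 1))" by (rule mult_le_mono[OF _]) (use * in simp)
    moreover have "4 * (b * c) \<le> (b + c) * (b + c)"
    proof -
      have "0 \<le> (int b - int c)\<^sup>2" by simp
      then have "4 * (int b * int c) \<le> (int b + int c) * (int b + int c)" by (simp add: power2_eq_square algebra_simps)
      then have "int (4 * (b * c)) \<le> int ((b + c) * (b + c))" by simp
      then show ?thesis by (simp only: of_nat_le_iff)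
    qed
    ultimately show False using *(1) M by linarith
  qed
  have "card ?X \<le> M" using aux[OF 1(1), of "card ?X"] tot by linarith
  moreover have "card ?Y \<le> M" using aux[OF 1(2), of "card ?Y"] tot by linarith
  ultimately have "x1 < x0 + int M" "y1 < y0 + int M" using le unfolding im by auto
  moreover have "xc f \<in> {x0..x1}" "yc f \<in> {y0..y1}" if "f \<in> W" for f using that im by blast+
  ultimately have "x0 \<le> xc f \<and> xc f < x0 + int M \<and> y0 \<le> yc f \<and> yc f < y0 + int M" if "f \<in> W" for f
    using that by fastforce
  then show ?thesis unfolding fits_def by blast
qed

section \<open>Supercritical droplets\<close>

definition adj1 :: "'a set \<Rightarrow> 'a set \<Rightarrow> bool" where
  "adj1 V W \<longleftrightarrow> (\<exists>f. f \<notin> V \<and> W = insert f V \<or> f \<notin> W \<and> V = insert f W)"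

lemma insert_exchange:
  assumes "insert f A = insert g B" "f \<notin> A" "g \<notin> B"
  shows "f = g \<Longrightarrow> A = B" "f \<noteq> g \<Longrightarrow> g \<in> A" "f \<noteq> g \<Longrightarrow> B = insert f (A - {g})"
proof -
  show "A = B" if "f = g" using assms that by (metis insert_ident)
  show "g \<in> A" if "f \<noteq> g" using assms(1) that by (metis insertE insertI1)
  have "B = insert g B - {g}" using assms(3) by simp
  then show "B = insert f (A - {g})" if "f \<noteq> g" using assms(1) that by (metis insert_Diff_if singletonD)
qed

lemma strips_mono:
  assumes "finite W" "V \<subseteq> W"
  shows "strips V \<le> strips W" "strips V = strips W \<Longrightarrow> face_hull V = face_hull W"
proof -
  have c: "c ` V \<subseteq> c ` W" "card (c ` V) \<le> card (c ` W)" for c :: "face \<Rightarrow> int"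
    using assms by (auto intro: card_mono)
  show "strips V \<le> strips W" unfolding strips_def using c(2)[of xc] c(2)[of yc] c(2)[of zc] by linarith
  assume "strips V = strips W"
  then have "card (xc ` V) = card (xc ` W)" "card (yc ` V) = card (yc ` W)" "card (zc ` V) = card (zc ` W)"
    unfolding strips_def using c(2)[of xc] c(2)[of yc] c(2)[of zc] by linarith+
  then have "xc ` V = xc ` W" "yc ` V = yc ` W" "zc ` V = zc ` W"
    using c(1) assms(1) by (meson card_subset_eq finite_imageI)+
  then show "face_hull V = face_hull W" by (simp add: face_hull_def)
qed

lemma face_hull_opt_hex:
  assumes "opt_hex n M" "W \<subseteq> M"
  shows "face_hull W \<subseteq> M"
proof -
  from assms(1) obtain x0 x1 y0 y1 z0 z1 where M: "M = hexa x0 x1 y0 y1 z0 z1" by (rule opt_hexE)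
  have "xc ` W \<subseteq> {x0..x1}" "yc ` W \<subseteq> {y0..y1}" "zc ` W \<subseteq> {z0..z1}" using assms(2) unfolding M by auto
  then show ?thesis unfolding M face_hull_def hexa_def thull_def by blast
qed

text \<open>If \<open>g\<close> is alone in one of its three strips, only the neighbour in that direction remains.\<close>

lemma deg_alone:
  assumes "finite V" "strips V < strips (insert g V)"
  shows "deg V g \<le> 1"
proof -
  have "xc g \<notin> xc ` V \<or> yc g \<notin> yc ` V \<or> zc g \<notin> zc ` V"
  proof (rule ccontr)
    assume "\<not> ?thesis"
    then have "xc ` insert g V = xc ` V" "yc ` insert g V = yc ` V" "zc ` insert g V = zc ` V" by auto
    then show False using assms(2) by (simp add: strips_def)
  qed
  then have "(ny g \<notin> V \<and> nz g \<notin> V) \<or> (nx g \<notin> V \<and> nz g \<notin> V) \<or> (nx g \<notin> V \<and> ny g \<notin> V)"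
    by (metis image_eqI nb_coords)
  then show ?thesis by (auto simp: deg_def)
qed

lemma strips_extremal:
  assumes "finite W" "3 \<le> n" "per W = n" "card W = max_area n"
  shows "strips W = n"
proof (rule ccontr)
  assume "strips W \<noteq> n"
  then have "strips W < n" using strips_le_per[OF assms(1)] assms(3) by linarith
  then have "max_area (strips W) < max_area n" using max_area_strict assms(2) by simp
  then show False using card_le_strips[OF assms(1)] assms(4) by linarith
qed

text \<open>The nominal widths add up to \<open>n\<close>, and an extremal set occupies exactly
  \<open>n\<close> strips, so no nominal strip is empty. Inclusions of hexagons can then be read off
  the bounds.\<close>

lemma opt_params_images:
  assumes "3 \<le> n" "opt_params n x0 x1 y0 y1 z0 z1"
  shows "xc ` hexa x0 x1 y0 y1 z0 z1 = {x0..x1}" "yc ` hexa x0 x1 y0 y1 z0 z1 = {y0..y1}"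
    "zc ` hexa x0 x1 y0 y1 z0 z1 = {z0..z1}"
proof -
  let ?W = "hexa x0 x1 y0 y1 z0 z1"
  have "opt_hex n ?W" using assms(2) unfolding opt_hex_def by blast
  then have "strips ?W = n" using strips_extremal opt_hex_size assms(1) opt_hex_finite by metis
  moreover have s: "xc ` ?W \<subseteq> {x0..x1}" "yc ` ?W \<subseteq> {y0..y1}" "zc ` ?W \<subseteq> {z0..z1}" by auto
  moreover have "card {x0..x1} + card {y0..y1} + card {z0..z1} = n"
  proof -
    have "int (card {x0..x1} + card {y0..y1} + card {z0..z1}) = int n"
      using assms(2) unfolding opt_params_def by simp
    then show ?thesis by (simp only: of_nat_eq_iff)
  qed
  moreover have "card (xc ` ?W) \<le> card {x0..x1}" "card (yc ` ?W) \<le> card {y0..y1}" "card (zc ` ?W) \<le> card {z0..z1}"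
    using s by (simp_all only: card_mono finite_atLeastAtMost_int)
  ultimately have "card (xc ` ?W) = card {x0..x1}" "card (yc ` ?W) = card {y0..y1}" "card (zc ` ?W) = card {z0..z1}"
    unfolding strips_def by linarith+
  then show "xc ` ?W = {x0..x1}" "yc ` ?W = {y0..y1}" "zc ` ?W = {z0..z1}"
    using s by (meson card_subset_eq finite_atLeastAtMost_int)+
qed

lemma opt_hex_sub:
  assumes "3 \<le> n" "opt_hex n K" "opt_hex (Suc n) M" "K \<subseteq> M"
  obtains \<phi> a0 a1 b0 b1 c0 c1 where "lat_face \<phi>" "hex_bar n a0 a1 b0 b1 c0 c1"
    "\<phi> ` K = hex_bar.P a0 a1 b0 b1 c0 c1" "\<phi> ` M = hex_bar.H a0 a1 b0 b1 c0 c1"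
proof -
  from assms(2) obtain k0 k1 l0 l1 m0 m1 where K: "opt_params n k0 k1 l0 l1 m0 m1" "K = hexa k0 k1 l0 l1 m0 m1"
    by (rule opt_hexE)
  from assms(3) obtain x0 x1 y0 y1 z0 z1 where M: "opt_params (Suc n) x0 x1 y0 y1 z0 z1" "M = hexa x0 x1 y0 y1 z0 z1"
    by (rule opt_hexE)
  have "{k0..k1} \<subseteq> {x0..x1}" "{l0..l1} \<subseteq> {y0..y1}" "{m0..m1} \<subseteq> {z0..z1}"
    using opt_params_images[OF assms(1) K(1)] opt_params_images[OF _ M(1)] assms(1,4) image_mono[OF assms(4)]
    unfolding K(2) M(2) by (metis le_Suc_eq)+
  moreover have "k0 \<le> k1" "l0 \<le> l1" "m0 \<le> m1" using K(1) by (simp_all add: opt_params_def)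
  ultimately have le: "x0 \<le> k0" "k1 \<le> x1" "y0 \<le> l0" "l1 \<le> y1" "z0 \<le> m0" "m1 \<le> z1" by simp_all
  show thesis by (rule bar_normal[OF K(1) M(1) le]) (use that K(2) M(2) in blast)
qed

text \<open>The three ways to choose two of the consecutive faces \<open>tt x\<close>,
  \<open>uu (x + 1)\<close>, \<open>tt (x + 1)\<close>.\<close>

definition (in hex_bar) gate_sets :: "face set set" where
  "gate_sets = {P \<union> R | R x. lft \<le> x \<and> x < x1 \<and>
     (R = {tt x, uu (x + 1)} \<or> R = {tt (x + 1), uu (x + 1)} \<or> R = {tt x, tt (x + 1)})}"

definition gate_shape :: "nat \<Rightarrow> face set \<Rightarrow> bool" where
  "gate_shape p W \<longleftrightarrow> (\<exists>\<phi> x0 x1 y0 y1 z0 z1 V. lat_face \<phi> \<and> hex_bar p x0 x1 y0 y1 z0 z1 \<and>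
     V \<in> hex_bar.gate_sets x0 x1 y0 y1 z0 z1 \<and> W = \<phi> ` V)"

lemma gate_shapeI:
  "lat_face \<phi> \<Longrightarrow> hex_bar p x0 x1 y0 y1 z0 z1 \<Longrightarrow> V \<in> hex_bar.gate_sets x0 x1 y0 y1 z0 z1 \<Longrightarrow> gate_shape p (\<phi> ` V)"
  unfolding gate_shape_def by blast

text \<open>\<open>r\<close> is \<open>r*\<close> and \<open>p\<close> the perimeter of \<open>Q*\<close>. With \<open>q < J/h\<close> for \<open>q = 2 r + 1\<close> or \<open>2 r + 2\<close>, the bounds on \<open>L\<close> are
  \<open>14 q + 1 \<le> 5 L\<close>, which follows from \<open>2 L^2 \<ge> 16 q^2\<close>.\<close>

locale crit =
  fixes J h :: real and L :: int and r p :: nat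
  assumes h_pos: "0 < h" and L_pos: "0 < L"
    and cases_rp: "(p = 6 * r + 5 \<and> 1 \<le> r \<and> h * (2 * real r + 1) < J \<and> J < h * (2 * real r + 2) \<and> 28 * int r + 15 \<le> 5 * L) \<or>
      (p = 6 * r + 7 \<and> h * (2 * real r + 2) < J \<and> J < h * (2 * real r + 3) \<and> 28 * int r + 29 \<le> 5 * L)"
begin

lemma p_facts: "odd p" "\<not> 3 dvd p" "7 \<le> p" "L \<ge> 6"
proof -
  consider "p = 6 * r + 5" "1 \<le> r" "28 * int r + 15 \<le> 5 * L" | "p = 6 * r + 7" "28 * int r + 29 \<le> 5 * L"
    using cases_rp by blast
  then have "odd p \<and> \<not> 3 dvd p \<and> 7 \<le> p \<and> L \<ge> 6"
  proof cases
    case 1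
    from 1(1) have "\<not> 3 dvd p" by presburger
    then show ?thesis using 1 by simp
  next
    case 2
    from 2(1) have "\<not> 3 dvd p" by presburger
    then show ?thesis using 2 by simp
  qed
  then show "odd p" "\<not> 3 dvd p" "7 \<le> p" "L \<ge> 6" by blast+
qed

text \<open>\<open>p\<close> is congruent to 1 or 5 modulo 6, so the defect is the worst one, 7. The
  other two numbers are the sizes of the bars after and before \<open>Q*\<close>.\<close>

lemma area_p: "6 * max_area p + 7 = p * p" "max_area (Suc p) = max_area p + 2 * r + 3"
  "max_area p = max_area (p - 1) + 2 * r + 1"
proof -
  consider "p = 6 * r + 5" | "p = 6 * r + 7" using cases_rp by blast
  then have "6 * max_area p + 7 = p * p \<and> max_area (Suc p) = max_area p + 2 * r + 3 \<and> max_area p = max_area (p - 1) + 2 * r + 1"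
  proof cases
    case 1
    then have S: "Suc p = 6 * r + 6" "p - 1 = 6 * r + 4" by simp_all
    show ?thesis unfolding S unfolding 1 max_area_mod6 max_area_mod6_pred by (simp add: algebra_simps)
  next
    case 2
    then have S: "Suc p = 6 * r + 8" "p - 1 = 6 * r + 6" by simp_all
    show ?thesis unfolding S unfolding 2 max_area_mod6 max_area_mod6_pred by (simp add: algebra_simps)
  qed
  then show "6 * max_area p + 7 = p * p" "max_area (Suc p) = max_area p + 2 * r + 3"
    "max_area p = max_area (p - 1) + 2 * r + 1" by blast+
qed

lemma J_bounds: "h * (2 * real r + 1) < J" "J < h * (2 * real r + 3)" "h < J" "0 < J"
proof -
  have r: "0 \<le> h * (real r * 2)" using h_pos by simp
  show *: "h * (2 * real r + 1) < J" "J < h * (2 * real r + 3)"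
    using cases_rp h_pos by (auto simp: algebra_simps)
  have "h * (2 * real r + 1) = h * (real r * 2) + h" by (simp add: algebra_simps)
  then show "h < J" "0 < J" using *(1) r h_pos by linarith+
qed

definition crit_energy :: real where
  "crit_energy = J * (real p + 2) - h * (real (max_area p) + 2)"

lemma strips_ge:
  assumes "finite W" "max_area p < card W"
  shows "Suc p \<le> strips W"
proof (rule ccontr)
  assume "\<not> ?thesis"
  then have "max_area (strips W) \<le> max_area p" by (intro max_area_mono) simp
  then show False using card_le_strips[OF assms(1)] assms(2) by linarith
qed

lemma per_ge:
  assumes "finite W" "max_area p \<le> card W"
  shows "p \<le> per W"
proof (rule ccontr)
  assume "\<not> ?thesis"
  then have "max_area (per W) < max_area p" using p_facts by (intro max_area_strict) auto
  then show False using card_le_per[OF assms(1)] assms(2) by linarith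
qed

lemma opt_hex_p: "opt_hex p Q \<Longrightarrow> finite Q \<and> per Q = p \<and> card Q = max_area p"
  using opt_hex_size[of p Q] opt_hex_finite p_facts by simp

lemma extremal_p: "finite W \<Longrightarrow> per W \<le> p \<Longrightarrow> card W = max_area p \<Longrightarrow> opt_hex p W"
  using extremal_structure[of p W] per_ge[of W] p_facts by simp

text \<open>Meant to say that the gate has not been passed. \<open>Q*\<close> with one face on a
  longest side already lies in an extremal hexagon of perimeter \<open>p + 1\<close>, yet it is
  still one face short of the gate; hence the first alternative.\<close>

definition safe :: "face set \<Rightarrow> bool" where
  "safe W \<longleftrightarrow> (\<exists>Q f. opt_hex p Q \<and> f \<notin> Q \<and> W = insert f Q) \<or> \<not> (\<exists>M. opt_hex (Suc p) M \<and> W \<subseteq> M)"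

text \<open>Perimeter at most \<open>p + 1\<close> and area above \<open>max_area p\<close> force
  exactly \<open>p + 1\<close> strips, so if one such set contains another, their hulls agree. Only
  the exchange of a face can change the hull; then the removed face was alone in a strip, and the
  common part is extremal of perimeter \<open>p\<close>.\<close>

lemma same_hull:
  assumes W1: "finite W1" "max_area p < card W1" "per W1 \<le> Suc p"
    and W2: "Suc (max_area p) < card W2"
    and W3: "finite W3" "max_area p < card W3" "per W3 \<le> Suc p"
    and a: "adj1 W1 W2" "adj1 W2 W3"
  shows "face_hull W3 = face_hull W1 \<or> (\<exists>Q f. opt_hex p Q \<and> f \<notin> Q \<and> W3 = insert f Q)"
proof -
  have s1: "strips W1 = Suc p" using strips_ge[OF W1(1,2)] strips_le_per[OF W1(1)] W1(3) by linarith
  have s3: "strips W3 = Suc p" using strips_ge[OF W3(1,2)] strips_le_per[OF W3(1)] W3(3) by linarith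
  have sub: "face_hull V = face_hull W" if "finite W" "V \<subseteq> W" "strips V = Suc p" "strips W = Suc p" for V W
    using strips_mono(2)[OF that(1,2)] that(3,4) by simp
  obtain f where f: "f \<notin> W1 \<and> W2 = insert f W1 \<or> f \<notin> W2 \<and> W1 = insert f W2" using a(1) unfolding adj1_def by blast
  obtain g where g: "g \<notin> W2 \<and> W3 = insert g W2 \<or> g \<notin> W3 \<and> W2 = insert g W3" using a(2) unfolding adj1_def by blast
  have fin2: "finite W2" using f W1(1) by auto
  show ?thesis
  proof (cases "W1 = insert f W2 \<and> f \<notin> W2")
    case True
    have "strips W2 \<le> strips W1" using strips_mono(1)[OF W1(1), of W2] True by blast
    then have s2: "strips W2 = Suc p" using strips_ge[OF fin2] W2 s1 by linarith
    then have "face_hull W2 = face_hull W1" using sub[OF W1(1), of W2] True s1 by blast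
    moreover have "face_hull W3 = face_hull W2"
      using g sub[OF W3(1) _ s2 s3] sub[OF fin2 _ s3 s2] by (metis subset_insertI)
    ultimately show ?thesis by simp
  next
    case False
    then have f: "f \<notin> W1" "W2 = insert f W1" using f by blast+
    show ?thesis
    proof (cases "W3 = insert g W2")
      case True
      then show ?thesis using sub[OF W3(1), of W1] f s1 s3 by blast
    next
      case False
      then have g: "g \<notin> W3" "W2 = insert g W3" using g by blast+
      show ?thesis
      proof (cases "g = f")
        case True
        then have "W3 = W1" using f g insert_ident[of f W3 W1] by simp
        then show ?thesis by simp
      next
        case ne: False
        define V where "V = W1 - {g}"
        have eq: "insert f W1 = insert g W3" using f(2) g(2) by simp
        have gW: "g \<in> W1" using insert_exchange(2)[OF eq f(1) g(1)] ne by simp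
        have W3V: "W3 = insert f V" "f \<notin> V"
          using insert_exchange(3)[OF eq f(1) g(1)] ne f(1) unfolding V_def by simp_all
        have W1V: "W1 = insert g V" "g \<notin> V" using gW unfolding V_def by (simp_all add: insert_absorb)
        have finV: "finite V" using W1(1) V_def by simp
        have cV: "max_area p \<le> card V" using W1(2) W1V finV by simp
        show ?thesis
        proof (cases "strips V = Suc p")
          case True
          then show ?thesis
            using sub[OF W1(1), of V] sub[OF W3(1), of V] s1 s3 W1V W3V by blast
        next
          case False
          then have lt: "strips V < strips W1" using strips_mono(1)[OF W1(1), of V] W1V s1 by fastforce
          then have "card V \<le> max_area p"
            using card_le_strips[OF finV] max_area_mono[of "strips V" p] s1 by linarith
          then have cV': "card V = max_area p" using cV by simp
          have "deg V g \<le> 1" using deg_alone[OF finV] lt W1V by simp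
          then have "per V \<le> p" using per_insert[OF finV W1V(2)] W1(3) W1V(1) by simp
          then have "opt_hex p V" using extremal_p[OF finV _ cV'] by simp
          then show ?thesis using W3V by blast
        qed
      qed
    qed
  qed
qed

text \<open>If \<open>W3\<close> were not safe, the equality of hulls would put \<open>W1\<close>
  into an extremal hexagon, so \<open>W1\<close> is \<open>Q\<close> plus a face and the coordinates
  of the bar apply. Avoiding the gate, the second face lands at least two columns from the first,
  and then no single move restores perimeter \<open>p + 1\<close>.\<close>

lemma two_step:
  assumes W1: "finite W1" "max_area p < card W1" "per W1 \<le> Suc p"
    and W2: "Suc (max_area p) < card W2" "per W2 \<le> p + 2"
    and W3: "finite W3" "max_area p < card W3" "per W3 \<le> Suc p"
    and a: "adj1 W1 W2" "adj1 W2 W3"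
    and safe: "safe W1" and ng: "\<not> gate_shape p W2"
  shows "safe W3"
proof (rule ccontr)
  assume nsafe: "\<not> safe W3"
  then have no: "W3 \<noteq> insert f Q" if "opt_hex p Q" "f \<notin> Q" for f Q using that unfolding safe_def by blast
  obtain M where M: "opt_hex (Suc p) M" "W3 \<subseteq> M" using nsafe unfolding safe_def by blast
  have hull: "face_hull W3 = face_hull W1" using same_hull[OF W1 W2(1) W3 a] no by blast
  then have W1M: "W1 \<subseteq> M" using face_hull_opt_hex[OF M] face_hull_superset[of W1] by blast
  then obtain Q t where Q: "opt_hex p Q" "t \<notin> Q" "W1 = insert t Q" using safe M(1) unfolding safe_def by blast
  have Q': "finite Q" "per Q = p" "card Q = max_area p" using opt_hex_p[OF Q(1)] by blast+
  obtain f where f: "f \<notin> W1 \<and> W2 = insert f W1 \<or> f \<notin> W2 \<and> W1 = insert f W2" using a(1) unfolding adj1_def by blast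
  have c1: "card W1 = Suc (max_area p)" using Q Q' by simp
  have f: "f \<notin> W1" "W2 = insert f W1"
  proof -
    have "\<not> (f \<notin> W2 \<and> W1 = insert f W2)"
    proof
      assume *: "f \<notin> W2 \<and> W1 = insert f W2"
      then have "finite W2" using W1(1) by auto
      then have "card W1 = Suc (card W2)" using * by simp
      then show False using c1 W2(1) by simp
    qed
    then show "f \<notin> W1" "W2 = insert f W1" using f by blast+
  qed
  have fQ: "f \<notin> Q" "f \<noteq> t" using f(1) Q by blast+
  obtain g where g: "g \<notin> W2 \<and> W3 = insert g W2 \<or> g \<notin> W3 \<and> W2 = insert g W3" using a(2) unfolding adj1_def by blast
  \<comment> \<open>Removing \<open>f\<close> returns to \<open>W1\<close> and removing
    \<open>t\<close> leaves \<open>Q\<close> with one face, both safe; so a removed face belongs to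
    \<open>Q\<close>.\<close>
  have g: "g \<notin> W2 \<and> W3 = insert g W2 \<or> g \<notin> W3 \<and> W2 = insert g W3 \<and> g \<in> Q"
  proof -
    have "g \<in> Q" if gn: "g \<notin> W3" "W2 = insert g W3"
    proof (rule ccontr)
      assume "g \<notin> Q"
      have eq: "insert f W1 = insert g W3" using f(2) gn(2) by simp
      note ex = insert_exchange[OF eq f(1) gn(1)]
      have "f \<noteq> g" using ex(1) safe nsafe by auto
      then have "g = t" "W3 = insert f (W1 - {g})" using ex(2,3) \<open>g \<notin> Q\<close> Q(3) by auto
      then have "W3 = insert f Q" using Q by simp
      then show False using no[OF Q(1) fQ(1)] by simp
    qed
    then show ?thesis using g by blast
  qed
  have "f \<in> W3" using g f(2) fQ(1) by (metis insertE insertI1 insertI2)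
  then have fM: "f \<in> M" using M(2) by blast
  have p3: "3 \<le> p" using p_facts(3) by simp
  have QM: "Q \<subseteq> M" using W1M Q(3) by blast
  obtain \<phi> a0 a1 b0 b1 c0 c1 where \<phi>: "lat_face \<phi>" and hb: "hex_bar p a0 a1 b0 b1 c0 c1"
    and im: "\<phi> ` Q = hex_bar.P a0 a1 b0 b1 c0 c1" "\<phi> ` M = hex_bar.H a0 a1 b0 b1 c0 c1"
    by (rule opt_hex_sub[OF p3 Q(1) M(1) QM])
  interpret hex_bar p a0 a1 b0 b1 c0 c1 by (rule hb)
  have len: "a1 - lft = int r + 1"
    using bar_length area_p(2) p_facts lft_le by simp
  have iso: "face_iso \<phi>" using lat_face_iso[OF \<phi>] .
  have inj: "inj \<phi>" using face_iso_inj[OF iso] .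
  have perP: "per P = p" using face_iso_per[OF iso Q'(1)] im(1) Q'(2) by simp
  have H: "H = P \<union> bar lft a1" using H_eq seg_def by simp
  have out: "\<exists>x. lft \<le> x \<and> x \<le> a1 \<and> (\<phi> v = tt x \<or> lft < x \<and> \<phi> v = uu x)" if "v \<in> M" "v \<notin> Q" for v
  proof -
    have "\<phi> v \<in> H" "\<phi> v \<notin> P" using that im inj by (auto simp: inj_image_mem_iff simp flip: im)
    then have "\<phi> v \<in> bar lft a1" using H by blast
    then show ?thesis unfolding bar_def by force
  qed
  have perW: "per (\<phi> ` W) = per W" if "finite W" for W using face_iso_per[OF iso that] .
  have imW1: "\<phi> ` W1 = insert (\<phi> t) P" using Q(3) im(1) by simp
  have imW2: "\<phi> ` W2 = insert (\<phi> f) (insert (\<phi> t) P)" using f(2) imW1 by simp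
  have fin2: "finite W2" using f W1(1) by simp
  obtain \<tau> where \<tau>: "lft \<le> \<tau>" "\<tau> \<le> a1" "\<phi> t = tt \<tau>"
  proof -
    obtain x where x: "lft \<le> x" "x \<le> a1" "\<phi> t = tt x \<or> lft < x \<and> \<phi> t = uu x" using out[of t] W1M Q by blast
    \<comment> \<open>A \<open>uu\<close> face without neighbours would cost three edges.\<close>
    have "\<phi> t \<noteq> uu x"
    proof
      assume "\<phi> t = uu x"
      then have "per (insert (uu x) P) \<le> Suc p" using perW[OF W1(1)] W1(3) imW1 by simp
      then show False using per_insert_uu[of "{}" x] perP by simp
    qed
    then show thesis using that x by blast
  qed
  have per1: "per (insert (tt \<tau>) P) = Suc p" using per_single[OF \<tau>(1,2)] perP by simp
  have per2: "per (insert (\<phi> f) (insert (tt \<tau>) P)) \<le> p + 2" using perW[OF fin2] imW2 \<tau>(3) W2(2) by simp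
  have gs: "\<not> (\<phi> ` W2 \<in> gate_sets)"
  proof
    assume *: "\<phi> ` W2 \<in> gate_sets"
    obtain \<psi> where \<psi>: "lat_face \<psi>" "\<And>f. \<psi> (\<phi> f) = f" using lat_face_has_inv[OF \<phi>] by metis
    have "W2 = \<psi> ` \<phi> ` W2" using \<psi>(2) by (simp add: image_image)
    then have "gate_shape p W2" using gate_shapeI[OF \<psi>(1) hb *] by simp
    then show False using ng by contradiction
  qed
  have gsI: "P \<union> R \<in> gate_sets" if "lft \<le> x" "x < a1"
    "R = {tt x, uu (x + 1)} \<or> R = {tt (x + 1), uu (x + 1)} \<or> R = {tt x, tt (x + 1)}" for R x
    unfolding gate_sets_def using that by blast
  obtain \<kappa> where \<kappa>: "lft \<le> \<kappa>" "\<kappa> \<le> a1" "\<phi> f = tt \<kappa>"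
  proof -
    obtain x where x: "lft \<le> x" "x \<le> a1" "\<phi> f = tt x \<or> lft < x \<and> \<phi> f = uu x" using out[OF fM fQ(1)] by blast
    have "\<not> (lft < x \<and> \<phi> f = uu x)"
    proof
      assume u: "lft < x \<and> \<phi> f = uu x"
      have "per (insert (uu x) (P \<union> {tt \<tau>})) \<le> p + 2" using per2 u by simp
      moreover have "per (P \<union> {tt \<tau>}) = Suc p" using per1 by simp
      ultimately have "tt (x - 1) \<in> {tt \<tau>} \<or> tt x \<in> {tt \<tau>}"
        using per_insert_uu(1)[of "{tt \<tau>}" x] by (auto split: if_splits simp: of_bool_def)
      then have "\<tau> = x - 1 \<or> \<tau> = x" by auto
      moreover have "P \<union> {tt (x - 1), uu x} \<in> gate_sets"
        using gsI[of "x - 1" "{tt (x - 1), uu x}"] u x by simp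
      moreover have "P \<union> {tt x, uu x} \<in> gate_sets"
        using gsI[of "x - 1" "{tt x, uu x}"] u x by simp
      moreover have "\<phi> ` W2 = P \<union> {tt \<tau>, uu x}" unfolding imW2 \<tau>(3) u[THEN conjunct2] by blast
      ultimately show False using gs by metis
    qed
    then show thesis using that x by blast
  qed
  have far: "\<bar>\<kappa> - \<tau>\<bar> \<ge> 2"
  proof (rule ccontr)
    assume "\<not> \<bar>\<kappa> - \<tau>\<bar> \<ge> 2"
    moreover have "\<kappa> \<noteq> \<tau>" using fQ(2) \<tau>(3) \<kappa>(3) inj by (metis injD)
    ultimately have c: "\<kappa> = \<tau> + 1 \<or> \<tau> = \<kappa> + 1" by linarith
    have eq: "\<phi> ` W2 = P \<union> {tt \<tau>, tt \<kappa>}" unfolding imW2 \<tau>(3) \<kappa>(3) by blast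
    have "P \<union> {tt \<tau>, tt \<kappa>} \<in> gate_sets"
      using c
    proof
      assume "\<kappa> = \<tau> + 1"
      then show ?thesis using gsI[of \<tau> "{tt \<tau>, tt \<kappa>}"] \<tau>(1,2) \<kappa>(1,2) by simp
    next
      assume "\<tau> = \<kappa> + 1"
      then have "P \<union> {tt \<kappa>, tt \<tau>} \<in> gate_sets" using gsI[of \<kappa> "{tt \<kappa>, tt \<tau>}"] \<tau>(1,2) \<kappa>(1,2) by simp
      then show ?thesis by (simp add: insert_commute)
    qed
    then show False using gs eq by simp
  qed
  let ?B = "{tt \<tau>, tt \<kappa>}"
  have W2': "\<phi> ` W2 = P \<union> ?B" unfolding imW2 \<tau>(3) \<kappa>(3) by blast
  have "tt \<kappa> \<notin> P \<union> {tt \<tau>}" using far by auto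
  then have per2': "per W2 = p + 2"
    using per_insert_tt(1)[OF \<kappa>(1,2), of "{tt \<tau>}"] per1 W2' perW[OF fin2] by (simp add: insert_commute)
  from g show False
  proof
    \<comment> \<open>Winning back an edge takes two neighbours, but a further \<open>tt\<close>
      face touches only \<open>P\<close>, and a \<open>uu\<close> face at most one of the two
      distant \<open>tt\<close> faces.\<close>
    assume g: "g \<notin> W2 \<and> W3 = insert g W2"
    then obtain x where x: "lft \<le> x" "x \<le> a1" "\<phi> g = tt x \<or> lft < x \<and> \<phi> g = uu x"
      using out[of g] M(2) f(2) Q(3) by blast
    have d: "deg W2 g \<ge> 2" using per_insert[OF fin2, of g] g per2' W3(3) by auto
    have "deg (\<phi> ` W2) (\<phi> g) \<ge> 2"
    proof -
      have "per (insert (\<phi> g) (\<phi> ` W2)) \<le> Suc p"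
        using perW[OF W3(1)] g W3(3) by simp
      moreover have "\<phi> g \<notin> \<phi> ` W2" using g inj by (simp add: inj_image_mem_iff)
      ultimately show ?thesis using per_insert[of "\<phi> ` W2" "\<phi> g"] fin2 perW[OF fin2] per2' by simp
    qed
    then have "deg (P \<union> ?B) (\<phi> g) \<ge> 2" by (simp only: W2')
    moreover have "deg (P \<union> ?B) (tt x) = 1 + of_bool (uu (x + 1) \<in> ?B) + of_bool (uu x \<in> ?B)"
      by (rule deg_tt[OF x(1,2)]) (elim insertE; simp)
    then have "deg (P \<union> ?B) (tt x) = 1" by simp
    moreover have "deg (P \<union> ?B) (uu x) = of_bool (tt (x - 1) \<in> ?B) + of_bool (tt x \<in> ?B)"
      by (rule deg_uu) (elim insertE; simp)
    then have "deg (P \<union> ?B) (uu x) \<le> 1" using far by (auto simp: of_bool_def)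
    ultimately show False using x(3) by fastforce
  next
    \<comment> \<open>Removing a face of \<open>Q\<close> with at most one neighbour leaves a set
      too large for its perimeter unless \<open>r = 0\<close>; but then the bar has only two
      columns, which are adjacent.\<close>
    assume g: "g \<notin> W3 \<and> W2 = insert g W3 \<and> g \<in> Q"
    have "deg W3 g \<le> 1" using per_insert[OF W3(1), of g] g per2' W3(3) by auto
    moreover have "Q - {g} \<subseteq> W3" using f(2) Q(3) g by blast
    ultimately have "deg (Q - {g}) g \<le> 1" using deg_mono[of "Q - {g}" W3 g] by simp
    moreover have "insert g (Q - {g}) = Q" using g by blast
    ultimately have "per (Q - {g}) \<le> p - 1" using per_insert[of "Q - {g}" g] Q'(1,2) by auto
    then have "card (Q - {g}) \<le> max_area (p - 1)"
      using card_le_per[of "Q - {g}"] max_area_mono[of "per (Q - {g})" "p - 1"] Q'(1) by simp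
    moreover have "card (Q - {g}) = max_area p - 1" using Q' g by simp
    ultimately have "r = 0" using area_p(3) by simp
    then show False using len far \<tau>(1,2) \<kappa>(1,2) by simp
  qed
qed

section \<open>Planar lifts at the critical level\<close>

lemma area_forms:
  "(p = 6 * r + 5 \<and> 1 \<le> r \<and> max_area p = 6 * r * r + 10 * r + 3) \<or> (p = 6 * r + 7 \<and> max_area p = 6 * r * r + 14 * r + 7)"
  using cases_rp by (elim disjE; simp add: max_area_mod6 max_area_mod6_pred)

lemma odd_area: "odd (max_area p)"
  using area_forms by (elim disjE; simp)

text \<open>Makes every droplet at the critical level, up to the area of the next hexagon, miss a
  column and a row, so that it can be cut open.\<close>

lemma cut_ineq:
  assumes "P \<le> p + 2" "c \<le> max_area p + 2 * r + 3"
  shows "L * int P + int c < 2 * L * L"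
proof -
  have key: "L * (int p + 2) + int (max_area p) + 2 * int r + 3 < 2 * L * L"
  proof -
    consider (1) "p = 6 * r + 5" "1 \<le> r" "max_area p = 6 * r * r + 10 * r + 3" "28 * int r + 15 \<le> 5 * L"
      | (2) "p = 6 * r + 7" "max_area p = 6 * r * r + 14 * r + 7" "28 * int r + 29 \<le> 5 * L"
      using area_forms cases_rp by (elim disjE) simp_all
    then show ?thesis
    proof cases
      case 1
      \<comment> \<open>The right-hand side is \<open>25 L (2 L - (p + 2))\<close>, and the
        hypothesis on \<open>L\<close> bounds both factors from below.\<close>
      have "(28 * int r + 15) * (26 * int r - 5) \<le> (5 * L) * (10 * L - 30 * int r - 35)"
        using 1 by (intro mult_mono) auto
      then have "175 * L + 250 * int r + 150 * (L * int r) + 728 * (int r * int r) \<le> 75 + 50 * (L * L)"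
        by (simp add: algebra_simps)
      moreover have "int r \<le> int r * int r" "1 \<le> int r" using 1(2) by auto
      ultimately have "150 + 175 * L + 300 * int r + 150 * (L * int r) + 150 * (int r * int r) < 50 * (L * L)"
        by linarith
      then show ?thesis unfolding 1(3) unfolding 1(1) by (simp add: algebra_simps)
    next
      case 2
      have "(28 * int r + 29) * (26 * int r + 13) \<le> (5 * L) * (10 * L - 30 * int r - 45)"
        using 2 by (intro mult_mono) auto
      then have "225 * L + 1118 * int r + 150 * (L * int r) + 728 * (int r * int r) + 377 \<le> 50 * (L * L)"
        by (simp add: algebra_simps)
      moreover have "0 \<le> int r * int r" "0 \<le> int r" by simp_all
      ultimately have "250 + 225 * L + 400 * int r + 150 * (L * int r) + 150 * (int r * int r) < 50 * (L * L)"
        by linarith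
      then show ?thesis unfolding 2(2) unfolding 2(1) by (simp add: algebra_simps)
    qed
  qed
  have "L * int P \<le> L * (int p + 2)" using assms(1) L_pos by (intro mult_left_mono) auto
  then show ?thesis using key assms(2) by linarith
qed

text \<open>\<open>j\<close> is the largest excess over \<open>Q*\<close> in perimeter and the least
  excess in area: 0 at the area of \<open>Q*\<close>, 1 at odd offsets and 2 at positive even
  ones.\<close>

lemma tight_near:
  assumes "finite W" "j \<le> 2" "per W \<le> p + j" "max_area p + j \<le> card W"
  shows "tight W"
proof -
  obtain k where k: "p = k + 7" using p_facts(3) le_Suc_ex by (metis add.commute)
  have "(per W - 3) * (per W - 3) \<le> (p + j - 3) * (p + j - 3)" using assms(3) by (intro mult_mono) auto
  moreover have "9 + (p + j - 3) * (p + j - 3) < 6 * max_area p + 6 * j"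
  proof -
    have "j = 0 \<or> j = 1 \<or> j = 2" using assms(2) by linarith
    then show ?thesis using area_p(1) unfolding k by (elim disjE; simp add: algebra_simps)
  qed
  ultimately have "9 + (per W - 3) * (per W - 3) < 6 * card W" using assms(4) by linarith
  then show ?thesis using assms(1) by (simp add: tight_def)
qed

text \<open>Two free strips are wanted because the lift must accept the next face and still have one
  strip to spare.\<close>

lemma fits_near:
  assumes "finite W" "j \<le> 2" "per W \<le> p + j" "max_area p + j \<le> card W"
  shows "fits (L - 2) W" "W \<noteq> {}"
proof -
  have pos: "max_area p > 0" using max_area_strict[of 0 p] p_facts(3) by simp
  then show ne: "W \<noteq> {}" using assms(4) by auto
  \<comment> \<open>What remains for the other two widths if one of them exceeded
    \<open>L - 2\<close>.\<close>
  define d where "d = per W - (nat (L - 2) + 1)"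
  have d: "int d \<le> int p + int j + 1 - L \<or> d = 0"
    using assms(3) p_facts(4) unfolding d_def by linarith
  have "d * d < 2 * (max_area p + j)"
  proof (cases "d = 0")
    case True
    then show ?thesis using pos by simp
  next
    case False
    then have d: "int d \<le> int p + int j + 1 - L" using d by simp
    have j: "j = 0 \<or> j = 1 \<or> j = 2" using assms(2) by linarith
    consider (1) "p = 6 * r + 5" "1 \<le> r" "max_area p = 6 * r * r + 10 * r + 3" "28 * int r + 15 \<le> 5 * L"
      | (2) "p = 6 * r + 7" "max_area p = 6 * r * r + 14 * r + 7" "28 * int r + 29 \<le> 5 * L"
      using area_forms cases_rp by (elim disjE) simp_all
    then have "int d * int d < 2 * (int (max_area p) + int j)"
    proof cases
      case 1
      \<comment> \<open>Five times the bound \<open>p + j + 1 - L\<close>, with \<open>5 L\<close>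
        replaced by its lower bound.\<close>
      have "(5 * int d) * (5 * int d) \<le> (2 * int r + 15 + 5 * int j) * (2 * int r + 15 + 5 * int j)"
        using d 1 by (intro mult_mono) auto
      then have a: "25 * (int d * int d) \<le> 225 + 60 * int r + 4 * (int r * int r) + int j * (20 * int r + 150 + 25 * int j)"
        by (simp add: algebra_simps)
      have b: "int r \<le> int r * int r" "1 \<le> int r" using 1(2) by auto
      have "25 * (int d * int d) < 300 * (int r * int r) + 500 * int r + 150 + 50 * int j"
        using j
      proof (elim disjE)
        assume "j = 0" then have "25 * (int d * int d) \<le> 225 + 60 * int r + 4 * (int r * int r)" using a by simp
        then show ?thesis using b \<open>j = 0\<close> by linarith
      next
        assume "j = 1" then have "25 * (int d * int d) \<le> 400 + 80 * int r + 4 * (int r * int r)" using a by simp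
        then show ?thesis using b \<open>j = 1\<close> by linarith
      next
        assume "j = 2" then have "25 * (int d * int d) \<le> 625 + 100 * int r + 4 * (int r * int r)" using a by simp
        then show ?thesis using b \<open>j = 2\<close> by linarith
      qed
      then have "int d * int d < 2 * (6 * int r * int r + 10 * int r + 3 + int j)" by (simp add: algebra_simps)
      then show ?thesis unfolding 1(3) by simp
    next
      case 2
      have "(5 * int d) * (5 * int d) \<le> (2 * int r + 11 + 5 * int j) * (2 * int r + 11 + 5 * int j)"
        using d 2 by (intro mult_mono) auto
      then have a: "25 * (int d * int d) \<le> 121 + 44 * int r + 4 * (int r * int r) + int j * (20 * int r + 110 + 25 * int j)"
        by (simp add: algebra_simps)
      have b: "0 \<le> int r * int r" "0 \<le> int r" by simp_all
      have "25 * (int d * int d) < 300 * (int r * int r) + 700 * int r + 350 + 50 * int j"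
        using j
      proof (elim disjE)
        assume "j = 0" then have "25 * (int d * int d) \<le> 121 + 44 * int r + 4 * (int r * int r)" using a by simp
        then show ?thesis using b \<open>j = 0\<close> by linarith
      next
        assume "j = 1" then have "25 * (int d * int d) \<le> 256 + 64 * int r + 4 * (int r * int r)" using a by simp
        then show ?thesis using b \<open>j = 1\<close> by linarith
      next
        assume "j = 2" then have "25 * (int d * int d) \<le> 441 + 84 * int r + 4 * (int r * int r)" using a by simp
        then show ?thesis using b \<open>j = 2\<close> by linarith
      qed
      then have "int d * int d < 2 * (6 * int r * int r + 14 * int r + 7 + int j)" by (simp add: algebra_simps)
      then show ?thesis unfolding 2(2) by simp
    qed
    then have "int (d * d) < int (2 * (max_area p + j))" by simp
    then show ?thesis by (simp only: of_nat_less_iff)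
  qed
  then have "(per W - (nat (L - 2) + 1)) * (per W - (nat (L - 2) + 1)) < 2 * card W"
    using assms(4) unfolding d_def by (meson less_le_trans mult_le_mono2)
  then have "fits (int (nat (L - 2))) W" using tight_fits tight_near[OF assms] ne by blast
  then show "fits (L - 2) W" using p_facts(4) by simp
qed

text \<open>Up to the next hexagon, the area beyond two additional faces is worth at most
  \<open>h (2 r + 1)\<close>, less than \<open>J\<close>, so it cannot pay for a third edge. With
  fewer than two additional faces not even a second edge is affordable.\<close>

lemma perT_level:
  assumes "energyT J h L A \<le> crit_energy" "max_area p \<le> card A" "card A \<le> max_area p + 2 * r + 3"
  shows "perT L A \<le> p + 2" "card A < max_area p + 2 \<Longrightarrow> perT L A \<le> p + 1"
proof -
  have e: "J * real (perT L A) \<le> J * (real p + 2) + h * (real (card A) - real (max_area p) - 2)"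
    using assms(1) by (simp add: energyT_def crit_energy_def algebra_simps)
  have "h * (real (card A) - real (max_area p) - 2) \<le> h * (2 * real r + 1)"
    using assms(3) h_pos by (intro mult_left_mono) auto
  then have "J * real (perT L A) < J * (real p + 3)" using e J_bounds(1) by (simp add: algebra_simps)
  then have "real (perT L A) < real p + 3" using J_bounds(4) by simp
  then show "perT L A \<le> p + 2" by linarith
  assume "card A < max_area p + 2"
  then have "h * (real (card A) - real (max_area p) - 2) < 0"
    using h_pos by (intro mult_pos_neg) auto
  then have "J * real (perT L A) < J * (real p + 2)" using e by linarith
  then have "real (perT L A) < real p + 2" using J_bounds(4) by simp
  then show "perT L A \<le> p + 1" by linarith
qed

lemma lift_level:
  assumes A: "A \<subseteq> Lam L" and e: "energyT J h L A \<le> crit_energy" "max_area p \<le> card A" "card A \<le> max_area p + 2 * r + 3"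
  obtains W where "finite W" "fits (L - 1) W" "proj L ` W = A"
  using lift_exists[OF A L_pos] cut_ineq[OF perT_level(1)[OF e] e(3)] by blast

text \<open>Parity sharpens the energy bound: at the area of \<open>Q*\<close> it excludes perimeter
  \<open>p + 1\<close>, at odd offsets \<open>p + 2\<close>.\<close>

lemma per_level:
  assumes e: "energyT J h L A \<le> crit_energy" "max_area p \<le> card A" "card A \<le> max_area p + 2 * r + 3"
    and W: "finite W" "fits (L - 1) W" "proj L ` W = A"
  shows "per W \<le> p + 2" "card W = card A" "card A = max_area p \<Longrightarrow> per W \<le> p"
    "odd (card A - max_area p) \<Longrightarrow> per W \<le> Suc p"
proof -
  have P: "perT L A = per W" "card A = card W" using perT_proj[OF W(2,1)] W(3) by simp_all
  then show "per W \<le> p + 2" "card W = card A" using perT_level(1)[OF e] by simp_all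
  have par: "even (per W + card A)" using per_parity[OF W(1)] P by simp
  show "per W \<le> p" if c: "card A = max_area p"
  proof -
    have "per W \<le> p + 1" using perT_level(2)[OF e] c P by simp
    moreover have "per W \<noteq> p + 1" using par c odd_area p_facts(1) by auto
    ultimately show ?thesis by simp
  qed
  show "per W \<le> Suc p" if o: "odd (card A - max_area p)"
  proof -
    have "even (card A)" using o e(2) odd_area by simp
    then have "even (per W)" using par by simp
    then have "per W \<noteq> p + 2" using p_facts(1) by auto
    then show ?thesis using perT_level(1)[OF e] P by simp
  qed
qed

text \<open>The lift is carried along the path instead of being chosen anew, since
  \<open>two_step\<close> compares planar droplets that differ in one face.\<close>

lemma lift_step:
  assumes W: "finite W" "fits (L - 2) W" "W \<noteq> {}" "proj L ` W = A" and B: "B \<subseteq> Lam L" "adj1 A B"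
  obtains V where "finite V" "fits (L - 1) V" "proj L ` V = B" "adj1 W V"
proof -
  obtain x where x: "x \<notin> A \<and> B = insert x A \<or> x \<notin> B \<and> A = insert x B" using B(2) unfolding adj1_def by blast
  show thesis
  proof (cases "x \<notin> A \<and> B = insert x A")
    case True
    have x: "x \<in> Lam L" "x \<notin> proj L ` W" using True B(1) W(4) by auto
    have "2 < L" using p_facts(4) by simp
    then obtain f where f: "proj L f = x" "f \<notin> W" "fits (L - 1) (insert f W)"
      using lift_insert[OF W(2,3) _ x] by blast
    show thesis
    proof (rule that[of "insert f W"])
      show "adj1 W (insert f W)" using f(2) unfolding adj1_def by blast
      show "proj L ` insert f W = B" using W(4) f(1) True by simp
    qed (use W(1) f(3) in simp_all)
  next
    case False
    then have x: "x \<notin> B" "A = insert x B" using x by blast+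
    then obtain f where f: "f \<in> W" "x = proj L f" using W(4) by blast
    have inj: "inj_on (proj L) W" using fits_inj[OF fits_weaken[OF W(2), of L]] by simp
    have "proj L ` (W - {f}) = A - {x}"
      using inj_on_image_set_diff[OF inj, of W "{f}"] f W(4) by simp
    then have im: "proj L ` (W - {f}) = B" using x by simp
    have "fits (L - 1) (W - {f})" using fits_mono[OF fits_weaken[OF W(2), of "L - 1"]] by auto
    moreover have "adj1 W (W - {f})" using f(1) unfolding adj1_def by (intro exI[of _ f]) (simp add: insert_absorb)
    ultimately show thesis using that W(1) im by blast
  qed
qed

section \<open>The invariant along a path\<close>

definition gateT :: "face set \<Rightarrow> bool" where
  "gateT A \<longleftrightarrow> (\<exists>W. gate_shape p W \<and> finite W \<and> fits (L - 1) W \<and> proj L ` W = A)"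

text \<open>At offset \<open>2 r + 3 = max_area (p + 1) - max_area p\<close> a droplet of perimeter \<open>p + 1\<close> is itself extremal, hence not safe:
  this is where a path avoiding the gate gets stuck.\<close>

definition invar :: "face set \<Rightarrow> bool" where
  "invar A \<longleftrightarrow> card A \<le> max_area p \<or>
     (card A < max_area p + 2 * r + 3 \<and> max_area p < card A \<and> odd (card A - max_area p) \<and>
       (\<exists>W. finite W \<and> fits (L - 1) W \<and> proj L ` W = A \<and> safe W)) \<or>
     (card A < max_area p + 2 * r + 3 \<and> max_area p < card A \<and> even (card A - max_area p) \<and>
       (\<exists>V W. finite V \<and> max_area p < card V \<and> per V \<le> Suc p \<and> safe V \<and> adj1 V W \<and>
         finite W \<and> fits (L - 1) W \<and> proj L ` W = A))"

lemma invar_odd: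
  assumes "card A < max_area p + 2 * r + 3" "max_area p < card A" "odd (card A - max_area p)"
    "finite W" "fits (L - 1) W" "proj L ` W = A" "safe W"
  shows "invar A"
  using assms unfolding invar_def by blast

lemma invar_even:
  assumes "card A < max_area p + 2 * r + 3" "max_area p < card A" "even (card A - max_area p)"
    "finite V" "max_area p < card V" "per V \<le> Suc p" "safe V" "adj1 V W"
    "finite W" "fits (L - 1) W" "proj L ` W = A"
  shows "invar A"
  using assms unfolding invar_def by blast

text \<open>Upwards the area of \<open>Q*\<close> is left only from extremal droplets, so the next
  one is a copy of \<open>Q*\<close> with one more face. From odd to even offsets the predecessor is
  recorded; from even to odd ones \<open>two_step\<close> applies to it.\<close>

lemma invar_step:
  assumes inv: "invar A" and A: "A \<subseteq> Lam L" "energyT J h L A \<le> crit_energy" "\<not> gateT A"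
    and B: "B \<subseteq> Lam L" "energyT J h L B \<le> crit_energy" and ab: "adj1 A B"
  shows "invar B"
proof -
  have fin: "finite A" "finite B" using A(1) B(1) finite_Lam finite_subset by blast+
  have cd: "card B = Suc (card A) \<or> card A = Suc (card B)"
    using ab fin unfolding adj1_def by auto
  consider (low) "card B \<le> max_area p" | (first) "card A = max_area p" "card B = Suc (max_area p)"
    | (oddl) W where "max_area p < card B" "card A < max_area p + 2 * r + 3" "max_area p < card A" "odd (card A - max_area p)"
      "finite W" "fits (L - 1) W" "proj L ` W = A" "safe W"
    | (evenl) V W where "max_area p < card B" "card A < max_area p + 2 * r + 3" "max_area p < card A" "even (card A - max_area p)"
      "finite V" "max_area p < card V" "per V \<le> Suc p" "safe V" "adj1 V W" "finite W" "fits (L - 1) W" "proj L ` W = A"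
  proof (cases "card B \<le> max_area p")
    case True
    then show ?thesis by (rule low)
  next
    case cB: False
    show ?thesis
    proof (cases "card A \<le> max_area p")
      case True
      then have "card A = max_area p" "card B = Suc (max_area p)" using cB cd by linarith+
      then show ?thesis by (rule first)
    next
      case False
      with inv have "(card A < max_area p + 2 * r + 3 \<and> max_area p < card A \<and> odd (card A - max_area p) \<and>
          (\<exists>W. finite W \<and> fits (L - 1) W \<and> proj L ` W = A \<and> safe W)) \<or>
        (card A < max_area p + 2 * r + 3 \<and> max_area p < card A \<and> even (card A - max_area p) \<and>
          (\<exists>V W. finite V \<and> max_area p < card V \<and> per V \<le> Suc p \<and> safe V \<and> adj1 V W \<and>
            finite W \<and> fits (L - 1) W \<and> proj L ` W = A))"
        unfolding invar_def by blast
      then show ?thesis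
      proof (elim disjE conjE exE)
        fix W assume "card A < max_area p + 2 * r + 3" "max_area p < card A" "odd (card A - max_area p)"
          "finite W" "fits (L - 1) W" "proj L ` W = A" "safe W"
        then show ?thesis using oddl cB not_le by blast
      next
        fix V W assume "card A < max_area p + 2 * r + 3" "max_area p < card A" "even (card A - max_area p)"
          "finite V" "max_area p < card V" "per V \<le> Suc p" "safe V" "adj1 V W"
          "finite W" "fits (L - 1) W" "proj L ` W = A"
        then show ?thesis using evenl cB not_le by blast
      qed
    qed
  qed
  then show ?thesis
  proof cases
    case low
    then show ?thesis by (simp add: invar_def)
  next
    case first
    have c: "max_area p \<le> card A" "card A \<le> max_area p + 2 * r + 3" using first by simp_all
    obtain W where W: "finite W" "fits (L - 1) W" "proj L ` W = A" using lift_level[OF A(1,2) c] .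
    have pW: "per W \<le> p" "card W = max_area p" using per_level[OF A(2) c W] first by simp_all
    have Q: "opt_hex p W" using extremal_p[OF W(1) pW] .
    have f2: "fits (L - 2) W" "W \<noteq> {}" using fits_near[OF W(1), of 0] pW by simp_all
    obtain V where V: "finite V" "fits (L - 1) V" "proj L ` V = B" "adj1 W V"
      using lift_step[OF W(1) f2 W(3) B(1) ab] .
    have cV: "card V = Suc (card W)" using perT_proj(2)[OF V(2,1)] V(3) first pW by simp
    then have "\<exists>f. f \<notin> W \<and> V = insert f W" using V(1,4) unfolding adj1_def by auto
    then have "safe V" using Q unfolding safe_def by blast
    then show ?thesis using invar_odd[OF _ _ _ V(1-3)] first by simp
  next
    case oddl
    have c: "max_area p \<le> card A" "card A \<le> max_area p + 2 * r + 3" using oddl by simp_all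
    have pW: "per W \<le> Suc p" "card W = card A" using per_level[OF A(2) c oddl(5-7)] oddl(4) by simp_all
    have f2: "fits (L - 2) W" "W \<noteq> {}" using fits_near[OF oddl(5), of 1] pW oddl(3) by simp_all
    obtain V where V: "finite V" "fits (L - 1) V" "proj L ` V = B" "adj1 W V"
      using lift_step[OF oddl(5) f2 oddl(7) B(1) ab] .
    have ne: "card A \<noteq> max_area p + 2 * r + 2" using oddl(4) by auto
    have "card B < max_area p + 2 * r + 3" using cd oddl(2) ne by linarith
    moreover have "even (card B - max_area p)" using cd oddl(1,3,4) by auto
    moreover have "max_area p < card W" using pW(2) oddl(3) by simp
    ultimately show ?thesis
      using invar_even[OF _ oddl(1) _ oddl(5) _ pW(1) oddl(8) V(4) V(1-3)] by blast
  next
    case evenl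
    have c: "max_area p \<le> card A" "card A \<le> max_area p + 2 * r + 3" using evenl by simp_all
    have "card A - max_area p \<noteq> 1" using evenl(4) by (metis odd_one)
    then have A2: "max_area p + 2 \<le> card A" using evenl(3) by linarith
    have pW: "per W \<le> p + 2" "card W = card A" using per_level[OF A(2) c evenl(10-12)] by simp_all
    have f2: "fits (L - 2) W" "W \<noteq> {}" using fits_near[OF evenl(10), of 2] pW A2 by simp_all
    obtain U where U: "finite U" "fits (L - 1) U" "proj L ` U = B" "adj1 W U"
      using lift_step[OF evenl(10) f2 evenl(12) B(1) ab] .
    have cB: "max_area p \<le> card B" "card B \<le> max_area p + 2 * r + 3" using cd evenl(1,2) by linarith+
    have oB: "odd (card B - max_area p)" using cd evenl(1,3,4) by auto
    have pU: "per U \<le> Suc p" "card U = card B" using per_level[OF B(2) cB U(1-3)] oB by simp_all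
    have ng: "\<not> gate_shape p W" using A(3) evenl(10-12) unfolding gateT_def by blast
    have sU: "safe U"
      by (rule two_step[OF evenl(5-7) _ pW(1) U(1) _ pU(1) evenl(9) U(4) evenl(8) ng])
        (use pW A2 pU evenl(1) in simp_all)
    have "card B \<noteq> max_area p + 2 * r + 3"
    proof
      assume c: "card B = max_area p + 2 * r + 3"
      then have cU: "card U = max_area (Suc p)" using pU(2) area_p(2) by simp
      have "max_area (Suc p) \<le> max_area (per U)" using card_le_per[OF U(1)] cU by simp
      then have "Suc p \<le> per U"
        using max_area_strict[of "per U" "Suc p"] p_facts(3) by linarith
      then have "per U = Suc p" using pU(1) by linarith
      then have "opt_hex (Suc p) U"
        by (rule extremal_structure[OF _ U(1) _ cU, rotated]) (use p_facts(3) in linarith)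
      then have "\<exists>M. opt_hex (Suc p) M \<and> U \<subseteq> M" by (intro exI[of _ U] conjI subset_refl)
      then obtain Q f where "opt_hex p Q" "f \<notin> Q" "U = insert f Q" using sU unfolding safe_def by metis
      then have "card U = Suc (max_area p)" using opt_hex_p[of Q] by simp
      then show False using pU(2) c by simp
    qed
    then have "card B < max_area p + 2 * r + 3" using cB(2) by simp
    then show ?thesis using invar_odd[OF _ evenl(1) oB U(1-3) sU] by blast
  qed
qed

lemma card_Lam_large: "max_area p + 2 * r + 3 < card (Lam L)"
proof -
  have "L * int 0 + int (max_area p + 2 * r + 3) < 2 * L * L"
    by (rule cut_ineq) simp_all
  then have "int (max_area p + 2 * r + 3) < int (card (Lam L))" using card_Lam L_pos by simp
  then show ?thesis by (simp only: of_nat_less_iff)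
qed

lemma plus_set_Lam: "plus_set L \<sigma> \<subseteq> Lam L"
  by (auto simp: plus_set_def)

lemma plus_set_all: "plus_set L (all_plus L) = Lam L" "plus_set L (all_minus L) = {}"
  by (auto simp: plus_set_def all_plus_def all_minus_def)

lemma path_adj1:
  assumes "is_path L \<omega>" "Suc k < length \<omega>"
  shows "adj1 (plus_set L (\<omega> ! k)) (plus_set L (\<omega> ! Suc k))"
proof -
  obtain x where x: "x \<in> Lam L" "\<omega> ! Suc k = flip (\<omega> ! k) x" using assms unfolding is_path_def by blast
  have "\<omega> ! k \<in> set \<omega>" using assms(2) by simp
  then have "\<omega> ! k \<in> Conf L" using assms(1) unfolding is_path_def by blast
  then have "plus_set L (\<omega> ! Suc k) = (if x \<in> plus_set L (\<omega> ! k) then plus_set L (\<omega> ! k) - {x} else insert x (plus_set L (\<omega> ! k)))"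
    using plus_set_flip x by simp
  then show ?thesis unfolding adj1_def by (intro exI[of _ x]) (auto simp: insert_absorb)
qed

text \<open>Without a gate the invariant would persist from the empty droplet on, but it bounds the
  area below that of the torus.\<close>

theorem path_visits_gate:
  assumes path: "is_path L \<omega>" "hd \<omega> = all_minus L" "last \<omega> = all_plus L"
    and e: "\<And>\<sigma>. \<sigma> \<in> set \<omega> \<Longrightarrow> energyT J h L (plus_set L \<sigma>) \<le> crit_energy"
  shows "\<exists>\<sigma>\<in>set \<omega>. gateT (plus_set L \<sigma>)"
proof (rule ccontr)
  assume *: "\<not> (\<exists>\<sigma>\<in>set \<omega>. gateT (plus_set L \<sigma>))"
  have ne: "\<omega> \<noteq> []" using path(1) by (simp add: is_path_def)
  have "invar (plus_set L (\<omega> ! k))" if "k < length \<omega>" for k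
    using that
  proof (induction k)
    case 0
    then show ?case using path(2) ne by (simp add: hd_conv_nth[symmetric] plus_set_all invar_def)
  next
    case (Suc k)
    have "\<omega> ! k \<in> set \<omega>" "\<omega> ! Suc k \<in> set \<omega>" using Suc.prems by simp_all
    then show ?case
      using invar_step[OF Suc.IH plus_set_Lam _ _ plus_set_Lam _ path_adj1[OF path(1) Suc.prems]] e * Suc.prems by auto
  qed
  then have "invar (plus_set L (last \<omega>))" using ne by (simp add: last_conv_nth)
  then have "invar (Lam L)" using path(3) plus_set_all by simp
  then show False using card_Lam_large unfolding invar_def by auto
qed

end

section \<open>Descent from the critical droplet\<close>

lemma bar_reach:
  assumes n: "3 \<le> n" and \<phi>: "lat_face \<phi>" and hb: "hex_bar n a0 a1 b0 b1 c0 c1"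
    and im: "\<phi> ` K = hex_bar.P a0 a1 b0 b1 c0 c1" "\<phi> ` M = hex_bar.H a0 a1 b0 b1 c0 c1"
    and h: "0 < h" "h < J" and C: "J * (real n + 2) - h * (real (max_area n) + 2) < C"
  shows "(K, M) \<in> (reach_rel J h C K M)\<^sup>*"
proof -
  interpret hex_bar n a0 a1 b0 b1 c0 c1 by (rule hb)
  have "per P = n" "card P = max_area n" using opt_hex_size[OF n opt_hex_PH(1)] by simp_all
  then have "(P, H) \<in> (reach_rel J h C P H)\<^sup>*" using reach_full[OF h] C by simp
  moreover obtain \<psi> where \<psi>: "lat_face \<psi>" "\<And>f. \<psi> (\<phi> f) = f" using lat_face_has_inv[OF \<phi>] by metis
  moreover have "finite H" using opt_hex_finite[OF opt_hex_PH(2)] .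
  ultimately have "(\<psi> ` P, \<psi> ` H) \<in> (reach_rel J h C (\<psi> ` P) (\<psi> ` H))\<^sup>*"
    using reach_rel_iso[OF lat_face_iso] by blast
  moreover have "\<psi> ` P = K" "\<psi> ` H = M" using \<psi>(2) unfolding im[symmetric] by (simp_all add: image_image)
  ultimately show ?thesis by simp
qed

lemma opt_reach:
  assumes "3 \<le> n" "opt_hex n K" "opt_hex (Suc n) M" "K \<subseteq> M" "0 < h" "h < J"
    "J * (real n + 2) - h * (real (max_area n) + 2) < C"
  shows "(K, M) \<in> (reach_rel J h C K M)\<^sup>*"
proof (rule opt_hex_sub[OF assms(1-4)])
  fix \<phi> a0 a1 b0 b1 c0 c1
  assume "lat_face \<phi>" "hex_bar n a0 a1 b0 b1 c0 c1"
    "\<phi> ` K = hex_bar.P a0 a1 b0 b1 c0 c1" "\<phi> ` M = hex_bar.H a0 a1 b0 b1 c0 c1"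
  then show ?thesis by (rule bar_reach[OF assms(1) _ _ _ _ assms(5-7)])
qed

lemma opt_hex_shrink:
  assumes "opt_hex (Suc n) W" "3 \<le> n"
  obtains K where "opt_hex n K" "K \<subseteq> W"
proof -
  from assms(1) obtain x0 x1 y0 y1 z0 z1 where W: "opt_params (Suc n) x0 x1 y0 y1 z0 z1" "W = hexa x0 x1 y0 y1 z0 z1"
    by (rule opt_hexE)
  obtain k0 k1 l0 l1 m0 m1 where k: "opt_params n k0 k1 l0 l1 m0 m1"
    "x0 \<le> k0" "k1 \<le> x1" "y0 \<le> l0" "l1 \<le> y1" "z0 \<le> m0" "m1 \<le> z1"
    using opt_params_pred[OF W(1) assms(2)] .
  show thesis
  proof (rule that)
    show "opt_hex n (hexa k0 k1 l0 l1 m0 m1)" using k(1) unfolding opt_hex_def by blast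
    show "hexa k0 k1 l0 l1 m0 m1 \<subseteq> W" using k(2-) unfolding W(2) hexa_def thull_def by fastforce
  qed
qed

lemma opt_hex_grow:
  assumes "opt_hex n K"
  obtains W where "opt_hex (Suc n) W" "K \<subseteq> W"
proof -
  from assms(1) obtain k0 k1 l0 l1 m0 m1 where K: "opt_params n k0 k1 l0 l1 m0 m1" "K = hexa k0 k1 l0 l1 m0 m1"
    by (rule opt_hexE)
  obtain x0 x1 y0 y1 z0 z1 where x: "opt_params (Suc n) x0 x1 y0 y1 z0 z1"
    "x0 \<le> k0" "k1 \<le> x1" "y0 \<le> l0" "l1 \<le> y1" "z0 \<le> m0" "m1 \<le> z1"
    using opt_params_succ[OF K(1)] .
  show thesis
  proof (rule that)
    show "opt_hex (Suc n) (hexa x0 x1 y0 y1 z0 z1)" using x(1) unfolding opt_hex_def by blast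
    show "K \<subseteq> hexa x0 x1 y0 y1 z0 z1" using x(2-) unfolding K(2) hexa_def thull_def by fastforce
  qed
qed

context crit
begin

lemma opt_fits: "opt_hex n W \<Longrightarrow> n \<le> 6 * r + 8 \<Longrightarrow> fits (L - 1) W"
proof -
  assume W: "opt_hex n W" "n \<le> 6 * r + 8"
  have "2 * int r + 4 \<le> L" using cases_rp p_facts(4) by (elim disjE conjE; linarith)
  then have "int n \<le> 3 * (L - 1)" using W(2) unfolding right_diff_distrib by linarith
  then show ?thesis using opt_hex_fits[OF W(1)] by blast
qed

lemma p_le: "Suc p \<le> 6 * r + 8"
  using cases_rp by auto

lemma energyT_opt: "opt_hex n W \<Longrightarrow> 3 \<le> n \<Longrightarrow> n \<le> 6 * r + 8 \<Longrightarrow> energyT J h L (proj L ` W) = J * real n - h * real (max_area n)"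
  using energyT_proj[OF opt_fits opt_hex_finite] opt_hex_size by (simp add: energy_def)

text \<open>Energies need not increase from hexagon to hexagon: if \<open>p = 6 r + 7\<close>, the
  bar from perimeter \<open>6 r + 5\<close> to \<open>6 r + 6\<close> has \<open>2 r + 3\<close>
  faces and lowers the energy. So each hexagon is compared with \<open>Q*\<close> directly, with the
  mean \<open>2 r + 2\<close> of this bar and the next one as slope.\<close>

lemma area_below:
  assumes "n \<le> p"
  shows "J * real n - h * real (max_area n) \<le> J * real p - h * real (max_area p)"
    "n < p \<Longrightarrow> J * real n - h * real (max_area n) < J * real p - h * real (max_area p)"
proof -
  have iter: "max_area m \<le> max_area n + (2 * r + 1) * (m - n)" if "n \<le> m" "m \<le> 6 * r + 5" for n m
    using that
  proof (induction m rule: dec_induct)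
    case base
    then show ?case by simp
  next
    case (step m)
    have "max_area (Suc m) \<le> max_area m + 2 * (Suc m div 6) + 1" using max_area_diff[of "Suc m"] by simp
    moreover have "Suc m div 6 \<le> r" using step.prems by simp
    ultimately have "max_area (Suc m) \<le> max_area m + (2 * r + 1)" by linarith
    moreover have "Suc m - n = Suc (m - n)" using step.hyps by simp
    ultimately show ?case using step.IH step.prems by simp
  qed
  have "\<exists>c. max_area p \<le> max_area n + c * (p - n) \<and> h * real c < J"
  proof -
    consider (1) "p = 6 * r + 5" "h * (2 * real r + 1) < J" | (2) "p = 6 * r + 7" "h * (2 * real r + 2) < J"
      using cases_rp by blast
    then show ?thesis
    proof cases
      case 1
      then show ?thesis using iter[of n p] assms by (intro exI[of _ "2 * r + 1"]) (simp add: add.commute)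
    next
      case 2
      have "max_area p \<le> max_area n + (2 * r + 2) * (p - n)"
      proof -
        consider "n = p" | "n = 6 * r + 6" | "n \<le> 6 * r + 5" using assms 2 by linarith
        then show ?thesis
        proof cases
          case 1
          then show ?thesis by simp
        next
          case n: 2
          have "p - 1 = n" "p - n = 1" using 2 n by simp_all
          then show ?thesis using area_p(3) by simp
        next
          case 3
          have "max_area p = max_area (6 * r + 5) + (4 * r + 4)"
            unfolding 2(1) max_area_mod6 max_area_mod6_pred by simp
          moreover have "max_area (6 * r + 5) \<le> max_area n + (2 * r + 1) * (6 * r + 5 - n)" using iter 3 by simp
          moreover have "(2 * r + 1) * (6 * r + 5 - n) \<le> (2 * r + 2) * (6 * r + 5 - n)" by (intro mult_le_mono1) simp
          moreover have "(2 * r + 2) * (p - n) = (2 * r + 2) * (6 * r + 5 - n) + (4 * r + 4)"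
          proof -
            have "p - n = (6 * r + 5 - n) + 2" using 2(1) 3 by simp
            then show ?thesis by (simp only: distrib_left) simp
          qed
          ultimately show ?thesis by linarith
        qed
      qed
      then show ?thesis using 2(2) by (intro exI[of _ "2 * r + 2"]) (simp add: add.commute)
    qed
  qed
  then obtain c where c: "max_area p \<le> max_area n + c * (p - n)" "h * real c < J" by blast
  have "real (max_area p) \<le> real (max_area n + c * (p - n))" using c(1) by (simp only: of_nat_le_iff)
  then have "real (max_area p) \<le> real (max_area n) + real c * (real p - real n)" using assms by (simp add: of_nat_diff)
  then have "h * real (max_area p) \<le> h * (real (max_area n) + real c * (real p - real n))" using h_pos by simp
  then have 1: "h * real (max_area p) \<le> h * real (max_area n) + (h * real c) * (real p - real n)"
    by (simp add: algebra_simps)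
  have "(h * real c) * (real p - real n) \<le> J * (real p - real n)"
    using c(2) assms by (intro mult_right_mono) auto
  then show "J * real n - h * real (max_area n) \<le> J * real p - h * real (max_area p)"
    using 1 by (simp add: algebra_simps)
  assume "n < p"
  then have "(h * real c) * (real p - real n) < J * (real p - real n)"
    using c(2) by (intro mult_strict_right_mono) auto
  then show "J * real n - h * real (max_area n) < J * real p - h * real (max_area p)"
    using 1 by (simp add: algebra_simps)
qed

lemma below_crit: "n < p \<Longrightarrow> J * (real n + 2) - h * (real (max_area n) + 2) < crit_energy"
  using area_below(2)[of n] unfolding crit_energy_def by (simp add: algebra_simps)

lemma energyT_empty: "energyT J h L {} = 0"
  by (simp add: energyT_def perT_def bdry_def)

lemma shrink_to_empty:
  assumes "3 \<le> n" "n \<le> p" "opt_hex n W"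
  shows "({}, proj L ` W) \<in> (reachT J h L crit_energy)\<^sup>*"
  using assms
proof (induction n arbitrary: W rule: nat_induct_at_least)
  case base
  have f3: "max_area 3 = 1" "max_area 2 = 0" by (simp_all add: max_area_def)
  have sz: "per W = 3" "card W = 1" using opt_hex_size[OF _ base.prems(2)] f3 by simp_all
  then obtain f where f: "W = {f}" by (metis card_1_singletonE)
  \<comment> \<open>The peak bound at the fictitious perimeter 2, where \<open>max_area\<close> is
    0; it dominates the energy \<open>3 J - h\<close> of a single face.\<close>
  have c: "4 * J - 2 * h < crit_energy" using below_crit[of 2] p_facts(3) f3 by simp
  have "energyT J h L (proj L ` W) = 3 * J - h"
    using energyT_opt[OF base.prems(2)] f3 by simp
  then have "energyT J h L (proj L ` W) < crit_energy" using c J_bounds(3) by linarith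
  moreover have "energyT J h L {} < crit_energy" using c J_bounds(3,4) energyT_empty by linarith
  moreover have "proj L ` W \<subseteq> Lam L" using proj_in_Lam[OF L_pos] by blast
  ultimately have "({}, proj L ` W) \<in> reachT J h L crit_energy"
    by (intro reachT_I[where f = "proj L f"]) (simp_all add: f)
  then show ?case by blast
next
  case (Suc n)
  obtain K where K: "opt_hex n K" "K \<subseteq> W" using opt_hex_shrink[OF Suc.prems(2) Suc.hyps] .
  have "({}, proj L ` K) \<in> (reachT J h L crit_energy)\<^sup>*" using Suc.IH K(1) Suc.prems(1) by simp
  moreover have "(K, W) \<in> (reach_rel J h crit_energy K W)\<^sup>*"
    using opt_reach[OF Suc.hyps K(1) Suc.prems(2) K(2) h_pos J_bounds(3)] below_crit Suc.prems(1) by simp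
  then have "(proj L ` K, proj L ` W) \<in> (reachT J h L crit_energy)\<^sup>*"
    using reach_to_torus[OF opt_fits opt_hex_finite L_pos] Suc.prems p_le by (meson Suc_leD le_trans)
  ultimately show ?case by (rule rtrancl_trans)
qed

section \<open>Growth to the whole torus\<close>

text \<open>A lower bound for the energy of an unfinished bar relative to the hexagon of perimeter
  \<open>6 r + 7\<close>: one edge against at most \<open>2 r + 2\<close> of the
  \<open>2 r + 3\<close> faces. It is negative only if \<open>p = 6 r + 5\<close>.\<close>

definition slack :: real where
  "slack = min 0 (J - h * (2 * real r + 2))"

lemma max_area_KM: "max_area (6 * r + 8) = max_area (6 * r + 7) + 2 * r + 3"
  unfolding max_area_mod6_pred by simp

text \<open>\<open>2 J - 2 h\<close> is the climb caused by the first two faces of a bar.\<close>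

lemma energy_margin:
  defines "EK \<equiv> J * real (6 * r + 7) - h * real (max_area (6 * r + 7))"
    and "EM \<equiv> J * real (6 * r + 8) - h * real (max_area (6 * r + 8))"
  shows "EK + 2 * J - 2 * h < crit_energy - EM + EK + slack" "EM - EK \<le> slack" "EM < crit_energy"
proof -
  have EM: "EM = EK + J - h * (2 * real r + 3)"
    unfolding EM_def EK_def max_area_KM by (simp add: algebra_simps)
  have aK: "real (max_area (6 * r + 7)) = 6 * (real r * real r) + 14 * real r + 7"
    unfolding max_area_mod6_pred by simp
  consider (1) "p = 6 * r + 5" "max_area p = 6 * r * r + 10 * r + 3" "h * (2 * real r + 1) < J" "J < h * (2 * real r + 2)"
    | (2) "p = 6 * r + 7" "h * (2 * real r + 2) < J" "J < h * (2 * real r + 3)"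
    using cases_rp area_forms by (elim disjE) simp_all
  then show "EK + 2 * J - 2 * h < crit_energy - EM + EK + slack" "EM - EK \<le> slack" "EM < crit_energy"
  proof (atomize (full), cases)
    case 1
    have s: "slack = J - h * (2 * real r + 2)" using 1(4) by (simp add: slack_def)
    have c: "crit_energy = EK - h * 2 + h * (4 * real r + 4)"
      unfolding crit_energy_def unfolding EK_def aK 1(2) unfolding 1(1) by (simp add: algebra_simps)
    have d: "h * (2 * real r + 2) = 2 * (h * real r) + 2 * h" "h * (4 * real r + 4) = 4 * (h * real r) + 4 * h"
      "h * (2 * real r + 3) = 2 * (h * real r) + 3 * h" by (simp_all add: algebra_simps)
    have "0 \<le> h * real r" using h_pos by simp
    then show "EK + 2 * J - 2 * h < crit_energy - EM + EK + slack \<and> EM - EK \<le> slack \<and> EM < crit_energy"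
      using 1(4) h_pos unfolding s c EM d by (intro conjI; linarith)
  next
    case 2
    have s: "slack = 0" using 2(2) by (simp add: slack_def)
    have c: "crit_energy = EK + 2 * J - 2 * h"
      unfolding crit_energy_def unfolding EK_def 2(1) by (simp add: algebra_simps)
    show "EK + 2 * J - 2 * h < crit_energy - EM + EK + slack \<and> EM - EK \<le> slack \<and> EM < crit_energy"
      using 2(3) J_bounds(3,4) unfolding s c EM by (simp add: algebra_simps)
  qed
qed

text \<open>Apart from \<open>K\<close> itself, a set strictly inside \<open>M\<close> is too large
  for perimeter \<open>6 r + 7\<close>, so an edge has been paid, while at least one face of the bar
  is still missing.\<close>

lemma bar_lower:
  assumes K: "opt_hex (6 * r + 7) K" and M: "opt_hex (6 * r + 8) M" and Y: "K \<subseteq> Y" "Y \<subset> M"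
  shows "J * real (6 * r + 7) - h * real (max_area (6 * r + 7)) + slack \<le> energy J h Y"
proof (cases "Y = K")
  case True
  have "energy J h K = J * real (6 * r + 7) - h * real (max_area (6 * r + 7))"
    using opt_hex_size[OF _ K] by (simp add: energy_def)
  then show ?thesis using True by (simp add: slack_def)
next
  case False
  have finM: "finite M" using opt_hex_finite[OF M] .
  have finY: "finite Y" using finM Y(2) finite_subset by blast
  have "card K < card Y" using finY Y(1) False by (intro psubset_card_mono) auto
  then have c1: "max_area (6 * r + 7) < card Y" using opt_hex_size[OF _ K] by simp
  have "card Y < card M" using finM Y(2) by (intro psubset_card_mono)
  then have c2: "card Y \<le> max_area (6 * r + 7) + 2 * r + 2" using opt_hex_size[OF _ M] max_area_KM by simp
  have "6 * r + 8 \<le> per Y"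
  proof (rule ccontr)
    assume "\<not> ?thesis"
    then have "max_area (per Y) \<le> max_area (6 * r + 7)" by (intro max_area_mono) simp
    then show False using card_le_per[OF finY] c1 by linarith
  qed
  then have "J * real (6 * r + 8) \<le> J * real (per Y)" using J_bounds(4) by simp
  moreover have "h * real (card Y) \<le> h * real (max_area (6 * r + 7) + 2 * r + 2)" using c2 h_pos by simp
  ultimately have "J * real (6 * r + 7) - h * real (max_area (6 * r + 7)) + (J - h * (2 * real r + 2)) \<le> energy J h Y"
    unfolding energy_def by (simp add: algebra_simps)
  then show ?thesis by (simp add: slack_def min_def)
qed

text \<open>The droplets that cannot grow by absorbing a further bar.\<close>

definition bar_closed :: "face set \<Rightarrow> bool" where
  "bar_closed X \<longleftrightarrow> (\<forall>K M. opt_hex (6 * r + 7) K \<longrightarrow> opt_hex (6 * r + 8) M \<longrightarrow> K \<subseteq> M \<longrightarrow> proj L ` K \<subseteq> X \<longrightarrow> proj L ` M \<subseteq> X)"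

text \<open>The planar path from \<open>K\<close> to \<open>M\<close> is replayed on top of
  \<open>X\<close>. By submodularity the union costs at most \<open>X\<close> plus the bar minus
  their overlap, and the overlap is an unfinished bar above \<open>K\<close>, so
  \<open>bar_lower\<close> applies.\<close>

lemma add_bar:
  assumes X: "X \<subseteq> Lam L" "energyT J h L X \<le> J * real (6 * r + 8) - h * real (max_area (6 * r + 8))"
    and K: "opt_hex (6 * r + 7) K" and M: "opt_hex (6 * r + 8) M" and KM: "K \<subseteq> M"
    and KX: "proj L ` K \<subseteq> X" and MX: "\<not> proj L ` M \<subseteq> X"
  shows "(X, X \<union> proj L ` M) \<in> (reachT J h L crit_energy)\<^sup>*"
    "energyT J h L (X \<union> proj L ` M) \<le> energyT J h L X"
proof -
  define EK where "EK = J * real (6 * r + 7) - h * real (max_area (6 * r + 7))"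
  define EM where "EM = J * real (6 * r + 8) - h * real (max_area (6 * r + 8))"
  note marg = energy_margin[folded EK_def EM_def]
  \<comment> \<open>The height available to the planar path, as \<open>X\<close> costs at most
    \<open>EM\<close> and the overlap at least \<open>EK + slack\<close>.\<close>
  define C where "C = crit_energy - EM + EK + slack"
  have finM: "finite M" using opt_hex_finite[OF M] .
  have finX: "finite X" using X(1) finite_Lam finite_subset by blast
  have fM: "fits (L - 1) M" using opt_fits[OF M] by simp
  have union: "energyT J h L (X \<union> proj L ` Y) \<le> energyT J h L X + energy J h Y - EK - slack"
    if Y: "K \<subseteq> Y" "Y \<subseteq> M" for Y
  proof -
    define Y' where "Y' = {f \<in> Y. proj L f \<in> X}"
    have "X \<inter> proj L ` Y = proj L ` Y'" by (auto simp: Y'_def)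
    moreover have "K \<subseteq> Y'" using Y(1) KX by (auto simp: Y'_def)
    moreover have "Y' \<subset> M"
    proof
      show "Y' \<subseteq> M" using Y(2) by (auto simp: Y'_def)
      show "Y' \<noteq> M" using MX unfolding Y'_def by (metis (no_types, lifting) image_subset_iff mem_Collect_eq)
    qed
    then have e: "EK + slack \<le> energy J h Y'"
      using bar_lower[OF K M] \<open>K \<subseteq> Y'\<close> unfolding EK_def by blast
    have finY: "finite Y" "finite Y'" using Y(2) \<open>Y' \<subset> M\<close> finM finite_subset by blast+
    have "energyT J h L (proj L ` Y') = energy J h Y'"
      using energyT_proj[OF fits_mono[OF fM] finY(2)] \<open>Y' \<subset> M\<close> by blast
    moreover have "energyT J h L (proj L ` Y) = energy J h Y"
      using energyT_proj[OF fits_mono[OF fM Y(2)] finY(1)] .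
    moreover have "energyT J h L (X \<union> proj L ` Y) + energyT J h L (X \<inter> proj L ` Y) \<le> energyT J h L X + energyT J h L (proj L ` Y)"
      using energyT_submodular[OF finX _ J_bounds(4)] finY(1) by blast
    ultimately show ?thesis using e \<open>X \<inter> proj L ` Y = proj L ` Y'\<close> by simp
  qed
  have eM: "energy J h M = EM" using opt_hex_size[OF _ M] by (simp add: energy_def EM_def)
  show "energyT J h L (X \<union> proj L ` M) \<le> energyT J h L X"
    using union[OF KM subset_refl] eM marg(2) by linarith
  have C: "J * (real (6 * r + 7) + 2) - h * (real (max_area (6 * r + 7)) + 2) < C"
    using marg(1) unfolding C_def EK_def by (simp add: algebra_simps)
  have "(K, M) \<in> (reach_rel J h C K M)\<^sup>*"
    by (rule opt_reach[OF _ K _ KM h_pos J_bounds(3) C]) (use M in \<open>simp_all add: eval_nat_numeral\<close>)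
  then have "(X \<union> proj L ` K, X \<union> proj L ` M) \<in> (reachT J h L crit_energy)\<^sup>*"
  proof (induction rule: rtrancl_induct)
    case base
    then show ?case by simp
  next
    case (step Y Z)
    have YZ: "K \<subseteq> Y" "Y \<subseteq> M" "K \<subseteq> Z" "Z \<subseteq> M" "energy J h Y < C" "energy J h Z < C"
      "\<exists>f. f \<notin> Y \<and> Z = insert f Y \<or> f \<notin> Z \<and> Y = insert f Z"
      using step(2) unfolding reach_rel_def by blast+
    have lt: "energyT J h L (X \<union> proj L ` V) < crit_energy" if "K \<subseteq> V" "V \<subseteq> M" "energy J h V < C" for V
      using union[OF that(1,2)] that(3) X(2) unfolding C_def EM_def by linarith
    have sub: "X \<union> proj L ` V \<subseteq> Lam L" for V using X(1) proj_in_Lam[OF L_pos] by blast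
    obtain f where f: "f \<notin> Y \<and> Z = insert f Y \<or> f \<notin> Z \<and> Y = insert f Z" using YZ(7) by blast
    \<comment> \<open>A planar step within the part already covered by \<open>X\<close> becomes
      invisible.\<close>
    have "X \<union> proj L ` Y = X \<union> proj L ` Z \<or> (X \<union> proj L ` Y, X \<union> proj L ` Z) \<in> reachT J h L crit_energy"
    proof (cases "X \<union> proj L ` Y = X \<union> proj L ` Z")
      case False
      have "proj L f \<notin> X \<union> proj L ` Y \<and> X \<union> proj L ` Z = insert (proj L f) (X \<union> proj L ` Y) \<or>
        proj L f \<notin> X \<union> proj L ` Z \<and> X \<union> proj L ` Y = insert (proj L f) (X \<union> proj L ` Z)"
        using f False by (metis Un_insert_right image_insert insert_absorb)
      then show ?thesis
        using reachT_I[OF sub sub lt[OF YZ(1,2,5)] lt[OF YZ(3,4,6)]] by blast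
    qed simp
    then show ?case using step(3) by (metis rtrancl.rtrancl_into_rtrancl)
  qed
  moreover have "X \<union> proj L ` K = X" using KX by blast
  ultimately show "(X, X \<union> proj L ` M) \<in> (reachT J h L crit_energy)\<^sup>*" by simp
qed

text \<open>Removing one bar from \<open>mx\<close>, \<open>my\<close> or \<open>mz\<close> at \<open>(i, j)\<close> leaves a hexagon of perimeter \<open>6 r + 7\<close> contained in another of these shapes,
  so a closed set containing one of them contains all translates.\<close>

definition mx :: "int \<Rightarrow> int \<Rightarrow> face set" where
  "mx i j = hexa i (i + 2 * int r + 1) j (j + 2 * int r + 2) (- 3 * int r - 3 - i - j) (- int r - 1 - i - j)"
definition my :: "int \<Rightarrow> int \<Rightarrow> face set" where
  "my i j = hexa i (i + 2 * int r + 2) j (j + 2 * int r + 1) (- 3 * int r - 3 - i - j) (- int r - 1 - i - j)"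
definition mz :: "int \<Rightarrow> int \<Rightarrow> face set" where
  "mz i j = hexa i (i + 2 * int r + 2) j (j + 2 * int r + 2) (- 3 * int r - 3 - i - j) (- int r - 2 - i - j)"

lemma closed_move:
  assumes "bar_closed X" "proj L ` A \<subseteq> X" "opt_params (6 * r + 7) x0 x1 y0 y1 z0 z1"
    "hexa x0 x1 y0 y1 z0 z1 \<subseteq> A" "hexa x0 x1 y0 y1 z0 z1 \<subseteq> B" "opt_hex (6 * r + 8) B"
  shows "proj L ` B \<subseteq> X"
proof -
  have "opt_hex (6 * r + 7) (hexa x0 x1 y0 y1 z0 z1)" using assms(3) unfolding opt_hex_def by blast
  moreover have "proj L ` hexa x0 x1 y0 y1 z0 z1 \<subseteq> X" using assms(2,4) by blast
  ultimately show ?thesis using assms(1,5,6) unfolding bar_closed_def by blast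
qed

lemma opt_m: "opt_hex (6 * r + 8) (mx i j)" "opt_hex (6 * r + 8) (my i j)" "opt_hex (6 * r + 8) (mz i j)"
proof -
  have I: "opt_params n x0 x1 y0 y1 z0 z1 \<Longrightarrow> opt_hex n (hexa x0 x1 y0 y1 z0 z1)" for n x0 x1 y0 y1 z0 z1
    unfolding opt_hex_def by blast
  show "opt_hex (6 * r + 8) (mx i j)" unfolding mx_def by (rule I) (simp add: opt_params_def)
  show "opt_hex (6 * r + 8) (my i j)" unfolding my_def by (rule I) (simp add: opt_params_def)
  show "opt_hex (6 * r + 8) (mz i j)" unfolding mz_def by (rule I) (simp add: opt_params_def)
qed

lemma closed_moves:
  assumes c: "bar_closed X"
  shows "proj L ` my i j \<subseteq> X \<Longrightarrow> proj L ` mx i j \<subseteq> X" "proj L ` mz i j \<subseteq> X \<Longrightarrow> proj L ` mx i j \<subseteq> X"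
    "proj L ` mx i j \<subseteq> X \<Longrightarrow> proj L ` my i j \<subseteq> X" "proj L ` mx i j \<subseteq> X \<Longrightarrow> proj L ` mz i j \<subseteq> X"
    "proj L ` mx i j \<subseteq> X \<Longrightarrow> proj L ` my (i - 1) (j + 1) \<subseteq> X" "proj L ` my i j \<subseteq> X \<Longrightarrow> proj L ` mx (i + 1) (j - 1) \<subseteq> X"
    "proj L ` mx i j \<subseteq> X \<Longrightarrow> proj L ` mz (i - 1) j \<subseteq> X" "proj L ` mz i j \<subseteq> X \<Longrightarrow> proj L ` mx (i + 1) j \<subseteq> X"
proof -
  let ?R = "int r"
  note I = closed_move[OF c]
  \<comment> \<open>The parameters given in each case are those of the intersection of the two
    shapes.\<close>
  show "proj L ` mx i j \<subseteq> X" if "proj L ` my i j \<subseteq> X"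
    by (rule I[OF that _ _ _ opt_m(1), of i "i + 2 * ?R + 1" j "j + 2 * ?R + 1" "- 3 * ?R - 3 - i - j" "- ?R - 1 - i - j"])
      (auto simp: opt_params_def mx_def my_def)
  show "proj L ` my i j \<subseteq> X" if "proj L ` mx i j \<subseteq> X"
    by (rule I[OF that _ _ _ opt_m(2), of i "i + 2 * ?R + 1" j "j + 2 * ?R + 1" "- 3 * ?R - 3 - i - j" "- ?R - 1 - i - j"])
      (auto simp: opt_params_def mx_def my_def)
  show "proj L ` mx i j \<subseteq> X" if "proj L ` mz i j \<subseteq> X"
    by (rule I[OF that _ _ _ opt_m(1), of i "i + 2 * ?R + 1" j "j + 2 * ?R + 2" "- 3 * ?R - 3 - i - j" "- ?R - 2 - i - j"])
      (auto simp: opt_params_def mx_def mz_def)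
  show "proj L ` mz i j \<subseteq> X" if "proj L ` mx i j \<subseteq> X"
    by (rule I[OF that _ _ _ opt_m(3), of i "i + 2 * ?R + 1" j "j + 2 * ?R + 2" "- 3 * ?R - 3 - i - j" "- ?R - 2 - i - j"])
      (auto simp: opt_params_def mx_def mz_def)
  show "proj L ` my (i - 1) (j + 1) \<subseteq> X" if "proj L ` mx i j \<subseteq> X"
    by (rule I[OF that _ _ _ opt_m(2), of i "i + 2 * ?R + 1" "j + 1" "j + 2 * ?R + 2" "- 3 * ?R - 3 - i - j" "- ?R - 1 - i - j"])
      (auto simp: opt_params_def mx_def my_def)
  show "proj L ` mx (i + 1) (j - 1) \<subseteq> X" if "proj L ` my i j \<subseteq> X"
    by (rule I[OF that _ _ _ opt_m(1), of "i + 1" "i + 2 * ?R + 2" j "j + 2 * ?R + 1" "- 3 * ?R - 3 - i - j" "- ?R - 1 - i - j"])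
      (auto simp: opt_params_def mx_def my_def)
  show "proj L ` mz (i - 1) j \<subseteq> X" if "proj L ` mx i j \<subseteq> X"
    by (rule I[OF that _ _ _ opt_m(3), of i "i + 2 * ?R + 1" j "j + 2 * ?R + 2" "- 3 * ?R - 2 - i - j" "- ?R - 1 - i - j"])
      (auto simp: opt_params_def mx_def mz_def)
  show "proj L ` mx (i + 1) j \<subseteq> X" if "proj L ` mz i j \<subseteq> X"
    by (rule I[OF that _ _ _ opt_m(1), of "i + 1" "i + 2 * ?R + 2" j "j + 2 * ?R + 2" "- 3 * ?R - 3 - i - j" "- ?R - 2 - i - j"])
      (auto simp: opt_params_def mx_def mz_def)
qed

text \<open>Two moves composed translate \<open>mx\<close> by one step, forwards or backwards, in
  two independent directions. So all translates are absorbed, and they cover the torus.\<close>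

lemma closed_full:
  assumes c: "bar_closed X" and M: "opt_hex (6 * r + 8) M" "proj L ` M \<subseteq> X"
  shows "Lam L \<subseteq> X"
proof -
  note mv = closed_moves[OF c]
  have "\<exists>i j. proj L ` mx i j \<subseteq> X"
  proof -
    from M(1) obtain x0 x1 y0 y1 z0 z1 where p: "opt_params (6 * r + 8) x0 x1 y0 y1 z0 z1" "M = hexa x0 x1 y0 y1 z0 z1"
      by (rule opt_hexE)
    let ?R = "int r"
    define dx dy dz where "dx = x1 - x0" and "dy = y1 - y0" and "dz = z1 - z0"
    have d: "dx + dy + dz = 6 * ?R + 5" "\<bar>dx - dy\<bar> \<le> 1" "\<bar>dy - dz\<bar> \<le> 1" "\<bar>dz - dx\<bar> \<le> 1"
      using p(1) by (auto simp: opt_params_def dx_def dy_def dz_def)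
    \<comment> \<open>The perimeter is even, so the centring condition has the single value
      zero.\<close>
    have "2 * (x0 + y0 + z0) + 6 * ?R + 6 = 0"
      using p(1) unfolding opt_params_def of_nat_add of_nat_mult of_nat_numeral by (smt (z3))
    then have z: "z0 = - 3 * ?R - 3 - x0 - y0" by presburger
    have "(dx = 2 * ?R + 1 \<and> dy = 2 * ?R + 2 \<and> dz = 2 * ?R + 2) \<or> (dx = 2 * ?R + 2 \<and> dy = 2 * ?R + 1 \<and> dz = 2 * ?R + 2) \<or>
      (dx = 2 * ?R + 2 \<and> dy = 2 * ?R + 2 \<and> dz = 2 * ?R + 1)"
      using d by (smt (z3))
    then have "M = mx x0 y0 \<or> M = my x0 y0 \<or> M = mz x0 y0"
    proof (elim disjE conjE)
      assume "dx = 2 * ?R + 1" "dy = 2 * ?R + 2" "dz = 2 * ?R + 2"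
      then have "x1 = x0 + 2 * ?R + 1" "y1 = y0 + 2 * ?R + 2" "z1 = - ?R - 1 - x0 - y0" using z by (simp_all add: dx_def dy_def dz_def)
      then show ?thesis unfolding p(2) mx_def z by simp
    next
      assume "dx = 2 * ?R + 2" "dy = 2 * ?R + 1" "dz = 2 * ?R + 2"
      then have "x1 = x0 + 2 * ?R + 2" "y1 = y0 + 2 * ?R + 1" "z1 = - ?R - 1 - x0 - y0" using z by (simp_all add: dx_def dy_def dz_def)
      then show ?thesis unfolding p(2) my_def z by simp
    next
      assume "dx = 2 * ?R + 2" "dy = 2 * ?R + 2" "dz = 2 * ?R + 1"
      then have "x1 = x0 + 2 * ?R + 2" "y1 = y0 + 2 * ?R + 2" "z1 = - ?R - 2 - x0 - y0" using z by (simp_all add: dx_def dy_def dz_def)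
      then show ?thesis unfolding p(2) mz_def z by simp
    qed
    then have "proj L ` mx x0 y0 \<subseteq> X"
    proof (elim disjE)
      assume "M = mx x0 y0" then show ?thesis using M(2) by simp
    next
      assume "M = my x0 y0" then show ?thesis using M(2) mv(1) by simp
    next
      assume "M = mz x0 y0" then show ?thesis using M(2) mv(2) by simp
    qed
    then show ?thesis by (intro exI)
  qed
  then obtain i0 j0 where start: "proj L ` mx i0 j0 \<subseteq> X" by blast
  have t: "proj L ` mx (i + 1) j \<subseteq> X" "proj L ` mx (i - 1) j \<subseteq> X"
    "proj L ` mx (i + 1) (j - 1) \<subseteq> X" "proj L ` mx (i - 1) (j + 1) \<subseteq> X" if "proj L ` mx i j \<subseteq> X" for i j
    using mv(8)[OF mv(4)[OF that]] mv(2)[OF mv(7)[OF that]] mv(6)[OF mv(3)[OF that]] mv(1)[OF mv(5)[OF that]] by blast+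
  have row: "proj L ` mx i j0 \<subseteq> X" for i
  proof (induction i rule: int_induct[of _ i0])
    case base
    then show ?case using start .
  next
    case (step1 i)
    then show ?case using t(1) by blast
  next
    case (step2 i)
    then show ?case using t(2) by blast
  qed
  have all: "proj L ` mx i j \<subseteq> X" for i j
  proof (induction j arbitrary: i rule: int_induct[of _ j0])
    case base
    then show ?case using row .
  next
    case (step1 j)
    have "i + 1 - 1 = i" by simp
    then show ?case using t(4)[OF step1(2)[of "i + 1"]] by metis
  next
    case (step2 j)
    have "i - 1 + 1 = i" by simp
    then show ?case using t(3)[OF step2(2)[of "i - 1"]] by metis
  qed
  show ?thesis
  proof
    fix f assume f: "f \<in> Lam L"
    obtain a b u where abu: "f = (a, b, u)" by (cases f)
    have "f \<in> mx a (b - 2 * int r - 2)" unfolding abu mx_def by (cases u) auto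
    then have "proj L f \<in> X" using all by blast
    then show "f \<in> X" using f by simp
  qed
qed

text \<open>A reachable droplet of maximal area is closed under absorbing bars, hence full; this
  replaces an explicit order of absorption. Between absorptions the energy stays at most that of
  \<open>M\<close>.\<close>

lemma grow_to_full:
  assumes M: "opt_hex (6 * r + 8) M"
  shows "(proj L ` M, Lam L) \<in> (reachT J h L crit_energy)\<^sup>*"
proof -
  let ?E = "J * real (6 * r + 8) - h * real (max_area (6 * r + 8))"
  define S where "S = {X. (proj L ` M, X) \<in> (reachT J h L crit_energy)\<^sup>* \<and> proj L ` M \<subseteq> X \<and> X \<subseteq> Lam L \<and> energyT J h L X \<le> ?E}"
  have MLam: "proj L ` M \<subseteq> Lam L" using proj_in_Lam[OF L_pos] by blast
  have "energyT J h L (proj L ` M) = ?E" using energyT_opt[OF M] by simp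
  then have ne: "proj L ` M \<in> S" using MLam by (simp add: S_def)
  have "S \<subseteq> Pow (Lam L)" by (auto simp: S_def)
  then have finS: "finite S" using finite_Lam by (meson finite_Pow_iff finite_subset)
  then have "Max (card ` S) \<in> card ` S" using ne by (intro Max_in) auto
  then obtain X where X: "X \<in> S" "card X = Max (card ` S)" by auto
  have XL: "X \<subseteq> Lam L" using X(1) by (simp add: S_def)
  have finX: "finite X" using XL finite_Lam finite_subset by blast
  have "bar_closed X"
    unfolding bar_closed_def
  proof (intro allI impI)
    fix K M' assume K: "opt_hex (6 * r + 7) K" and M': "opt_hex (6 * r + 8) M'" "K \<subseteq> M'" and KX: "proj L ` K \<subseteq> X"
    show "proj L ` M' \<subseteq> X"
    proof (rule ccontr)
      assume n: "\<not> proj L ` M' \<subseteq> X"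
      have "energyT J h L X \<le> ?E" using X(1) by (simp add: S_def)
      note ab = add_bar[OF XL this K M' KX n]
      have "X \<union> proj L ` M' \<in> S"
        using X(1) ab proj_in_Lam[OF L_pos] unfolding S_def by (auto intro: rtrancl_trans)
      then have "card (X \<union> proj L ` M') \<le> card X" unfolding X(2) using finS by (intro Max_ge) auto
      moreover have "card X < card (X \<union> proj L ` M')"
        using n finX opt_hex_finite[OF M'(1)] by (intro psubset_card_mono) auto
      ultimately show False by simp
    qed
  qed
  moreover have "proj L ` M \<subseteq> X" using X(1) by (simp add: S_def)
  ultimately have "X = Lam L" using closed_full[OF _ M] XL by blast
  then show ?thesis using X(1) by (simp add: S_def)
qed

text \<open>If \<open>p = 6 r + 5\<close>, two further bars have to be completed before absorption
  can start.\<close>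

lemma grow_from_supercritical:
  assumes M: "opt_hex (Suc p) M"
  shows "(proj L ` M, Lam L) \<in> (reachT J h L crit_energy)\<^sup>*"
proof -
  consider (1) "p = 6 * r + 5" "max_area p = 6 * r * r + 10 * r + 3" "J < h * (2 * real r + 2)" | (2) "p = 6 * r + 7"
    using cases_rp area_forms by (elim disjE) simp_all
  then show ?thesis
  proof cases
    case 1
    have s6: "Suc p = 6 * r + 6" using 1(1) by simp
    have M6: "opt_hex (6 * r + 6) M" using M unfolding s6 .
    obtain K where K: "opt_hex (Suc (6 * r + 6)) K" "M \<subseteq> K" using opt_hex_grow[OF M6] .
    obtain N where N: "opt_hex (Suc (Suc (6 * r + 6))) N" "K \<subseteq> N" using opt_hex_grow[OF K(1)] .
    have hr: "0 \<le> h * real r" using h_pos by simp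
    have c1: "J * (real (6 * r + 6) + 2) - h * (real (max_area (6 * r + 6)) + 2) < crit_energy"
      unfolding crit_energy_def unfolding 1(2) unfolding 1(1) max_area_mod6_pred using 1(3) h_pos hr by (simp add: algebra_simps)
    have s7: "Suc (6 * r + 6) = 6 * r + 7" "Suc (Suc (6 * r + 6)) = 6 * r + 8" by simp_all
    \<comment> \<open>This peak minus the critical energy is \<open>2 J - h (4 r + 4)\<close>,
      negative because \<open>J < h (2 r + 2)\<close>.\<close>
    have c2: "J * (real (Suc (6 * r + 6)) + 2) - h * (real (max_area (Suc (6 * r + 6))) + 2) < crit_energy"
      unfolding s7 crit_energy_def unfolding 1(2) unfolding 1(1) max_area_mod6_pred using 1(3) h_pos hr by (simp add: algebra_simps)
    have "(M, K) \<in> (reach_rel J h crit_energy M K)\<^sup>*"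
      by (rule opt_reach[OF _ M6 K h_pos J_bounds(3) c1]) simp
    then have "(proj L ` M, proj L ` K) \<in> (reachT J h L crit_energy)\<^sup>*"
      using reach_to_torus[OF opt_fits[OF K(1)] opt_hex_finite[OF K(1)] L_pos] by simp
    moreover have "(K, N) \<in> (reach_rel J h crit_energy K N)\<^sup>*"
      by (rule opt_reach[OF _ K(1) N h_pos J_bounds(3) c2]) simp
    then have "(proj L ` K, proj L ` N) \<in> (reachT J h L crit_energy)\<^sup>*"
      using reach_to_torus[OF opt_fits[OF N(1)] opt_hex_finite[OF N(1)] L_pos] by simp
    moreover have "(proj L ` N, Lam L) \<in> (reachT J h L crit_energy)\<^sup>*"
      by (rule grow_to_full) (use N(1) in \<open>simp only: s7(2)\<close>)
    ultimately show ?thesis by (meson rtrancl_trans)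
  next
    case 2
    have "Suc p = 6 * r + 8" using 2 by simp
    then show ?thesis using M by (intro grow_to_full) (simp only:)
  qed
qed

end

section \<open>Paths with a single highest point\<close>

context hex_bar
begin

text \<open>\<open>V1\<close> keeps a face attached to \<open>P\<close>, \<open>V2\<close> has all
  three consecutive faces. Both have perimeter \<open>per P + 1\<close> and lie strictly below the
  gate, by \<open>J - h\<close> and \<open>J + h\<close>.\<close>

lemma gate_sets_neighbours:
  assumes V: "V \<in> gate_sets" and h: "0 < h" "h < J"
  obtains V1 V2 where "V \<subseteq> H" "finite V" "per V = per P + 2" "card V = card P + 2" "adj1 V1 V" "adj1 V V2"
    "(P, V1) \<in> (reach_rel J h (J * (real (per P) + 2) - h * (real (card P) + 2)) P H)\<^sup>*"
    "(V2, H) \<in> (reach_rel J h (J * (real (per P) + 2) - h * (real (card P) + 2)) P H)\<^sup>*"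
    "P \<subseteq> V1" "V1 \<subseteq> H" "V2 \<subseteq> H"
    "energy J h V1 < J * (real (per P) + 2) - h * (real (card P) + 2)"
    "energy J h V2 < J * (real (per P) + 2) - h * (real (card P) + 2)"
proof -
  let ?C = "J * (real (per P) + 2) - h * (real (card P) + 2)"
  obtain R x where R: "V = P \<union> R" "lft \<le> x" "x < x1"
    "R = {tt x, uu (x + 1)} \<or> R = {tt (x + 1), uu (x + 1)} \<or> R = {tt x, tt (x + 1)}"
    using V unfolding gate_sets_def by blast
  have x: "x \<le> x1" "lft \<le> x + 1" "x + 1 \<le> x1" "x \<le> x + 1" using R by simp_all
  let ?V2 = "seg x (x + 1)"
  have s2: "?V2 = P \<union> {tt x, uu (x + 1), tt (x + 1)}"
    using seg_right[of x x] unfolding seg_single by auto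
  have sz2: "per ?V2 = per P + 1" "card ?V2 = card P + 3" using seg_size[OF x(4) R(2) x(3)] by simp_all
  have e2: "energy J h ?V2 < ?C" using h unfolding energy_def sz2 by (simp add: algebra_simps)
  have r2: "(?V2, H) \<in> (reach_rel J h ?C P H)\<^sup>*"
    by (rule reach_seg[OF h R(2) x(4,3)]) (use h in \<open>simp add: algebra_simps\<close>)
  have V2H: "?V2 \<subseteq> H" using seg_subset(1)[OF R(2) x(3)] .
  have sing: "(P, insert (tt v) P) \<in> (reach_rel J h ?C P H)\<^sup>*" "insert (tt v) P \<subseteq> H" "P \<subseteq> insert (tt v) P"
    "energy J h (insert (tt v) P) < ?C" if "lft \<le> v" "v \<le> x1" for v
  proof -
    have rs: "(P, insert (tt v) P) \<in> reach_rel J h ?C P H" using reach_single[OF h that] by simp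
    then show "(P, insert (tt v) P) \<in> (reach_rel J h ?C P H)\<^sup>*" by blast
    show "insert (tt v) P \<subseteq> H" "P \<subseteq> insert (tt v) P" "energy J h (insert (tt v) P) < ?C"
      using rs by (simp_all only: reach_rel_def mem_Collect_eq prod.case)
  qed
  have "R \<subseteq> {tt x, uu (x + 1), tt (x + 1)}"
    using R(4) by (elim disjE) (simp_all only: insert_subset insert_iff empty_subsetI simp_thms)
  then have "V \<subseteq> ?V2" unfolding R(1) s2 by (rule Un_mono[OF order_refl])
  then have VH: "V \<subseteq> H" using V2H by (rule order_trans)
  have finV: "finite V" using R(4) unfolding R(1) by auto
  from R(4) have "per V = per P + 2 \<and> card V = card P + 2 \<and> (\<exists>v. lft \<le> v \<and> v \<le> x1 \<and> adj1 (insert (tt v) P) V) \<and> adj1 V ?V2"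
  proof (elim disjE)
    assume r: "R = {tt x, uu (x + 1)}"
    have eq: "V = insert (uu (x + 1)) (seg x x)" unfolding R(1) r seg_single by auto
    have "adj1 (insert (tt x) P) V" unfolding eq seg_single adj1_def by (intro exI[of _ "uu (x + 1)"]) simp
    moreover have "adj1 V ?V2" unfolding adj1_def s2 R(1) r by (intro exI[of _ "tt (x + 1)"]) (auto simp del: split_paired_Ex)
    moreover have "per V = per P + 2 \<and> card V = card P + 2"
      using step_right(1,2)[of x x] R(2,3) x seg_size[of x x] unfolding eq by simp
    ultimately show ?thesis using R(2) x(1) by (intro conjI exI[of _ x]) simp_all
  next
    assume r: "R = {tt (x + 1), uu (x + 1)}"
    have eq: "V = insert (uu (x + 1)) (seg (x + 1) (x + 1))" unfolding R(1) r seg_single by auto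
    have "adj1 (insert (tt (x + 1)) P) V" unfolding eq seg_single adj1_def by (intro exI[of _ "uu (x + 1)"]) simp
    moreover have "adj1 V ?V2" unfolding adj1_def s2 R(1) r by (intro exI[of _ "tt x"]) (auto simp del: split_paired_Ex)
    moreover have "per V = per P + 2 \<and> card V = card P + 2"
      using step_left(1,2)[of "x + 1" "x + 1"] R(2,3) x seg_size[of "x + 1" "x + 1"] unfolding eq by simp
    ultimately show ?thesis using x(2,3) by (intro conjI exI[of _ "x + 1"]) simp_all
  next
    assume r: "R = {tt x, tt (x + 1)}"
    have eq: "V = insert (tt (x + 1)) (P \<union> {tt x})" unfolding R(1) r by auto
    have 1: "per (insert (tt (x + 1)) (P \<union> {tt x})) + 2 * (of_bool (uu (x + 1 + 1) \<in> {tt x}) + of_bool (uu (x + 1) \<in> {tt x})) = per (P \<union> {tt x}) + 1"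
      "card (insert (tt (x + 1)) (P \<union> {tt x})) = card (P \<union> {tt x}) + 1"
      by (rule per_insert_tt[OF x(2,3)]; (elim insertE emptyE)?; simp)+
    have "adj1 (insert (tt x) P) V" unfolding eq adj1_def by (intro exI[of _ "tt (x + 1)"]) simp
    moreover have "adj1 V ?V2" unfolding adj1_def s2 R(1) r by (intro exI[of _ "uu (x + 1)"]) (auto simp del: split_paired_Ex)
    moreover have "per V = per P + 2 \<and> card V = card P + 2"
      using 1 per_single[OF R(2) x(1)] unfolding eq by simp
    ultimately show ?thesis using R(2) x(1) by (intro conjI exI[of _ x]) simp_all
  qed
  then obtain v where v: "per V = per P + 2" "card V = card P + 2" "lft \<le> v" "v \<le> x1" "adj1 (insert (tt v) P) V" "adj1 V ?V2"
    by blast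
  show thesis
    by (rule that[OF VH finV v(1,2,5,6) sing(1)[OF v(3,4)] r2 sing(3,2)[OF v(3,4)] V2H sing(4)[OF v(3,4)] e2])
qed

end

lemma adj1_image:
  assumes "inj_on \<phi> U" "V \<subseteq> U" "W \<subseteq> U" "adj1 V W"
  shows "adj1 (\<phi> ` V) (\<phi> ` W)"
proof -
  obtain f where f: "f \<notin> V \<and> W = insert f V \<or> f \<notin> W \<and> V = insert f W" using assms(4) unfolding adj1_def by blast
  then have "f \<in> U" using assms(2,3) by blast
  then have "\<phi> f \<in> \<phi> ` S \<longleftrightarrow> f \<in> S" if "S \<subseteq> U" for S using inj_on_image_mem_iff[OF assms(1) _ that] by blast
  then have "\<phi> f \<notin> \<phi> ` V \<and> \<phi> ` W = insert (\<phi> f) (\<phi> ` V) \<or> \<phi> f \<notin> \<phi> ` W \<and> \<phi> ` V = insert (\<phi> f) (\<phi> ` W)"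
    using f assms(2,3) by (metis image_insert)
  then show ?thesis unfolding adj1_def by blast
qed

context crit
begin

lemma gate_shape_path:
  assumes W: "gate_shape p W"
  obtains B1 B2 where "finite W" "fits (L - 1) W" "energyT J h L (proj L ` W) = crit_energy"
    "({}, B1) \<in> (reachT J h L crit_energy)\<^sup>*" "(B2, Lam L) \<in> (reachT J h L crit_energy)\<^sup>*"
    "adj1 B1 (proj L ` W)" "adj1 (proj L ` W) B2" "B1 \<subseteq> Lam L" "B2 \<subseteq> Lam L" "energyT J h L B2 < crit_energy"
proof -
  obtain \<phi> x0 x1 y0 y1 z0 z1 V where \<phi>: "lat_face \<phi>" and hb: "hex_bar p x0 x1 y0 y1 z0 z1"
    and V: "V \<in> hex_bar.gate_sets x0 x1 y0 y1 z0 z1" and WV: "W = \<phi> ` V"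
    using W unfolding gate_shape_def by (elim exE conjE)
  interpret hex_bar p x0 x1 y0 y1 z0 z1 by (rule hb)
  have sP: "per P = p" "card P = max_area p" using opt_hex_p[OF opt_hex_PH(1)] by simp_all
  have C: "J * (real (per P) + 2) - h * (real (card P) + 2) = crit_energy"
    unfolding crit_energy_def sP by simp
  obtain V1 V2 where n: "V \<subseteq> H" "finite V" "per V = per P + 2" "card V = card P + 2" "adj1 V1 V" "adj1 V V2"
    "(P, V1) \<in> (reach_rel J h crit_energy P H)\<^sup>*" "(V2, H) \<in> (reach_rel J h crit_energy P H)\<^sup>*"
    "P \<subseteq> V1" "V1 \<subseteq> H" "V2 \<subseteq> H" "energy J h V1 < crit_energy" "energy J h V2 < crit_energy"
    by (rule gate_sets_neighbours[OF V h_pos J_bounds(3), unfolded C])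
  have iso: "face_iso \<phi>" using lat_face_iso[OF \<phi>] .
  have finH: "finite H" using opt_hex_finite[OF opt_hex_PH(2)] .
  have p5: "5 \<le> p" "5 \<le> Suc p" using p_facts(3) by simp_all
  have oP: "opt_hex p (\<phi> ` P)" using opt_hex_image[OF p5(1) opt_hex_PH(1) iso] .
  have oH: "opt_hex (Suc p) (\<phi> ` H)" using opt_hex_image[OF p5(2) opt_hex_PH(2) iso] .
  have fH: "fits (L - 1) (\<phi> ` H)" using opt_fits[OF oH p_le] .
  have fin: "finite (\<phi> ` S)" "fits (L - 1) (\<phi> ` S)" if "S \<subseteq> H" for S
    using finite_subset[OF that finH] fits_mono[OF fH image_mono[OF that]] by blast+
  have eS: "energyT J h L (proj L ` \<phi> ` S) = energy J h S" if "S \<subseteq> H" for S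
    using energyT_proj[OF fin(2,1)[OF that]] face_iso_per[OF iso finite_subset[OF that finH]] face_iso_card[OF iso]
    by (simp add: energy_def)
  have lift: "(proj L ` \<phi> ` S, proj L ` \<phi> ` T) \<in> (reachT J h L crit_energy)\<^sup>*"
    if "(S, T) \<in> (reach_rel J h crit_energy P H)\<^sup>*" for S T
    using reach_to_torus[OF fH _ L_pos reach_rel_iso[OF iso finH that]] finH by blast
  have inj: "inj_on (\<lambda>f. proj L (\<phi> f)) H"
  proof -
    have "inj_on (proj L) (\<phi> ` H)" using fits_inj[OF fits_weaken[OF fH, of L]] by simp
    moreover have "inj_on \<phi> H" using inj_on_subset[OF face_iso_inj[OF iso]] by blast
    ultimately show ?thesis using comp_inj_on[of \<phi> H "proj L"] by (simp add: comp_def)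
  qed
  have PH: "P \<subseteq> H" using n(9,10) by blast
  show thesis
  proof (rule that)
    show "finite W" "fits (L - 1) W" unfolding WV using fin[OF n(1)] by blast+
    show "energyT J h L (proj L ` W) = crit_energy"
      unfolding WV eS[OF n(1)] energy_def n(3,4) sP crit_energy_def by (simp add: algebra_simps)
    have "({}, proj L ` \<phi> ` P) \<in> (reachT J h L crit_energy)\<^sup>*"
      using shrink_to_empty[OF _ le_refl oP] p_facts(3) by simp
    then show "({}, proj L ` \<phi> ` V1) \<in> (reachT J h L crit_energy)\<^sup>*" using lift[OF n(7)] by (rule rtrancl_trans)
    show "(proj L ` \<phi> ` V2, Lam L) \<in> (reachT J h L crit_energy)\<^sup>*"
      using lift[OF n(8)] grow_from_supercritical[OF oH] by (rule rtrancl_trans)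
    show "adj1 (proj L ` \<phi> ` V1) (proj L ` W)" "adj1 (proj L ` W) (proj L ` \<phi> ` V2)"
      using adj1_image[OF inj n(10,1,5)] adj1_image[OF inj n(1,11,6)] by (simp_all add: WV image_image)
    show "proj L ` \<phi> ` V1 \<subseteq> Lam L" "proj L ` \<phi> ` V2 \<subseteq> Lam L" using proj_in_Lam[OF L_pos] by blast+
    show "energyT J h L (proj L ` \<phi> ` V2) < crit_energy" using eS[OF n(11)] n(13) by simp
  qed
qed

lemma adj1_flip:
  assumes "adj1 A B" "A \<subseteq> Lam L" "B \<subseteq> Lam L"
  shows "\<exists>x\<in>Lam L. conf L B = flip (conf L A) x"
proof -
  obtain f where "f \<notin> A \<and> B = insert f A \<or> f \<notin> B \<and> A = insert f B" using assms(1) unfolding adj1_def by blast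
  then show ?thesis using conf_insert[of f L A] conf_insert[of f L B] assms(2,3) by blast
qed

lemma conf_all: "conf L {} = all_minus L" "conf L (Lam L) = all_plus L"
  by (auto simp: conf_def all_minus_def all_plus_def)

theorem single_saddle_path:
  assumes W: "gate_shape p W"
  obtains \<omega> where "is_path L \<omega>" "hd \<omega> = all_minus L" "last \<omega> = all_plus L" "conf L (proj L ` W) \<in> set \<omega>"
    "\<And>\<sigma>. \<sigma> \<in> set \<omega> \<Longrightarrow> \<sigma> \<noteq> conf L (proj L ` W) \<Longrightarrow> energyT J h L (plus_set L \<sigma>) < crit_energy"
proof -
  obtain B1 B2 where B: "finite W" "fits (L - 1) W" "energyT J h L (proj L ` W) = crit_energy"
    "({}, B1) \<in> (reachT J h L crit_energy)\<^sup>*" "(B2, Lam L) \<in> (reachT J h L crit_energy)\<^sup>*"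
    "adj1 B1 (proj L ` W)" "adj1 (proj L ` W) B2" "B1 \<subseteq> Lam L" "B2 \<subseteq> Lam L" "energyT J h L B2 < crit_energy"
    using gate_shape_path[OF W] .
  have "0 < crit_energy" using below_crit[of 2] p_facts(3) J_bounds h_pos by (simp add: max_area_def)
  then have e0: "energyT J h L {} < crit_energy" by (simp add: energyT_empty)
  obtain \<omega>1 where 1: "is_path L \<omega>1" "hd \<omega>1 = conf L {}" "last \<omega>1 = conf L B1"
    "\<forall>\<sigma>\<in>set \<omega>1. energyT J h L (plus_set L \<sigma>) < crit_energy"
    using reachT_path[OF B(4) _ e0] by auto
  obtain \<omega>2 where 2: "is_path L \<omega>2" "hd \<omega>2 = conf L B2" "last \<omega>2 = conf L (Lam L)"
    "\<forall>\<sigma>\<in>set \<omega>2. energyT J h L (plus_set L \<sigma>) < crit_energy"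
    using reachT_path[OF B(5) B(9,10)] by auto
  have WL: "proj L ` W \<subseteq> Lam L" using proj_in_Lam[OF L_pos] by blast
  have ne: "\<omega>1 \<noteq> []" "\<omega>2 \<noteq> []" using 1(1) 2(1) by (simp_all add: is_path_def)
  let ?\<omega> = "\<omega>1 @ conf L (proj L ` W) # \<omega>2"
  show thesis
  proof (rule that)
    show "is_path L ?\<omega>"
      using 1(1,3) 2(1,2) conf_Conf adj1_flip[OF B(6,8) WL] adj1_flip[OF B(7) WL B(9)] ne
      unfolding is_path_successively by (cases \<omega>2) (auto simp: successively_append_iff)
    show "hd ?\<omega> = all_minus L" "last ?\<omega> = all_plus L" using 1(2) 2(3) ne conf_all by simp_all
    show "conf L (proj L ` W) \<in> set ?\<omega>" by simp
    show "energyT J h L (plus_set L \<sigma>) < crit_energy" if "\<sigma> \<in> set ?\<omega>" "\<sigma> \<noteq> conf L (proj L ` W)" for \<sigma>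
      using that 1(4) 2(4) by auto
  qed
qed

lemma Qstar_opt:
  assumes "p = 6 * r + 5 \<and> delta J h < 1 / 2 \<or> p = 6 * r + 7 \<and> \<not> delta J h < 1 / 2" "rstar J h = r"
  shows "opt_hex p (Qstar J h)"
proof -
  have I: "opt_params n x0 x1 y0 y1 z0 z1 \<Longrightarrow> opt_hex n (hexa x0 x1 y0 y1 z0 z1)" for n x0 x1 y0 y1 z0 z1
    unfolding opt_hex_def by blast
  from assms(1) show ?thesis
  proof (elim disjE conjE)
    assume "p = 6 * r + 5" "delta J h < 1 / 2"
    then have Q: "Qstar J h = Tshape (3 * r + 2) r r (r + 1)" using assms(2) by (simp add: Qstar_def Let_def)
    show ?thesis unfolding Q Tshape_hexa \<open>p = _\<close> by (rule I) (simp add: opt_params_def)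
  next
    assume "p = 6 * r + 7" "\<not> delta J h < 1 / 2"
    then have Q: "Qstar J h = Tshape (3 * r + 3) r (r + 1) (r + 1)" using assms(2) by (simp add: Qstar_def Let_def)
    show ?thesis unfolding Q Tshape_hexa \<open>p = _\<close> by (rule I) (simp add: opt_params_def)
  qed
qed

end

section \<open>Minimal gates\<close>

text \<open>On the line \<open>y = 0\<close> the boundary edges form the single interval from
  \<open>- z1\<close> to \<open>x1\<close>, so a maximal run is the entire side.\<close>

lemma bottom_side_hexa:
  assumes "x0 + z1 \<le> 0" "x1 + z0 \<le> 0" "0 \<le> y1" "1 \<le> l"
  shows "bottom_side (hexa x0 x1 0 y1 z0 z1) l X \<longleftrightarrow> X = - z1 \<and> int l = x1 + z1 + 1"
proof -
  have mem: "(x, 0, True) \<in> hexa x0 x1 0 y1 z0 z1 \<and> (x, -1, False) \<notin> hexa x0 x1 0 y1 z0 z1 \<longleftrightarrow> - z1 \<le> x \<and> x \<le> x1" for x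
    using assms by auto
  have "bottom_side (hexa x0 x1 0 y1 z0 z1) l X \<longleftrightarrow>
      (\<forall>k. 0 \<le> k \<and> k < int l \<longrightarrow> - z1 \<le> X + k \<and> X + k \<le> x1) \<and>
      \<not> (- z1 \<le> X - 1 \<and> X - 1 \<le> x1) \<and> \<not> (- z1 \<le> X + int l \<and> X + int l \<le> x1)"
    unfolding bottom_side_def mem ..
  also have "\<dots> \<longleftrightarrow> X = - z1 \<and> int l = x1 + z1 + 1"
  proof
    assume *: "(\<forall>k. 0 \<le> k \<and> k < int l \<longrightarrow> - z1 \<le> X + k \<and> X + k \<le> x1) \<and>
      \<not> (- z1 \<le> X - 1 \<and> X - 1 \<le> x1) \<and> \<not> (- z1 \<le> X + int l \<and> X + int l \<le> x1)"
    have "- z1 \<le> X \<and> X \<le> x1" "- z1 \<le> X + (int l - 1) \<and> X + (int l - 1) \<le> x1"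
      using *[THEN conjunct1, THEN spec, of 0] *[THEN conjunct1, THEN spec, of "int l - 1"] assms(4) by simp_all
    then show "X = - z1 \<and> int l = x1 + z1 + 1" using *[THEN conjunct2] by linarith
  qed auto
  finally show ?thesis .
qed

lemma bottom_side_level:
  assumes "bottom_side (hexa x0 x1 y0 y1 z0 z1) l X" "1 \<le> l"
  shows "y0 = 0"
proof -
  have "(X + 0, 0, True) \<in> hexa x0 x1 y0 y1 z0 z1 \<and> (X + 0, -1, False) \<notin> hexa x0 x1 y0 y1 z0 z1"
    by (rule assms(1)[unfolded bottom_side_def, THEN conjunct1, THEN spec, THEN mp]) (use assms(2) in simp)
  then show ?thesis by auto
qed

definition bar_pair :: "int \<Rightarrow> int \<Rightarrow> face set \<Rightarrow> bool" where
  "bar_pair X j R \<longleftrightarrow> R = {t_face X j, u_face X j} \<or> R = {t_face X (j + 1), u_face X j} \<or> R = {t_face X j, t_face X (j + 1)}"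

lemma shapes_cases:
  "W \<in> S_shapes J h \<union> D_shapes J h \<longleftrightarrow> (\<exists>g hh X j R. lattice_sym g \<and> lattice_sym hh \<and>
     bottom_side (img hh (Qstar J h)) (ell J h) X \<and> 1 \<le> j \<and> j \<le> int (ell J h) - 1 \<and> bar_pair X j R \<and>
     W = img g (img hh (Qstar J h) \<union> R))"
  (is "_ \<longleftrightarrow> ?rhs")
proof -
  let ?ex = "\<lambda>Q. \<exists>g hh X j R. lattice_sym g \<and> lattice_sym hh \<and>
     bottom_side (img hh (Qstar J h)) (ell J h) X \<and> 1 \<le> j \<and> j \<le> int (ell J h) - 1 \<and> Q X j R \<and>
     W = img g (img hh (Qstar J h) \<union> R)"
  have "W \<in> S_shapes J h \<longleftrightarrow> ?ex (\<lambda>X j R. R = {t_face X j, u_face X j} \<or> R = {t_face X (j + 1), u_face X j})"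
    unfolding S_shapes_def mem_Collect_eq by (intro iffI; elim exE conjE; intro exI conjI; (assumption | rule refl | simp only:))
  moreover have "W \<in> D_shapes J h \<longleftrightarrow> ?ex (\<lambda>X j R. R = {t_face X j, t_face X (j + 1)})"
    unfolding D_shapes_def mem_Collect_eq by (intro iffI; elim exE conjE; intro exI conjI; (assumption | rule refl | simp only:))
  moreover have "?ex (\<lambda>X j R. A X j R \<or> B X j R) \<longleftrightarrow> ?ex A \<or> ?ex B" for A B
    by (simp only: conj_disj_distribL conj_disj_distribR ex_disj_distrib)
  ultimately show ?thesis unfolding Un_iff bar_pair_def disj_assoc[symmetric] by simp
qed

context crit
begin

text \<open>Length \<open>r + 2\<close> singles out the sides on which the next extremal hexagon
  grows: it fixes the height \<open>y1\<close> and the centring value, and these make the enlarged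
  hexagon balanced and centred.\<close>

lemma opt_params_bar:
  assumes "opt_params p x0 x1 0 y1 z0 z1" "int (r + 2) = x1 + z1 + 1"
  shows "hex_bar p x0 x1 0 y1 z0 z1"
proof
  show p: "opt_params p x0 x1 0 y1 z0 z1" by (rule assms(1))
  note p = p[unfolded opt_params_def abs_le_iff]
  have w: "x1 + z1 = int r + 1" using assms(2) by simp
  consider "int p = 6 * int r + 5" | "int p = 6 * int r + 7" using cases_rp by auto
  then show "opt_params (Suc p) x0 x1 (0 - 1) y1 z0 z1"
  proof cases
    case 1
    have "x0 + z0 = - 3 * int r - 1 \<or> x0 + z0 = - 3 * int r - 2" using p 1 by (smt (verit))
    then have "x0 + z0 = - 3 * int r - 1 \<and> y1 = 2 * int r" using p w 1 by linarith
    then show ?thesis using p w 1 unfolding opt_params_def of_nat_Suc abs_le_iff distrib_left right_diff_distrib by (intro conjI) linarith+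
  next
    case 2
    have "x0 + z0 = - 3 * int r - 2 \<or> x0 + z0 = - 3 * int r - 3" using p 2 by (smt (verit))
    then have "x0 + z0 = - 3 * int r - 2 \<and> y1 = 2 * int r + 1" using p w 2 by linarith
    then show ?thesis using p w 2 unfolding opt_params_def of_nat_Suc abs_le_iff distrib_left right_diff_distrib by (intro conjI) linarith+
  qed
qed

lemma bar_width: "hex_bar p x0 x1 y0 y1 z0 z1 \<Longrightarrow> x1 - hex_bar.lft y0 z1 = int r + 1"
  using hex_bar.bar_length[of p x0 x1 y0 y1 z0 z1] hex_bar.lft_le[of p x0 x1 y0 y1 z0 z1] area_p(2) p_facts(3) by simp

text \<open>One direction reads the side of length \<open>ell\<close> as the place of a bar by
  \<open>opt_params_bar\<close>; the other rests on every extremal hexagon of perimeter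
  \<open>p\<close> being congruent to \<open>Q*\<close>.\<close>

lemma gate_shape_iff:
  assumes Q: "opt_hex p (Qstar J h)" and l: "ell J h = r + 2"
  shows "W \<in> S_shapes J h \<union> D_shapes J h \<longleftrightarrow> gate_shape p W"
proof
  assume "W \<in> S_shapes J h \<union> D_shapes J h"
  then obtain g hh X j R where g: "lattice_sym g" "lattice_sym hh" "bottom_side (img hh (Qstar J h)) (r + 2) X"
    "1 \<le> j" "j \<le> int (r + 2) - 1" "bar_pair X j R" "W = img g (img hh (Qstar J h) \<union> R)"
    unfolding shapes_cases l by (elim exE conjE)
  obtain \<psi> where \<psi>: "lat_face \<psi>" "\<And>F. img g F = \<psi> ` F" by (rule lattice_sym_lat_face[OF g(1)]) blast
  obtain \<chi> where \<chi>: "lat_face \<chi>" "\<And>F. img hh F = \<chi> ` F" by (rule lattice_sym_lat_face[OF g(2)]) blast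
  have "opt_hex p (img hh (Qstar J h))"
    unfolding \<chi>(2) using opt_hex_image[OF _ Q lat_face_iso[OF \<chi>(1)]] p_facts(3) by simp
  then obtain x0 x1 y0 y1 z0 z1 where op: "opt_params p x0 x1 y0 y1 z0 z1" and H: "img hh (Qstar J h) = hexa x0 x1 y0 y1 z0 z1"
    by (rule opt_hexE)
  have y0: "y0 = 0" using bottom_side_level[of x0 x1 y0 y1 z0 z1 "r + 2"] g(3) unfolding H by simp
  note op = op[unfolded y0] and H = H[unfolded y0]
  have "x0 + z1 \<le> 0 \<and> x1 + z0 \<le> 0 \<and> 0 \<le> y1"
    using op p_facts(3) unfolding opt_params_def by (smt (verit))
  then have X: "X = - z1" "int (r + 2) = x1 + z1 + 1"
    using bottom_side_hexa[of x0 z1 x1 z0 y1 "r + 2" X] g(3) unfolding H by simp_all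
  have hb: "hex_bar p x0 x1 0 y1 z0 z1" by (rule opt_params_bar[OF op X(2)])
  then interpret hex_bar p x0 x1 0 y1 z0 z1 .
  have P: "img hh (Qstar J h) = P" unfolding H P_def ..
  have "t_face X j = tt (X + j - 1)" "t_face X (j + 1) = tt (X + j - 1 + 1)" "u_face X j = uu (X + j - 1 + 1)"
    by (simp_all add: t_face_def u_face_def tt_def uu_def)
  then have "P \<union> R \<in> gate_sets"
    using g(4-6) X unfolding gate_sets_def bar_pair_def lft_def
    by (intro CollectI exI[of _ R] exI[of _ "X + j - 1"]) simp
  then show "gate_shape p W" unfolding g(7) P \<psi>(2) by (rule gate_shapeI[OF \<psi>(1) hb])
next
  assume "gate_shape p W"
  then obtain \<phi> x0 x1 y0 y1 z0 z1 V where \<phi>: "lat_face \<phi>" and hb: "hex_bar p x0 x1 y0 y1 z0 z1"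
    and V: "V \<in> hex_bar.gate_sets x0 x1 y0 y1 z0 z1" and W: "W = \<phi> ` V"
    unfolding gate_shape_def by (elim exE conjE)
  interpret hex_bar p x0 x1 y0 y1 z0 z1 by (rule hb)
  obtain R x where R: "V = P \<union> R" "lft \<le> x" "x < x1"
    "R = {tt x, uu (x + 1)} \<or> R = {tt (x + 1), uu (x + 1)} \<or> R = {tt x, tt (x + 1)}"
    using V unfolding gate_sets_def by blast
  \<comment> \<open>Moves the lower side of \<open>P\<close> to the line \<open>y = 0\<close>, where
    \<open>bottom_side\<close> expects it.\<close>
  let ?T = "trf 0 (- y0)"
  have TP: "?T ` P = hexa x0 x1 0 (y1 - y0) (z0 + y0) (z1 + y0)" by (simp add: P_def image_trf_hexa)
  have "opt_hex p (?T ` P)" using opt_hex_image[OF _ opt_hex_PH(1) face_iso_trf] p_facts(3) by simp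
  then obtain \<chi> where \<chi>: "lat_face \<chi>" "?T ` P = \<chi> ` Qstar J h"
    using opt_hex_congruent[OF p_facts(1,2) Q] by metis
  obtain hh where hh: "lattice_sym hh" "\<And>F. img hh F = \<chi> ` F" by (rule lat_face_img[OF \<chi>(1)]) blast
  obtain g where g: "lattice_sym g" "\<And>F. img g F = (\<lambda>f. \<phi> (trf 0 y0 f)) ` F"
    using lat_face_img[OF lat_face_comp[OF \<phi> lat_face_trf[of 0 y0]]] unfolding comp_def by metis
  have bs: "bottom_side (img hh (Qstar J h)) (r + 2) lft"
    unfolding hh(2) \<chi>(2)[symmetric] TP
    by (subst bottom_side_hexa) (use ineqs bar_width[OF hb] in \<open>simp_all add: lft_def\<close>)
  have bp: "bar_pair lft (x - lft + 1) (?T ` R)"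
  proof -
    have "?T (tt x) = t_face lft (x - lft + 1)" "?T (tt (x + 1)) = t_face lft (x - lft + 1 + 1)"
      "?T (uu (x + 1)) = u_face lft (x - lft + 1)"
      by (simp_all add: t_face_def u_face_def tt_def uu_def)
    then show ?thesis using R(4) unfolding bar_pair_def by (elim disjE) (simp_all del: trf.simps)
  qed
  have WV: "W = img g (img hh (Qstar J h) \<union> ?T ` R)"
    unfolding W g(2) hh(2) \<chi>(2)[symmetric] R(1) image_Un[symmetric] image_image by simp
  show "W \<in> S_shapes J h \<union> D_shapes J h"
    unfolding shapes_cases l
    by (rule exI[of _ g], rule exI[of _ hh], rule exI[of _ lft], rule exI[of _ "x - lft + 1"], rule exI[of _ "?T ` R"])
      (use g(1) hh(1) bs bp WV R(2,3) bar_width[OF hb] in \<open>simp del: split_paired_Ex\<close>)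
qed

lemma gate_shape_exists:
  assumes "opt_hex p Q"
  obtains W where "gate_shape p W"
proof -
  obtain \<phi> x0 x1 y0 y1 z0 z1 where hb: "hex_bar p x0 x1 y0 y1 z0 z1" using opt_hex_succ[OF assms] by metis
  interpret hex_bar p x0 x1 y0 y1 z0 z1 by (rule hb)
  have "P \<union> {tt lft, uu (lft + 1)} \<in> gate_sets"
    unfolding gate_sets_def using bar_width[OF hb]
    by (intro CollectI exI[of _ "{tt lft, uu (lft + 1)}"] exI[of _ lft]) simp
  from gate_shapeI[OF lat_face_id hb this] that show thesis by blast
qed

end

section \<open>From single-saddle paths to the unique minimal gate\<close>

lemma finite_Conf: "finite (Conf L)"
proof -
  have "finite {\<sigma>. \<forall>x. (x \<in> Lam L \<longrightarrow> \<sigma> x \<in> {1, - 1 :: int}) \<and> (x \<notin> Lam L \<longrightarrow> \<sigma> x = 0)}"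
    by (rule finite_set_of_finite_funs) (simp_all add: finite_Lam)
  then show ?thesis by (rule rev_finite_subset) (auto simp: Conf_def simp del: split_paired_All)
qed

lemma path_max_le_iff:
  "\<omega> \<in> paths L \<sigma> \<eta> \<Longrightarrow> path_max J h L \<omega> \<le> C \<longleftrightarrow> (\<forall>\<zeta>\<in>set \<omega>. Ham J h L \<zeta> \<le> C)"
  unfolding path_max_def paths_def is_path_def by (subst Max_le_iff) auto

lemma finite_path_max: "finite (path_max J h L ` paths L \<sigma> \<eta>)"
proof (rule finite_subset)
  show "path_max J h L ` paths L \<sigma> \<eta> \<subseteq> Ham J h L ` Conf L"
  proof (rule image_subsetI)
    fix \<omega> assume \<omega>: "\<omega> \<in> paths L \<sigma> \<eta>"
    then have "path_max J h L \<omega> \<in> Ham J h L ` set \<omega>"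
      unfolding path_max_def by (intro Max_in) (auto simp: paths_def is_path_def)
    then show "path_max J h L \<omega> \<in> Ham J h L ` Conf L" using \<omega> unfolding paths_def is_path_def by blast
  qed
qed (simp add: finite_Conf)

text \<open>Paths below \<open>C\<close> would miss \<open>G\<close>, and some path has maximum
  \<open>C\<close>; so the communication height is \<open>C\<close>. A gate consists of saddles, all
  of height \<open>C\<close>, so on a path with only one such point it must contain that point.
  Hence every gate contains \<open>G\<close>, and the union of all minimal gates has a single
  member.\<close>

lemma unique_min_gate:
  assumes height: "\<And>\<zeta>. \<zeta> \<in> G \<Longrightarrow> Ham J h L \<zeta> = C"
    and meets: "\<And>\<omega>. \<omega> \<in> paths L \<sigma> \<eta> \<Longrightarrow> (\<forall>\<zeta>\<in>set \<omega>. Ham J h L \<zeta> \<le> C) \<Longrightarrow> set \<omega> \<inter> G \<noteq> {}"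
    and single: "\<And>\<zeta>. \<zeta> \<in> G \<Longrightarrow> \<exists>\<omega>\<in>paths L \<sigma> \<eta>. \<zeta> \<in> set \<omega> \<and> (\<forall>\<xi>\<in>set \<omega>. \<xi> \<noteq> \<zeta> \<longrightarrow> Ham J h L \<xi> < C)"
    and ne: "G \<noteq> {}"
  shows "\<forall>\<omega>\<in>opt_paths J h L \<sigma> \<eta>. set \<omega> \<inter> G \<noteq> {}" "{W. is_min_gate J h L \<sigma> \<eta> W} = {G}"
proof -
  let ?\<Phi> = "Phi J h L \<sigma> \<eta>"
  have low: "C \<le> path_max J h L \<omega>" if "\<omega> \<in> paths L \<sigma> \<eta>" for \<omega>
  proof (rule ccontr)
    assume "\<not> C \<le> path_max J h L \<omega>"
    then have less: "path_max J h L \<omega> < C" by simp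
    then have "set \<omega> \<inter> G \<noteq> {}" using meets[OF that] path_max_le_iff[OF that, of J h C] by simp
    then obtain \<zeta> where "\<zeta> \<in> set \<omega>" "\<zeta> \<in> G" by blast
    then have "C \<le> path_max J h L \<omega>" using path_max_le_iff[OF that, of J h "path_max J h L \<omega>"] height by fastforce
    then show False using less by simp
  qed
  have single': "\<exists>\<omega>\<in>paths L \<sigma> \<eta>. \<zeta> \<in> set \<omega> \<and> (\<forall>\<xi>\<in>set \<omega>. \<xi> \<noteq> \<zeta> \<longrightarrow> Ham J h L \<xi> < C) \<and> path_max J h L \<omega> = C"
    if \<zeta>: "\<zeta> \<in> G" for \<zeta>
  proof -
    obtain \<omega> where \<omega>: "\<omega> \<in> paths L \<sigma> \<eta>" "\<zeta> \<in> set \<omega>" "\<forall>\<xi>\<in>set \<omega>. \<xi> \<noteq> \<zeta> \<longrightarrow> Ham J h L \<xi> < C"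
      using single[OF \<zeta>] by blast
    have "path_max J h L \<omega> \<le> C" unfolding path_max_le_iff[OF \<omega>(1)] using \<omega>(3) height[OF \<zeta>] by fastforce
    then show ?thesis using low[OF \<omega>(1)] \<omega> by (intro bexI[of _ \<omega>]) simp_all
  qed
  obtain \<zeta>0 where "\<zeta>0 \<in> G" using ne by blast
  then obtain \<omega>0 where "\<omega>0 \<in> paths L \<sigma> \<eta>" "path_max J h L \<omega>0 = C" using single' by blast
  then have \<Phi>: "?\<Phi> = C" unfolding Phi_def by (intro Min_eqI[OF finite_path_max]) (use low in auto)
  have opt: "\<omega> \<in> opt_paths J h L \<sigma> \<eta> \<longleftrightarrow> \<omega> \<in> paths L \<sigma> \<eta> \<and> path_max J h L \<omega> = C" for \<omega>
    unfolding opt_paths_def \<Phi> by simp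
  show 1: "\<forall>\<omega>\<in>opt_paths J h L \<sigma> \<eta>. set \<omega> \<inter> G \<noteq> {}"
  proof
    fix \<omega> assume "\<omega> \<in> opt_paths J h L \<sigma> \<eta>"
    then have \<omega>: "\<omega> \<in> paths L \<sigma> \<eta>" "path_max J h L \<omega> = C" unfolding opt by simp_all
    have "\<forall>\<zeta>\<in>set \<omega>. Ham J h L \<zeta> \<le> C"
      unfolding path_max_le_iff[OF \<omega>(1), symmetric] using \<omega>(2) by simp
    then show "set \<omega> \<inter> G \<noteq> {}" by (rule meets[OF \<omega>(1)])
  qed
  have "G \<subseteq> min_saddles J h L \<sigma> \<eta>"
  proof
    fix \<zeta> assume "\<zeta> \<in> G"
    with single'[OF this] height[OF this] show "\<zeta> \<in> min_saddles J h L \<sigma> \<eta>"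
      unfolding min_saddles_def \<Phi> using opt by blast
  qed
  with 1 have gate: "is_gate J h L \<sigma> \<eta> G" unfolding is_gate_def by blast
  have sub: "G \<subseteq> W" if W: "is_gate J h L \<sigma> \<eta> W" for W
  proof
    fix \<zeta> assume \<zeta>: "\<zeta> \<in> G"
    obtain \<omega> where \<omega>: "\<omega> \<in> paths L \<sigma> \<eta>" "\<forall>\<xi>\<in>set \<omega>. \<xi> \<noteq> \<zeta> \<longrightarrow> Ham J h L \<xi> < C" "path_max J h L \<omega> = C"
      using single'[OF \<zeta>] by blast
    then have "set \<omega> \<inter> W \<noteq> {}" using W opt unfolding is_gate_def by blast
    then obtain \<xi> where \<xi>: "\<xi> \<in> set \<omega>" "\<xi> \<in> W" by blast
    then have "Ham J h L \<xi> = C" using W unfolding is_gate_def min_saddles_def \<Phi> by blast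
    then show "\<zeta> \<in> W" using \<omega>(2) \<xi> by force
  qed
  show "{W. is_min_gate J h L \<sigma> \<eta> W} = {G}"
    unfolding is_min_gate_def using gate sub by blast
qed

lemma (in crit) crit_gates:
  assumes Q: "opt_hex p (Qstar J h)" and l: "ell J h = r + 2"
  shows "\<forall>\<omega>\<in>opt_paths J h L (all_minus L) (all_plus L). set \<omega> \<inter> (S_tilde J h L \<union> D_tilde J h L) \<noteq> {}"
    "{W. is_min_gate J h L (all_minus L) (all_plus L) W} = {S_tilde J h L \<union> D_tilde J h L}"
proof -
  let ?G = "S_tilde J h L \<union> D_tilde J h L"
  let ?C = "Ham J h L (all_minus L) + crit_energy"
  have L2: "2 \<le> L" using p_facts(4) by simp
  have G: "\<sigma> \<in> ?G \<longleftrightarrow> \<sigma> \<in> Conf L \<and> (\<exists>W. gate_shape p W \<and> plus_set L \<sigma> = proj L ` W)" for \<sigma>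
    unfolding gate_shape_iff[OF Q l, symmetric] S_tilde_def D_tilde_def by blast
  have WL: "proj L ` W \<subseteq> Lam L" for W using proj_in_Lam[OF L_pos] by blast
  have height: "Ham J h L \<zeta> = ?C" if \<zeta>: "\<zeta> \<in> ?G" for \<zeta>
  proof -
    obtain W where W: "gate_shape p W" "plus_set L \<zeta> = proj L ` W" "\<zeta> \<in> Conf L" using \<zeta> unfolding G by blast
    have "energyT J h L (proj L ` W) = crit_energy" by (rule gate_shape_path[OF W(1)])
    then show ?thesis using Ham_energyT[OF L2 W(3)] W(2) by simp
  qed
  have meets: "set \<omega> \<inter> ?G \<noteq> {}"
    if \<omega>: "\<omega> \<in> paths L (all_minus L) (all_plus L)" and le: "\<forall>\<zeta>\<in>set \<omega>. Ham J h L \<zeta> \<le> ?C" for \<omega>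
  proof -
    have p: "is_path L \<omega>" "hd \<omega> = all_minus L" "last \<omega> = all_plus L" using \<omega> by (simp_all add: paths_def)
    have cf: "\<sigma> \<in> Conf L" if "\<sigma> \<in> set \<omega>" for \<sigma> using p(1) that unfolding is_path_def by blast
    have "energyT J h L (plus_set L \<sigma>) \<le> crit_energy" if "\<sigma> \<in> set \<omega>" for \<sigma>
      using bspec[OF le that] Ham_energyT[OF L2 cf[OF that], of J h] by simp
    from path_visits_gate[OF p this] obtain \<sigma> where "\<sigma> \<in> set \<omega>" "gateT (plus_set L \<sigma>)" by blast
    moreover from this have "\<sigma> \<in> ?G" unfolding G gateT_def using cf by blast
    ultimately show ?thesis by blast
  qed
  have single: "\<exists>\<omega>\<in>paths L (all_minus L) (all_plus L). \<zeta> \<in> set \<omega> \<and> (\<forall>\<xi>\<in>set \<omega>. \<xi> \<noteq> \<zeta> \<longrightarrow> Ham J h L \<xi> < ?C)"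
    if \<zeta>: "\<zeta> \<in> ?G" for \<zeta>
  proof -
    obtain W where W: "gate_shape p W" "plus_set L \<zeta> = proj L ` W" "\<zeta> \<in> Conf L" using \<zeta> unfolding G by blast
    have eq: "conf L (proj L ` W) = \<zeta>" using conf_plus_set[OF W(3)] W(2) by simp
    obtain \<omega> where \<omega>: "is_path L \<omega>" "hd \<omega> = all_minus L" "last \<omega> = all_plus L" "\<zeta> \<in> set \<omega>"
      "\<And>\<sigma>. \<sigma> \<in> set \<omega> \<Longrightarrow> \<sigma> \<noteq> \<zeta> \<Longrightarrow> energyT J h L (plus_set L \<sigma>) < crit_energy"
      using single_saddle_path[OF W(1), unfolded eq] by metis
    have "Ham J h L \<xi> < ?C" if "\<xi> \<in> set \<omega>" "\<xi> \<noteq> \<zeta>" for \<xi>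
    proof -
      have "\<xi> \<in> Conf L" using \<omega>(1) that(1) unfolding is_path_def by blast
      then show ?thesis using Ham_energyT[OF L2, of \<xi> J h] \<omega>(5)[OF that] by simp
    qed
    then show ?thesis using \<omega>(1-4) by (intro bexI[of _ \<omega>]) (simp_all add: paths_def)
  qed
  obtain W where W: "gate_shape p W" by (rule gate_shape_exists[OF Q])
  have "conf L (proj L ` W) \<in> ?G" unfolding G using W conf_Conf plus_set_conf[OF WL] by blast
  then have "?G \<noteq> {}" by blast
  from unique_min_gate[OF height meets single this]
  show "\<forall>\<omega>\<in>opt_paths J h L (all_minus L) (all_plus L). set \<omega> \<inter> ?G \<noteq> {}"
    "{W. is_min_gate J h L (all_minus L) (all_plus L) W} = {?G}" by simp_all
qed

text \<open>The assumption gives \<open>8 q^2 \<le> L^2\<close>, and 14/5 is just below the square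
  root of 8, as 196 < 200.\<close>

lemma torus_size:
  assumes "0 < h" "h * real q < J" "real_of_int (2 * L ^ 2) \<ge> (4 * J / h) ^ 2" "1 \<le> L"
  shows "14 * int q + 1 \<le> 5 * L"
proof -
  have "4 * real q < 4 * J / h" using assms(1,2) by (simp add: field_simps)
  then have "(4 * real q) ^ 2 \<le> (4 * J / h) ^ 2" by (intro power_mono) simp_all
  then have "real_of_int (16 * int q ^ 2) \<le> real_of_int (2 * L ^ 2)" using assms(3) by (simp add: power2_eq_square)
  then have le: "8 * int q ^ 2 \<le> L ^ 2" by linarith
  show ?thesis
  proof (cases "q = 0")
    case False
    have "0 < int q ^ 2" using False by simp
    then have "196 * int q ^ 2 < 25 * L ^ 2" using le by linarith
    then have "(14 * int q) ^ 2 < (5 * L) ^ 2" by (simp only: power_mult_distrib) simp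
    then have "14 * int q < 5 * L" by (rule power_less_imp_less_base) (use assms(4) in simp)
    then show ?thesis by simp
  qed (use assms(4) in simp)
qed

theorem theorem2p10:
  fixes J h :: real and L :: int
  assumes "L \<ge> 1"
    and "0 < h" and "h < 1"
    and "J \<ge> 2 * h"
    and "J / (2 * h) - 1 / 2 \<notin> \<int>"
    and "delta J h \<noteq> 1 / 2"
    and "real_of_int (2 * L^2) \<ge> (4 * J / h)^2"
  shows "(\<forall>\<omega>\<in>opt_paths J h L (all_minus L) (all_plus L).
            set \<omega> \<inter> (S_tilde J h L \<union> D_tilde J h L) \<noteq> {})
       \<and> S_tilde J h L \<union> D_tilde J h L =
           \<Union> {W. is_min_gate J h L (all_minus L) (all_plus L) W}"
proof -
  define r where "r = rstar J h"
  define d where "d = delta J h"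
  let ?x = "J / (2 * h) - 1 / 2"
  have x: "1 / 2 \<le> ?x" using assms(2,4) by (simp add: field_simps)
  have r: "real r = of_int \<lfloor>?x\<rfloor>" using x unfolding r_def rstar_def by (simp add: le_floor_iff)
  have d: "d = ?x - real r" by (simp add: d_def delta_def r_def)
  have "?x \<noteq> real r" using assms(5) by (metis Ints_of_nat)
  then have d01: "0 < d" "d < 1" unfolding d r by linarith+
  have J: "J = h * (2 * real r + 2 * d + 1)" unfolding d using assms(2) by (simp add: field_simps)
  have d12: "d \<noteq> 1 / 2" using assms(6) by (simp add: d_def)
  obtain p where p: "p = 6 * r + 5 \<and> d < 1 / 2 \<or> p = 6 * r + 7 \<and> \<not> d < 1 / 2" by blast
  have "crit J h L r p"
  proof
    show "0 < h" "0 < L" using assms(1,2) by simp_all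
    show "(p = 6 * r + 5 \<and> 1 \<le> r \<and> h * (2 * real r + 1) < J \<and> J < h * (2 * real r + 2) \<and> 28 * int r + 15 \<le> 5 * L) \<or>
      (p = 6 * r + 7 \<and> h * (2 * real r + 2) < J \<and> J < h * (2 * real r + 3) \<and> 28 * int r + 29 \<le> 5 * L)"
    proof (cases "d < 1 / 2")
      case True
      \<comment> \<open>\<open>J \<ge> 2 h\<close> makes \<open>?x\<close> at least 1/2, so a
        fractional part below 1/2 excludes \<open>r = 0\<close>.\<close>
      have "r \<noteq> 0" using True x unfolding d by (metis diff_zero not_le of_nat_0)
      moreover have lo: "h * (2 * real r + 1) < J" and "J < h * (2 * real r + 2)"
        unfolding J using True d01 assms(2) by (simp_all add: mult_less_cancel_left_pos)
      moreover have "28 * int r + 15 \<le> 5 * L"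
        using torus_size[OF assms(2) _ assms(7,1), of "2 * r + 1"] lo by (simp add: add.commute)
      ultimately show ?thesis using p True by simp
    next
      case False
      \<comment> \<open>The lower bound is strict because \<open>delta\<close> differs from
        1/2.\<close>
      have lo: "h * (2 * real r + 2) < J" and "J < h * (2 * real r + 3)"
        unfolding J using False d01 d12 assms(2) by (simp_all add: mult_less_cancel_left_pos)
      moreover have "28 * int r + 29 \<le> 5 * L"
        using torus_size[OF assms(2) _ assms(7,1), of "2 * r + 2"] lo by (simp add: add.commute)
      ultimately show ?thesis using p False by simp
    qed
  qed
  then interpret crit J h L r p .
  have "opt_hex p (Qstar J h)" by (rule Qstar_opt) (use p in \<open>simp_all add: d_def r_def\<close>)
  moreover have "ell J h = r + 2" by (simp add: ell_def r_def)
  ultimately show ?thesis using crit_gates by simp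
qed

end
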